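(* Let $\mathcal M\in\mathfrak B_1(\Omega)$ with reproducing kernel $K$, write $K_w:=K(\cdot,w)$, let $w_0\in\Omega$, and let $g^0_1,\dots,g^0_d$ be (holomorphic functions near $w_0$ whose germs form) a minimal set of generators of the $\mathcal O_{w_0}$-module $\mathcal S^{\mathcal M}_{w_0}$. Then: (i) there exist an open neighborhood $\Omega_0$ of $w_0$ and anti-holomorphic functions $K^{(1)},\dots,K^{(d)}:\Omega_0\to\mathcal M$, $w\mapsto K^{(i)}_w$, such that $$K_w=\overline{g^0_1(w)}\,K^{(1)}_w+\cdots+\overline{g^0_d(w)}\,K^{(d)}_w,\qquad w\in\Omega_0;$$ (ii) the vectors $K^{(i)}_w$, $1\le i\le d$, are linearly independent in $\mathcal M$ for all $w$ in some neighborhood of $w_0$; (iii) the vectors $K^{(i)}_{w_0}$, $1\le i\le d$, are uniquely determined by the generators $g^0_1,\dots,g^0_d$ (i.e. they are the same for every decomposition as in (i)); (iv) the linear span of $\{K^{(i)}_{w_0}:1\le i\le d\}$ in $\mathcal M$ is independent of the choice of the minimal set of generators $g^0_1,\dots,g^0_d$; (v) $M_p^*K^{(i)}_{w_0}=\overline{p(w_0)}\,K^{(i)}_{w_0}$ for all $1\le i\le d$ and every polynomial $p\in\mathbb C[z_1,\dots,z_m]$, where $M_p$ denotes module multiplication by $p$ on $\mathcal M$.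
   Context: $\Omega\subset\mathbb C^m$ is a bounded domain and $\mathfrak m_w\subset\mathbb C[\underline z]=\mathbb C[z_1,\dots,z_m]$ is the maximal ideal of polynomials vanishing at $w$. A Hilbert module over $\mathbb C[\underline z]$ is a Hilbert space with a $\mathbb C[\underline z]$-module structure in which every polynomial acts as a bounded operator. The class $\mathfrak B_1(\Omega)$ consists of the Hilbert modules $\mathcal M$ over $\mathbb C[\underline z]$ whose elements are holomorphic functions on $\Omega$, with module action given by pointwise multiplication, such that (rk) $\mathcal M$ has a reproducing kernel $K$ (that is, $K(\cdot,w)\in\mathcal M$ and $f(w)=\langle f,K(\cdot,w)\rangle$; the value $K(w,w)=0$ is allowed), and (fin) $\dim\mathcal M/\mathfrak m_w\mathcal M<\infty$ for all $w\in\Omega$, where $\mathfrak m_w\mathcal M=\{\sum_{j=1}^m(z_j-w_j)f_j:f_j\in\mathcal M\}$. $\mathcal O_w$ is the ring of germs of holomorphic functions at $w$. $\mathcal S^{\mathcal M}$ is the subsheaf of $\mathcal O_\Omega$ whose stalk at $w\in\Omega$ is the ideal of $\mathcal O_w$ generated by the germs at $w$ of all $f\in\mathcal M$. *)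

theory Defs
  imports
    "HOL-Analysis.Analysis"
    "HOL-Library.Function_Algebras"
    "HOL-Library.Poly_Mapping"
    "HOL-Algebra.Ideal"
begin

section \<open>The complex vector space of functions on \<open>\<complex>\<^sup>m\<close>\<close>

text \<open>A function on \<open>\<Omega>\<close> is represented by a total function that vanishes off \<open>\<Omega>\<close>, so that
  equality of functions on \<open>\<Omega>\<close> is HOL equality; the condition is imposed in \<open>class_B1\<close>.\<close>

type_synonym 'm cfun = "complex ^ 'm \<Rightarrow> complex"

definition cscale :: "complex \<Rightarrow> ('m::finite) cfun \<Rightarrow> 'm cfun" where
  "cscale c f = (\<lambda>z. c * f z)"

interpretation cfun: vector_space "cscale :: complex \<Rightarrow> ('m::finite) cfun \<Rightarrow> 'm cfun"
  by unfold_locales (auto simp: cscale_def fun_eq_iff algebra_simps)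

definition linearly_independent_family :: "nat set \<Rightarrow> (nat \<Rightarrow> ('m::finite) cfun) \<Rightarrow> bool" where
  "linearly_independent_family I v \<longleftrightarrow> inj_on v I \<and> cfun.independent (v ` I)"


section \<open>Holomorphic functions and the ring of germs\<close>

definition holomorphic_fun_on :: "('m::finite) cfun \<Rightarrow> (complex ^ 'm) set \<Rightarrow> bool" where
  "holomorphic_fun_on f S \<longleftrightarrow>
     (\<forall>z\<in>S. \<exists>D. (f has_derivative D) (at z) \<and> (\<forall>c v. D (c *s v) = c * D v))"

definition holomorphic_near :: "complex ^ 'm \<Rightarrow> ('m::finite) cfun \<Rightarrow> bool" where
  "holomorphic_near w f \<longleftrightarrow> (\<exists>U. open U \<and> w \<in> U \<and> holomorphic_fun_on f U)"

definition germ :: "complex ^ 'm \<Rightarrow> ('m::finite) cfun \<Rightarrow> 'm cfun set" where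
  "germ w f = {g. eventually (\<lambda>z. g z = f z) (nhds w)}"

text \<open>In the operations below all members of the union coincide: they do not depend on the
  chosen representatives (see \<open>germ_ring_mult\<close> and \<open>germ_ring_add\<close>).\<close>

definition germ_ring :: "complex ^ 'm \<Rightarrow> ('m::finite) cfun set ring" where
  "germ_ring w = \<lparr>
     carrier = germ w ` {f. holomorphic_near w f},
     monoid.mult = (\<lambda>A B. \<Union>f\<in>A. \<Union>g\<in>B. germ w (f * g)),
     one = germ w 1,
     zero = germ w 0,
     add = (\<lambda>A B. \<Union>f\<in>A. \<Union>g\<in>B. germ w (f + g))\<rparr>"

lemma germ_eq_iff: "germ w f = germ w g \<longleftrightarrow> eventually (\<lambda>z. f z = g z) (nhds w)"
proof
  assume "germ w f = germ w g"
  moreover have "f \<in> germ w f" by (simp add: germ_def)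
  ultimately have "f \<in> germ w g" by simp
  then show "eventually (\<lambda>z. f z = g z) (nhds w)" by (simp add: germ_def)
next
  assume *: "eventually (\<lambda>z. f z = g z) (nhds w)"
  have "eventually (\<lambda>z. h z = f z) (nhds w) \<longleftrightarrow> eventually (\<lambda>z. h z = g z) (nhds w)" for h
    by (rule eventually_cong[OF *]) simp
  then show "germ w f = germ w g"
    by (simp add: germ_def)
qed

lemma germ_self: "f \<in> germ w f"
  by (simp add: germ_def)

lemma germ_ring_mult: "germ w f \<otimes>\<^bsub>germ_ring w\<^esub> germ w g = germ w (f * g)"
proof -
  have "germ w (f' * g') = germ w (f * g)" if "f' \<in> germ w f" "g' \<in> germ w g" for f' g'
    using that unfolding germ_eq_iff unfolding germ_def mem_Collect_eq
    by eventually_elim simp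
  then have "(\<Union>f'\<in>germ w f. \<Union>g'\<in>germ w g. germ w (f' * g')) = germ w (f * g)"
    using germ_self[of f w] germ_self[of g w] by blast
  then show ?thesis
    by (simp add: germ_ring_def)
qed

lemma germ_ring_add: "germ w f \<oplus>\<^bsub>germ_ring w\<^esub> germ w g = germ w (f + g)"
proof -
  have "germ w (f' + g') = germ w (f + g)" if "f' \<in> germ w f" "g' \<in> germ w g" for f' g'
    using that unfolding germ_eq_iff unfolding germ_def mem_Collect_eq
    by eventually_elim simp
  then have "(\<Union>f'\<in>germ w f. \<Union>g'\<in>germ w g. germ w (f' + g')) = germ w (f + g)"
    using germ_self[of f w] germ_self[of g w] by blast
  then show ?thesis
    by (simp add: germ_ring_def)
qed

lemma holomorphic_fun_on_subset:
  "holomorphic_fun_on f S \<Longrightarrow> T \<subseteq> S \<Longrightarrow> holomorphic_fun_on f T"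
  unfolding holomorphic_fun_on_def by blast

lemma holomorphic_fun_on_const: "holomorphic_fun_on (\<lambda>z. c) S"
  unfolding holomorphic_fun_on_def
  by (auto intro!: exI[of _ "\<lambda>v. 0"])

lemma holomorphic_fun_on_add:
  assumes "holomorphic_fun_on f S" "holomorphic_fun_on g S"
  shows "holomorphic_fun_on (f + g) S"
  unfolding holomorphic_fun_on_def
proof
  fix z assume "z \<in> S"
  then obtain D E where "(f has_derivative D) (at z)" "\<forall>c v. D (c *s v) = c * D v"
    "(g has_derivative E) (at z)" "\<forall>c v. E (c *s v) = c * E v"
    using assms unfolding holomorphic_fun_on_def by blast
  then show "\<exists>D. (f + g has_derivative D) (at z) \<and> (\<forall>c v. D (c *s v) = c * D v)"
    unfolding plus_fun_def
    by (intro exI[of _ "\<lambda>v. D v + E v"]) (auto intro!: derivative_eq_intros simp: algebra_simps)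
qed

lemma holomorphic_fun_on_mult:
  assumes "holomorphic_fun_on f S" "holomorphic_fun_on g S"
  shows "holomorphic_fun_on (f * g) S"
  unfolding holomorphic_fun_on_def
proof
  fix z assume "z \<in> S"
  then obtain D E where "(f has_derivative D) (at z)" "\<forall>c v. D (c *s v) = c * D v"
    "(g has_derivative E) (at z)" "\<forall>c v. E (c *s v) = c * E v"
    using assms unfolding holomorphic_fun_on_def by blast
  then show "\<exists>D. (f * g has_derivative D) (at z) \<and> (\<forall>c v. D (c *s v) = c * D v)"
    unfolding times_fun_def
    by (intro exI[of _ "\<lambda>v. f z * E v + D v * g z"])
       (auto intro!: derivative_eq_intros simp: algebra_simps)
qed

lemma holomorphic_near_const: "holomorphic_near w (\<lambda>z. c)"
  unfolding holomorphic_near_def using holomorphic_fun_on_const open_UNIV by blast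

lemma holomorphic_near_add:
  assumes "holomorphic_near w f" "holomorphic_near w g"
  shows "holomorphic_near w (f + g)"
proof -
  obtain U V where "open U" "w \<in> U" "holomorphic_fun_on f U"
    "open V" "w \<in> V" "holomorphic_fun_on g V"
    using assms unfolding holomorphic_near_def by blast
  then show ?thesis unfolding holomorphic_near_def
    by (intro exI[of _ "U \<inter> V"])
       (auto intro!: holomorphic_fun_on_add intro: holomorphic_fun_on_subset)
qed

lemma holomorphic_near_mult:
  assumes "holomorphic_near w f" "holomorphic_near w g"
  shows "holomorphic_near w (f * g)"
proof -
  obtain U V where "open U" "w \<in> U" "holomorphic_fun_on f U"
    "open V" "w \<in> V" "holomorphic_fun_on g V"
    using assms unfolding holomorphic_near_def by blast
  then show ?thesis unfolding holomorphic_near_def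
    by (intro exI[of _ "U \<inter> V"])
       (auto intro!: holomorphic_fun_on_mult intro: holomorphic_fun_on_subset)
qed

lemma germ_ring_carrier: "carrier (germ_ring w) = germ w ` {f. holomorphic_near w f}"
  and germ_ring_one: "\<one>\<^bsub>germ_ring w\<^esub> = germ w 1"
  and germ_ring_zero: "\<zero>\<^bsub>germ_ring w\<^esub> = germ w 0"
  by (simp_all add: germ_ring_def)

lemma cring_germ_ring: "cring (germ_ring w)"
proof (rule cringI)
  note ops = germ_ring_one germ_ring_zero germ_ring_mult germ_ring_add
  have zero: "holomorphic_near w 0" and one: "holomorphic_near w 1"
    using holomorphic_near_const[of w 0] holomorphic_near_const[of w 1]
    by (simp_all add: zero_fun_def one_fun_def)
  have rep: "\<exists>f. x = germ w f \<and> holomorphic_near w f" if "x \<in> carrier (germ_ring w)" for x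
    using that unfolding germ_ring_carrier by blast
  have mem: "germ w f \<in> carrier (germ_ring w)" if "holomorphic_near w f" for f
    using that unfolding germ_ring_carrier by blast
  show "abelian_group (germ_ring w)"
  proof (rule abelian_groupI)
    fix x assume "x \<in> carrier (germ_ring w)"
    then obtain f where f: "x = germ w f" "holomorphic_near w f" using rep by blast
    have "holomorphic_near w ((\<lambda>z. - 1) * f)"
      using f by (intro holomorphic_near_mult holomorphic_near_const)
    moreover have "(\<lambda>z. - 1) * f + f = 0" by (simp add: fun_eq_iff)
    ultimately show "\<exists>y\<in>carrier (germ_ring w). y \<oplus>\<^bsub>germ_ring w\<^esub> x = \<zero>\<^bsub>germ_ring w\<^esub>"
      unfolding f(1) by (intro bexI[of _ "germ w ((\<lambda>z. - 1) * f)"] mem) (simp_all only: ops)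
  qed (auto dest!: rep intro!: mem simp: ops zero add_ac holomorphic_near_add)
  show "comm_monoid (germ_ring w)"
    by (rule comm_monoidI)
      (auto dest!: rep intro!: mem simp: ops one mult_ac holomorphic_near_mult)
qed (auto simp: germ_ring_carrier germ_ring_mult germ_ring_add distrib_right)


section \<open>Hilbert spaces of functions\<close>

definition hnorm :: "(('m::finite) cfun \<Rightarrow> 'm cfun \<Rightarrow> complex) \<Rightarrow> 'm cfun \<Rightarrow> real" where
  "hnorm ip f = sqrt (Re (ip f f))"

locale hilbert_function_space =
  fixes M :: "('m::finite) cfun set" and ip :: "'m cfun \<Rightarrow> 'm cfun \<Rightarrow> complex"
  assumes subspace: "cfun.subspace M"
    and ip_add: "f \<in> M \<Longrightarrow> g \<in> M \<Longrightarrow> h \<in> M \<Longrightarrow> ip (f + g) h = ip f h + ip g h"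
    and ip_scale: "f \<in> M \<Longrightarrow> h \<in> M \<Longrightarrow> ip (cscale c f) h = c * ip f h"
    and ip_cnj: "f \<in> M \<Longrightarrow> g \<in> M \<Longrightarrow> ip g f = cnj (ip f g)"
    and ip_pos: "f \<in> M \<Longrightarrow> f \<noteq> 0 \<Longrightarrow> Re (ip f f) > 0"
    and complete: "range X \<subseteq> M \<Longrightarrow>
          (\<And>e. e > 0 \<Longrightarrow> \<exists>N. \<forall>m\<ge>N. \<forall>n\<ge>N. hnorm ip (X m - X n) < e) \<Longrightarrow>
          \<exists>f\<in>M. (\<lambda>n. hnorm ip (X n - f)) \<longlonglongrightarrow> 0"

definition bounded_operator ::
    "('m::finite) cfun set \<Rightarrow> ('m cfun \<Rightarrow> 'm cfun \<Rightarrow> complex) \<Rightarrow> ('m cfun \<Rightarrow> 'm cfun) \<Rightarrow> bool" where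
  "bounded_operator M ip T \<longleftrightarrow>
     (\<forall>f\<in>M. T f \<in> M) \<and>
     (\<forall>f\<in>M. \<forall>g\<in>M. T (f + g) = T f + T g) \<and>
     (\<forall>c. \<forall>f\<in>M. T (cscale c f) = cscale c (T f)) \<and>
     (\<exists>B. \<forall>f\<in>M. hnorm ip (T f) \<le> B * hnorm ip f)"

definition adjoint_op ::
    "('m::finite) cfun set \<Rightarrow> ('m cfun \<Rightarrow> 'm cfun \<Rightarrow> complex) \<Rightarrow> ('m cfun \<Rightarrow> 'm cfun)
      \<Rightarrow> 'm cfun \<Rightarrow> 'm cfun" where
  "adjoint_op M ip T h = (THE k. k \<in> M \<and> (\<forall>f\<in>M. ip (T f) h = ip f k))"

lemma (in hilbert_function_space) adjoint_op_eqI: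
  assumes "k \<in> M" "\<And>f. f \<in> M \<Longrightarrow> ip (T f) h = ip f k"
  shows "adjoint_op M ip T h = k"
  unfolding adjoint_op_def
proof (rule the_equality)
  fix k' assume k': "k' \<in> M \<and> (\<forall>f\<in>M. ip (T f) h = ip f k')"
  define u where "u = k' - k"
  have u: "u \<in> M" using k' assms subspace by (simp add: u_def cfun.subspace_diff)
  have "ip k' u = ip k u"
    using ip_cnj[of u k'] ip_cnj[of u k] k' assms u by auto
  moreover have "ip k' u = ip u u + ip k u"
    using ip_add[of u k u] u assms by (simp add: u_def)
  ultimately have "ip u u = 0" by simp
  then have "u = 0" using ip_pos[OF u] by auto
  then show "k' = k" by (simp add: u_def)
qed (use assms in auto)

text \<open>Differentiability in the norm of \<open>M\<close> with conjugate-linear derivative \<open>D\<close>; such a \<open>D\<close> is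
  automatically bounded because its domain is finite-dimensional.\<close>

definition antiholomorphic_into ::
    "('m::finite) cfun set \<Rightarrow> ('m cfun \<Rightarrow> 'm cfun \<Rightarrow> complex) \<Rightarrow> (complex ^ 'm) set
      \<Rightarrow> (complex ^ 'm \<Rightarrow> 'm cfun) \<Rightarrow> bool" where
  "antiholomorphic_into M ip S F \<longleftrightarrow>
     (\<forall>w\<in>S. F w \<in> M) \<and>
     (\<forall>w\<in>S. \<exists>D. (\<forall>v. D v \<in> M) \<and>
        (\<forall>u v. D (u + v) = D u + D v) \<and>
        (\<forall>c v. D (c *s v) = cscale (cnj c) (D v)) \<and>
        ((\<lambda>v. hnorm ip (F (w + v) - F w - D v) / norm v) \<longlongrightarrow> 0) (at 0))"


section \<open>The class \<open>\<BB>\<^sub>1(\<Omega>)\<close>\<close>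

text \<open>A polynomial maps exponent vectors to coefficients, both finitely supported.\<close>

type_synonym 'm cpoly = "('m \<Rightarrow>\<^sub>0 nat) \<Rightarrow>\<^sub>0 complex"

definition poly_eval :: "('m::finite) cpoly \<Rightarrow> 'm cfun" where
  "poly_eval p z =
     (\<Sum>\<alpha>\<in>Poly_Mapping.keys p.
        Poly_Mapping.lookup p \<alpha> * (\<Prod>j\<in>UNIV. (z $ j) ^ Poly_Mapping.lookup \<alpha> j))"

definition module_mult :: "('m::finite) cpoly \<Rightarrow> 'm cfun \<Rightarrow> 'm cfun" where
  "module_mult p f = poly_eval p * f"

definition reproducing_kernel ::
    "(complex ^ 'm) set \<Rightarrow> ('m::finite) cfun set \<Rightarrow> ('m cfun \<Rightarrow> 'm cfun \<Rightarrow> complex)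
      \<Rightarrow> (complex ^ 'm \<Rightarrow> complex ^ 'm \<Rightarrow> complex) \<Rightarrow> bool" where
  "reproducing_kernel \<Omega> M ip K \<longleftrightarrow>
     (\<forall>w\<in>\<Omega>. (\<lambda>z. K z w) \<in> M \<and> (\<forall>f\<in>M. f w = ip f (\<lambda>z. K z w)))"

definition ideal_mult :: "complex ^ 'm \<Rightarrow> ('m::finite) cfun set \<Rightarrow> 'm cfun set" where
  "ideal_mult w M = {\<Sum>j\<in>UNIV. (\<lambda>z. z $ j - w $ j) * f j | f. \<forall>j. f j \<in> M}"

text \<open>The quotient of \<open>M\<close> by \<open>N\<close> is finite-dimensional: it is spanned by finitely many cosets.\<close>

definition finite_dim_quotient :: "('m::finite) cfun set \<Rightarrow> 'm cfun set \<Rightarrow> bool" where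
  "finite_dim_quotient M N \<longleftrightarrow>
     (\<exists>B. finite B \<and> B \<subseteq> M \<and> (\<forall>f\<in>M. \<exists>b\<in>cfun.span B. f - b \<in> N))"

text \<open>The axioms of a module over the polynomial ring hold automatically for pointwise
  multiplication; what remains is that every polynomial acts on \<open>M\<close> as a bounded operator.\<close>

definition class_B1 ::
    "(complex ^ 'm) set \<Rightarrow> ('m::finite) cfun set \<Rightarrow> ('m cfun \<Rightarrow> 'm cfun \<Rightarrow> complex) \<Rightarrow> bool" where
  "class_B1 \<Omega> M ip \<longleftrightarrow>
     hilbert_function_space M ip \<and>
     (\<forall>f\<in>M. holomorphic_fun_on f \<Omega> \<and> (\<forall>z. z \<notin> \<Omega> \<longrightarrow> f z = 0)) \<and>
     (\<forall>p. bounded_operator M ip (module_mult p)) \<and>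
     (\<exists>K. reproducing_kernel \<Omega> M ip K) \<and>
     (\<forall>w\<in>\<Omega>. finite_dim_quotient M (ideal_mult w M))"


section \<open>The stalks of the sheaf of a module, and decompositions of the kernel\<close>

definition stalk :: "('m::finite) cfun set \<Rightarrow> complex ^ 'm \<Rightarrow> 'm cfun set set" where
  "stalk M w = Idl\<^bsub>germ_ring w\<^esub> (germ w ` M)"

definition minimal_generators ::
    "complex ^ 'm \<Rightarrow> ('m::finite) cfun set set \<Rightarrow> nat \<Rightarrow> (nat \<Rightarrow> 'm cfun) \<Rightarrow> bool" where
  "minimal_generators w S d g \<longleftrightarrow>
     (\<forall>i\<in>{1..d}. holomorphic_near w (g i)) \<and>
     Idl\<^bsub>germ_ring w\<^esub> ((\<lambda>i. germ w (g i)) ` {1..d}) = S \<and>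
     (\<forall>J. J \<subset> {1..d} \<longrightarrow> Idl\<^bsub>germ_ring w\<^esub> ((\<lambda>i. germ w (g i)) ` J) \<noteq> S)"

text \<open>The neighbourhood \<open>\<Omega>\<^sub>0\<close> has to lie in the common domain of holomorphy of the \<open>g i\<close>, because
  the values of these total functions elsewhere are meaningless.\<close>

definition kernel_decomposition ::
    "(complex ^ 'm) set \<Rightarrow> ('m::finite) cfun set \<Rightarrow> ('m cfun \<Rightarrow> 'm cfun \<Rightarrow> complex)
      \<Rightarrow> (complex ^ 'm \<Rightarrow> complex ^ 'm \<Rightarrow> complex) \<Rightarrow> complex ^ 'm
      \<Rightarrow> nat \<Rightarrow> (nat \<Rightarrow> 'm cfun) \<Rightarrow> (complex ^ 'm) set \<Rightarrow> (nat \<Rightarrow> complex ^ 'm \<Rightarrow> 'm cfun) \<Rightarrow> bool" where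
  "kernel_decomposition \<Omega> M ip K w0 d g \<Omega>0 KK \<longleftrightarrow>
     open \<Omega>0 \<and> w0 \<in> \<Omega>0 \<and> \<Omega>0 \<subseteq> \<Omega> \<and>
     (\<forall>i\<in>{1..d}. holomorphic_fun_on (g i) \<Omega>0) \<and>
     (\<forall>i\<in>{1..d}. antiholomorphic_into M ip \<Omega>0 (KK i)) \<and>
     (\<forall>w\<in>\<Omega>0. (\<lambda>z. K z w) = (\<Sum>i=1..d. cscale (cnj (g i w)) (KK i w)))"

end

theory Submission
  imports Defs "HOL-Complex_Analysis.Cauchy_Integral_Formula"
begin

text \<open>A decomposition of the kernel amounts to a linear choice, for \<open>f \<in> M\<close>, of holomorphic
  coefficients \<open>h\<^sub>i\<close> with \<open>f = \<Sum>i. h\<^sub>i * g i\<close> near \<open>w0\<close>, where \<open>h\<^sub>i w = \<langle>f, KK i w\<rangle>\<close>. Minimality of the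
  generators and the fact that the ring of germs is local determine the values \<open>h\<^sub>i w0\<close>; this
  yields (ii)--(v).

  For the existence of a decomposition, each \<open>f\<close> has some such coefficients on some polydisc. The Baire
  category theorem and successive approximation make the polydisc and a bound \<open>C * \<parallel>f\<parallel>\<close> uniform.
  A choice that is linear in \<open>f\<close> is obtained by minimizing the mean square over a torus: this
  norm satisfies the parallelogram law, hence minimizing sequences add up to minimizing sequences,
  and it controls point evaluations, hence they converge. The Riesz representation theorem then
  produces \<open>KK i w\<close>.\<close>

section \<open>Holomorphic functions of several variables\<close>

text \<open>The coefficients of a given \<open>f\<close> are not unique: they may be changed by any
  relation among the generators. The Baire argument therefore yields a bounded choice that need not
  be linear, whereas the Riesz theorem needs linear functionals of \<open>f\<close>. Projecting away
  the relations in a Hilbert space of coefficient tuples would repair this, but it requires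
  completeness of that space and closedness of the relations; infima and almost minimal lifts
  require neither. Their limits exist only where the torus seminorm controls values: bounded lifts
  live on radius R, the torus has radius R/2, the limits live on radius R/4.

  Norm differentiability of the kernel vectors is deduced from that of the scalar functions
  \<open>ip f (KK i w)\<close>, so derivative estimates must be uniform in \<open>f\<close>. This is
  why they are explicit and depend only on a supremum bound and a radius.

  Relations also explain why uniqueness is claimed at \<open>w0\<close> alone: by minimality their
  coefficients vanish at \<open>w0\<close>, but possibly not at nearby points.\<close>

lemma norm_vector_scalar_mult: "norm (c *s (v :: complex ^ 'm::finite)) = norm c * norm v"
  unfolding norm_vec_def vector_smult_component norm_mult by (simp add: L2_set_right_distrib)

lemma complex_linear_imp_bounded_linear:
  fixes D :: "complex ^ 'm::finite \<Rightarrow> complex"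
  assumes "\<And>u v. D (u + v) = D u + D v" "\<And>c v. D (c *s v) = c * D v"
  shows "bounded_linear D"
proof -
  have "D (r *\<^sub>R v) = r *\<^sub>R D v" for r v
  proof -
    have "r *\<^sub>R v = of_real r *s v" by (simp add: vec_eq_iff) (simp add: scaleR_conv_of_real)
    then show ?thesis by (simp add: assms scaleR_conv_of_real)
  qed
  with assms show ?thesis by (intro linear_conv_bounded_linear[THEN iffD1] linearI)
qed

text \<open>Cauchy's inequality on discs of radius \<rho>/4 about the points of the half-radius disc
  bounds the second derivative by 2! * C * (4/\<rho>)^2, which is the constant 32. The Taylor
  estimate applied here divides by 1! and not by 2!.\<close>

lemma complex_Taylor_1:
  assumes \<phi>: "\<phi> holomorphic_on ball 0 \<rho>" and le: "\<And>t. t \<in> ball 0 \<rho> \<Longrightarrow> norm (\<phi> t) \<le> C"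
    and t: "norm t < \<rho> / 2"
  shows "norm (\<phi> t - \<phi> 0 - deriv \<phi> 0 * t) \<le> 32 * C / \<rho>\<^sup>2 * (norm t)\<^sup>2"
proof -
  have \<rho>: "\<rho> > 0" using t norm_ge_zero[of t] by linarith
  have b: "norm ((deriv ^^ 2) \<phi> x) \<le> fact 2 * C / (\<rho> / 4) ^ 2" if x: "x \<in> ball 0 (\<rho>/2)" for x
  proof (rule Cauchy_inequality)
    have "y \<in> ball 0 \<rho>" if "y \<in> cball x (\<rho>/4)" for y
    proof -
      have "norm y \<le> norm x + norm (x - y)"
        by (metis add.commute diff_add_cancel norm_minus_commute norm_triangle_ineq)
      then show ?thesis using that x \<rho> by (auto simp: dist_norm)
    qed
    then have sub: "cball x (\<rho>/4) \<subseteq> ball 0 \<rho>" by blast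
    show "\<phi> holomorphic_on ball x (\<rho>/4)" "continuous_on (cball x (\<rho>/4)) \<phi>"
      using \<phi> sub ball_subset_cball
      by (meson holomorphic_on_subset order_trans holomorphic_on_imp_continuous_on)+
    show "norm (\<phi> y) \<le> C" if "norm (x - y) = \<rho>/4" for y
      using sub that by (intro le) (auto simp: dist_norm)
  qed (use \<rho> in auto)
  have "norm ((deriv ^^ 0) \<phi> t - (\<Sum>i\<le>1. (deriv ^^ i) \<phi> 0 * (t-0)^i / fact i))
      \<le> (fact 2 * C / (\<rho> / 4) ^ 2) * norm (t - 0) ^ Suc 1 / fact 1"
  proof (rule complex_Taylor[where S = "ball 0 (\<rho>/2)"])
    fix i x assume "x \<in> ball (0::complex) (\<rho>/2)"
    then have x: "x \<in> ball 0 \<rho>" using \<rho> by auto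
    have "(deriv ^^ i) \<phi> holomorphic_on ball 0 \<rho>" using \<phi> by (intro holomorphic_higher_deriv) auto
    with x show "((deriv ^^ i) \<phi> has_field_derivative (deriv ^^ Suc i) \<phi> x) (at x within ball 0 (\<rho>/2))"
      by (simp add: holomorphic_derivI has_field_derivative_at_within)
  qed (use b t \<rho> in \<open>auto simp: numeral_2_eq_2\<close>)
  then show ?thesis by (simp add: power2_eq_square field_simps)
qed

lemma holomorphic_fun_on_slice:
  assumes h: "holomorphic_fun_on h S" and S: "\<And>t. t \<in> T \<Longrightarrow> z + t *s v \<in> S"
    and D: "t \<in> T" "(h has_derivative D) (at (z + t *s v))" "\<And>c v. D (c *s v) = c * D v"
  shows "((\<lambda>t. h (z + t *s v)) has_field_derivative D v) (at t)"
proof -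
  have bl: "bounded_linear (\<lambda>s. s *s v)"
    by (intro bounded_linear_intro[where K = "norm v"])
      (auto simp: vec_eq_iff algebra_simps norm_vector_scalar_mult)
  have "((\<lambda>t. z + t *s v) has_derivative (\<lambda>s. s *s v)) (at t)"
    by (auto intro!: derivative_eq_intros bounded_linear.has_derivative[OF bl])
  from diff_chain_at[OF this D(2)] show ?thesis
    by (simp add: has_field_derivative_def o_def D(3) mult_commute_abs)
qed

lemma holomorphic_fun_on_imp_slice_holomorphic:
  assumes "holomorphic_fun_on h S" "\<And>t. t \<in> T \<Longrightarrow> z + t *s v \<in> S"
  shows "(\<lambda>t. h (z + t *s v)) holomorphic_on T"
  unfolding holomorphic_on_def
proof
  fix t assume t: "t \<in> T"
  obtain D where "(h has_derivative D) (at (z + t *s v))" "\<And>c v. D (c *s v) = c * D v"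
    using assms(1) assms(2)[OF t] unfolding holomorphic_fun_on_def by blast
  from holomorphic_fun_on_slice[OF assms t this]
  show "(\<lambda>t. h (z + t *s v)) field_differentiable at t within T"
    by (meson field_differentiable_at_within field_differentiable_def)
qed

text \<open>Restriction to the complex line through \<open>z\<close> in direction \<open>v\<close>:
  the slice is holomorphic on the disc of radius \<delta>/|v|, and t = 1 lies in its inner half
  because |v| < \<delta>/2. The constant depends on \<open>h\<close> only through \<open>C\<close>,
  which is what limits of sequences and vector-valued maps need.\<close>

lemma holomorphic_fun_remainder:
  assumes h: "holomorphic_fun_on h (ball z \<delta>)" and le: "\<And>u. u \<in> ball z \<delta> \<Longrightarrow> norm (h u) \<le> C"
    and D: "(h has_derivative D) (at z)" "\<And>c v. D (c *s v) = c * D v"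
    and v: "norm v < \<delta> / 2"
  shows "norm (h (z + v) - h z - D v) \<le> 32 * C / \<delta>\<^sup>2 * (norm v)\<^sup>2"
proof (cases "v = 0")
  case True
  have "D 0 = 0" using D(2)[of 0 0] by simp
  then show ?thesis using True by simp
next
  case False
  define \<rho> where "\<rho> = \<delta> / norm v"
  have \<rho>: "\<rho> > 2" using v False by (simp add: \<rho>_def field_simps)
  have mem: "z + t *s v \<in> ball z \<delta>" if "t \<in> ball 0 \<rho>" for t
    using that False by (simp add: \<rho>_def dist_norm norm_vector_scalar_mult field_simps)
  have hol: "(\<lambda>t. h (z + t *s v)) holomorphic_on ball 0 \<rho>"
    using h mem by (rule holomorphic_fun_on_imp_slice_holomorphic)
  have "((\<lambda>t. h (z + t *s v)) has_field_derivative D v) (at 0)"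
    by (rule holomorphic_fun_on_slice[where T = \<open>ball 0 \<rho>\<close>, OF h mem]) (use D \<rho> in \<open>auto\<close>)
  then have d: "deriv (\<lambda>t. h (z + t *s v)) 0 = D v" by (rule DERIV_imp_deriv)
  have "norm (h (z + 1 *s v) - h (z + 0 *s v) - D v * 1) \<le> 32 * C / \<rho>\<^sup>2 * (norm (1::complex))\<^sup>2"
    unfolding d[symmetric]
    by (rule complex_Taylor_1[OF hol]) (use le mem \<rho> in auto)
  then show ?thesis by (simp add: \<rho>_def power_divide)
qed

text \<open>At the multiple of \<open>v\<close> of length \<delta>/4 the remainder is at most 2 * C,
  and two values of \<open>h\<close> contribute at most C each. So the derivative is at most 4 * C
  there, and rescaling gives 16 * C / \<delta>.\<close>

lemma holomorphic_fun_derivative_bound: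
  assumes h: "holomorphic_fun_on h (ball z \<delta>)" and le: "\<And>u. u \<in> ball z \<delta> \<Longrightarrow> norm (h u) \<le> C"
    and D: "(h has_derivative D) (at z)" "\<And>c v. D (c *s v) = c * D v"
    and \<delta>: "\<delta> > 0"
  shows "norm (D v) \<le> 16 * C / \<delta> * norm v"
proof (cases "v = 0")
  case True
  have "D 0 = 0" using D(2)[of 0 0] by simp
  then show ?thesis using True by simp
next
  case False
  define s where "s = \<delta> / (4 * norm v)"
  have s: "s > 0" using False \<delta> by (simp add: s_def)
  let ?v = "of_real s *s v"
  have n: "norm ?v = \<delta> / 4" using False \<delta> s by (simp add: norm_vector_scalar_mult) (simp add: s_def)
  have "norm (h (z + ?v) - h z - D ?v) \<le> 32 * C / \<delta>\<^sup>2 * (norm ?v)\<^sup>2"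
    by (rule holomorphic_fun_remainder[OF h le D]) (use n \<delta> in auto)
  also have "\<dots> = 2 * C" using \<delta> unfolding n by (simp add: power2_eq_square field_simps)
  finally have "norm (h (z + ?v) - h z - D ?v) \<le> 2 * C" .
  moreover have "norm (h (z + ?v)) \<le> C" "norm (h z) \<le> C"
    using n \<delta> by (auto intro!: le simp: dist_norm)
  moreover have "norm (D ?v) \<le> norm (h (z + ?v) - h z - D ?v) + norm (h (z + ?v)) + norm (h z)"
  proof -
    have "D ?v = h (z + ?v) - h z - (h (z + ?v) - h z - D ?v)" by simp
    then have "norm (D ?v) \<le> norm (h (z + ?v) - h z) + norm (h (z + ?v) - h z - D ?v)"
      by (metis norm_triangle_ineq4)
    then show ?thesis using norm_triangle_ineq4[of "h (z + ?v)" "h z"] by linarith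
  qed
  ultimately have "norm (D ?v) \<le> 4 * C" by linarith
  then have "s * norm (D v) \<le> 4 * C" using s by (simp add: D(2) norm_mult)
  then show ?thesis using s False \<delta> by (simp add: s_def field_simps)
qed

text \<open>The second-order Taylor estimate along complex lines is uniform in the sequence, so the
  derivatives converge as well.\<close>

lemma holomorphic_fun_on_pointwise_limit:
  fixes h :: "nat \<Rightarrow> ('m::finite) cfun"
  assumes S: "open S" and h: "\<And>n. holomorphic_fun_on (h n) S"
    and le: "\<And>n z. z \<in> S \<Longrightarrow> norm (h n z) \<le> C"
    and lim: "\<And>z. z \<in> S \<Longrightarrow> (\<lambda>n. h n z) \<longlonglongrightarrow> H z"
  shows "holomorphic_fun_on H S"
  unfolding holomorphic_fun_on_def
proof
  fix z assume "z \<in> S"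
  then obtain \<delta> where \<delta>: "\<delta> > 0" "ball z \<delta> \<subseteq> S" using S open_contains_ball by blast
  have C: "C \<ge> 0" using le[OF \<open>z \<in> S\<close>, of 0] norm_ge_zero order_trans by blast
  have "\<exists>D. (h n has_derivative D) (at z) \<and> (\<forall>c v. D (c *s v) = c * D v)" for n
    using h[of n] \<open>z \<in> S\<close> unfolding holomorphic_fun_on_def by blast
  then obtain D where D: "(h n has_derivative D n) (at z)" "\<And>c v. D n (c *s v) = c * D n v" for n
    by metis
  have Dadd: "D n (u + v) = D n u + D n v" for n u v
    using D(1)[of n] by (meson has_derivative_linear linear_add)
  define L where "L = 32 * C / \<delta>\<^sup>2"
  have L: "L \<ge> 0" using C by (simp add: L_def)
  have rem: "norm (h n (z + v) - h n z - D n v) \<le> L * (norm v)\<^sup>2" if "norm v < \<delta>/2" for n v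
    unfolding L_def
    by (rule holomorphic_fun_remainder[OF _ _ D that])
      (use \<delta> le holomorphic_fun_on_subset[OF h] in auto)
  have "convergent (\<lambda>n. D n v)" for v
  proof (cases "v = 0")
    case True
    have "D n 0 = 0" for n using D(2)[of n 0 0] by simp
    then show ?thesis using True by (simp add: convergent_const)
  next
    case False
    have "Cauchy (\<lambda>n. D n v)"
    proof (rule metric_CauchyI)
      fix e :: real assume e: "e > 0"
      have tri: "norm (p - q) \<le> norm (x - p) + norm (y - q) + norm (x - y)" for p q x y :: complex
      proof -
        have "p - q = (y - q) - (x - p) + (x - y)" by simp
        then show ?thesis
          using norm_triangle_ineq[of "(y - q) - (x - p)" "x - y"] norm_triangle_ineq4[of "y - q" "x - p"]
          by simp
      qed
      \<comment> \<open>The remainder is quadratic, so dividing it by \<open>s\<close> leaves a term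
        of order \<open>s\<close>; the second entry makes two such terms at most e/2 together. The
        other e/2 comes from convergence at the fixed points \<open>z\<close> and
        \<open>z + s v\<close>. The first entry keeps \<open>s v\<close> inside the half radius, and
        \<open>L + 1\<close> avoids division by zero.\<close>
      define s where "s = min (\<delta> / (4 * norm v)) (e / (4 * (L + 1) * (norm v)\<^sup>2))"
      have s: "s > 0" using False \<delta> e L by (simp add: s_def)
      let ?v = "of_real s *s v"
      have n: "norm ?v = s * norm v" using s by (simp add: norm_vector_scalar_mult)
      have "s \<le> \<delta> / (4 * norm v)" by (simp add: s_def)
      then have "s * norm v \<le> \<delta> / 4" using False by (simp add: field_simps)
      then have n2: "norm ?v < \<delta> / 2" using \<delta> n by linarith
      have "s \<le> e / (4 * (L + 1) * (norm v)\<^sup>2)" by (simp add: s_def)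
      then have "s * (4 * (L + 1) * (norm v)\<^sup>2) \<le> e" using False L by (simp add: pos_le_divide_eq)
      then have se: "4 * (L * s * (norm v)\<^sup>2) \<le> e"
        using mult_nonneg_nonneg[OF less_imp_le[OF s] zero_le_power2[of "norm v"]] by (simp add: algebra_simps)
      have zv: "z + ?v \<in> S" using n2 \<delta> by (intro subsetD[OF \<delta>(2)]) (simp add: dist_norm)
      have "Cauchy (\<lambda>n. h n (z + ?v) - h n z)"
        by (rule LIMSEQ_imp_Cauchy[OF tendsto_diff[OF lim[OF zv] lim[OF \<open>z \<in> S\<close>]]])
      then obtain N where N: "\<And>m n. m \<ge> N \<Longrightarrow> n \<ge> N \<Longrightarrow>
          dist (h m (z + ?v) - h m z) (h n (z + ?v) - h n z) < s * e / 2"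
        using metric_CauchyD[of "\<lambda>n. h n (z + ?v) - h n z" "s * e / 2"] s e by auto
      show "\<exists>M. \<forall>m\<ge>M. \<forall>n\<ge>M. dist (D m v) (D n v) < e"
      proof (intro exI allI impI)
        fix m n assume mn: "m \<ge> N" "n \<ge> N"
        have "norm (D m ?v - D n ?v) \<le> norm (h m (z + ?v) - h m z - D m ?v)
           + norm (h n (z + ?v) - h n z - D n ?v)
           + norm ((h m (z + ?v) - h m z) - (h n (z + ?v) - h n z))"
          using tri .
        also have "\<dots> < L * (norm ?v)\<^sup>2 + L * (norm ?v)\<^sup>2 + s * e / 2"
          using rem[OF n2, of m] rem[OF n2, of n] N[OF mn] by (simp add: dist_norm)
        also have "\<dots> = s * (2 * (L * s * (norm v)\<^sup>2) + e / 2)"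
          unfolding n by (simp add: power2_eq_square algebra_simps)
        also have "\<dots> \<le> s * e" using se s by (intro mult_left_mono) auto
        finally have "s * norm (D m v - D n v) < s * e"
          using s by (simp add: D(2) right_diff_distrib[symmetric] norm_mult)
        then show "dist (D m v) (D n v) < e" using s by (simp add: dist_norm)
      qed
    qed
    then show ?thesis by (simp add: Cauchy_convergent_iff)
  qed
  then obtain E where E: "(\<lambda>n. D n v) \<longlonglongrightarrow> E v" for v unfolding convergent_def by metis
  have Eadd: "E (u + v) = E u + E v" for u v
    using tendsto_add[OF E[of u] E[of v]] E[of "u + v"] unfolding Dadd by (rule LIMSEQ_unique[rotated])
  have Escale: "E (c *s v) = c * E v" for c v
    using tendsto_mult_left[OF E[of v], of c] E[of "c *s v"] unfolding D(2) by (rule LIMSEQ_unique[rotated])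
  have remE: "norm (H (z + v) - H z - E v) \<le> L * (norm v)\<^sup>2" if v: "norm v < \<delta>/2" for v
  proof (rule LIMSEQ_le_const2)
    have "z + v \<in> S" using v \<delta> by (intro subsetD[OF \<delta>(2)]) (simp add: dist_norm)
    then show "(\<lambda>n. norm (h n (z + v) - h n z - D n v)) \<longlonglongrightarrow> norm (H (z + v) - H z - E v)"
      using \<open>z \<in> S\<close> by (intro tendsto_intros lim E)
  qed (use rem v in auto)
  have "(H has_derivative E) (at z)"
    unfolding has_derivative_at
  proof (intro conjI)
    show "bounded_linear E" using Eadd Escale by (rule complex_linear_imp_bounded_linear)
    have *: "norm (norm (H (z + v) - H z - E v) / norm v) \<le> L * norm v" if "v \<in> ball 0 (\<delta>/2)" "v \<noteq> 0" for v
      using remE[of v] that by (simp add: power2_eq_square field_simps)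
    have "eventually (\<lambda>v. norm (norm (H (z + v) - H z - E v) / norm v) \<le> L * norm v) (at 0)"
      unfolding eventually_at using * \<delta> by (intro exI[of _ "\<delta>/2"]) auto
    moreover have "((\<lambda>v::complex^'m. L * norm v) \<longlongrightarrow> 0) (at 0)"
      by (rule tendsto_eq_intros refl tendsto_ident_at | simp)+
    ultimately show "(\<lambda>v. norm (H (z + v) - H z - E v) / norm v) \<midarrow>0\<rightarrow> 0"
      by (rule Lim_null_comparison)
  qed
  then show "\<exists>D. (H has_derivative D) (at z) \<and> (\<forall>c v. D (c *s v) = c * D v)"
    using Escale by blast
qed

section \<open>A Hilbert seminorm on a polydisc\<close>

definition polydisc :: "complex ^ 'm \<Rightarrow> real \<Rightarrow> (complex ^ 'm::finite) set" where
  "polydisc c R = {z. \<forall>j. norm (z $ j - c $ j) < R}"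

lemma open_polydisc [simp]: "open (polydisc c R)"
proof -
  have "polydisc c R = (\<Inter>j\<in>UNIV. {z. norm (z $ j - c $ j) < R})"
    by (auto simp: polydisc_def)
  moreover have "open {z. norm (z $ j - c $ j) < R}" for j
    by (intro open_Collect_less continuous_intros)
  ultimately show ?thesis by (simp add: open_INT)
qed

lemma center_in_polydisc [simp]: "R > 0 \<Longrightarrow> c \<in> polydisc c R"
  by (simp add: polydisc_def)

lemma polydisc_mono: "R \<le> R' \<Longrightarrow> polydisc c R \<subseteq> polydisc c R'"
  by (auto simp: polydisc_def intro: less_le_trans)

lemma polydisc_subset_open:
  fixes c :: "complex ^ 'm::finite"
  assumes "open U" "c \<in> U"
  obtains R where "R > 0" "polydisc c R \<subseteq> U"
proof -
  obtain e where e: "e > 0" "ball c e \<subseteq> U" using assms open_contains_ball by blast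
  \<comment> \<open>The Euclidean norm is at most the sum of the moduli of the
    \<open>CARD('m)\<close> coordinates.\<close>
  define R where "R = e / CARD('m)"
  have "polydisc c R \<subseteq> ball c e"
  proof
    fix z assume z: "z \<in> polydisc c R"
    have "norm (z - c) \<le> (\<Sum>j\<in>UNIV. norm ((z - c) $ j))"
      unfolding norm_vec_def by (rule L2_set_le_sum) auto
    also have "\<dots> < (\<Sum>j\<in>(UNIV::'m set). R)"
      using z by (intro sum_strict_mono) (auto simp: polydisc_def)
    also have "\<dots> = e" by (simp add: R_def)
    finally show "z \<in> ball c e" by (simp add: dist_norm norm_minus_commute)
  qed
  with e show ?thesis by (intro that[of R]) (auto simp: R_def)
qed

section \<open>Mean squares over circles and tori\<close>

abbreviation unit_interval_measure :: "real measure" where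
  "unit_interval_measure \<equiv> restrict_space lborel {0..1}"

text \<open>Cauchy's formula is applied to \<open>\<phi>\<^sup>2\<close>, so that no Cauchy--Schwarz inequality is needed.\<close>

lemma circle_square_mean_bound:
  assumes \<phi>: "\<phi> holomorphic_on ball c R" and r: "0 < r" "r < R" and w: "norm (w - c) < r / 2"
  shows "ennreal ((norm (\<phi> w))\<^sup>2) \<le>
    2 * (\<integral>\<^sup>+t. ennreal ((norm (\<phi> (c + of_real r * cis (2 * pi * t))))\<^sup>2) \<partial>unit_interval_measure)"
proof -
  let ?u = "\<lambda>t::real. c + of_real r * cis (2 * pi * t)"
  have circ: "circlepath c r t = ?u t" for t
    by (simp add: circlepath_def part_circlepath_def linepath_def cis_conv_exp mult_ac)
  have sph: "norm (?u t - c) = r" for t using r by (simp add: norm_mult)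
  have uw: "norm (?u t - w) \<ge> r / 2" for t
  proof -
    have "norm (?u t - c) \<le> norm (?u t - w) + norm (w - c)"
      using norm_triangle_ineq[of "?u t - w" "w - c"] by simp
    with sph w show ?thesis by simp
  qed
  have "(\<lambda>u. (\<phi> u)\<^sup>2) holomorphic_on cball c r"
    using r by (intro holomorphic_intros holomorphic_on_subset[OF \<phi>]) auto
  then have "((\<lambda>u. (\<phi> u)\<^sup>2 / (u - w)) has_contour_integral (2 * of_real pi * \<i> * (\<phi> w)\<^sup>2)) (circlepath c r)"
    by (rule Cauchy_integral_circlepath_simple) (use w r in auto)
  then have I: "((\<lambda>t. (\<phi> (?u t))\<^sup>2 / (?u t - w) * vector_derivative (circlepath c r) (at t within {0..1}))
      has_integral (2 * of_real pi * \<i> * (\<phi> w)\<^sup>2)) {0..1}"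
    unfolding has_contour_integral_def circ .
  let ?g = "\<lambda>t. (norm (\<phi> (?u t)))\<^sup>2"
  have "continuous_on {0..1} ?g"
  proof -
    have "continuous_on (ball c R) \<phi>" using \<phi> by (rule holomorphic_on_imp_continuous_on)
    then have "continuous_on {0..1} (\<lambda>t. \<phi> (?u t))"
      by (rule continuous_on_compose2)
        (use r in \<open>auto intro!: continuous_intros simp: dist_norm norm_mult\<close>)
    then show ?thesis by (intro continuous_intros)
  qed
  then have g: "?g integrable_on {0..1}" by (rule integrable_continuous_real)
  \<comment> \<open>The point \<open>w\<close> has distance at least r/2 from the circle, so the
    Cauchy kernel is at most 2/r; the speed of the path is 2 * pi * r. Their product is 4 * pi, and
    division by the 2 * pi of Cauchy's formula leaves the factor 2.\<close>
  have "norm (2 * of_real pi * \<i> * (\<phi> w)\<^sup>2) \<le> integral {0..1} (\<lambda>t. (4 * pi) * ?g t)"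
    unfolding integral_unique[OF I, symmetric]
  proof (rule integral_norm_bound_integral)
    show "(\<lambda>t. (\<phi> (?u t))\<^sup>2 / (?u t - w) * vector_derivative (circlepath c r) (at t within {0..1})) integrable_on {0..1}"
      using I by blast
    show "(\<lambda>t. (4 * pi) * ?g t) integrable_on {0..1}"
      by (rule integrable_on_cmult_left[OF g, simplified])
    fix t :: real assume t: "t \<in> {0..1}"
    have v: "norm (vector_derivative (circlepath c r) (at t within {0..1})) = 2 * pi * r"
      using t r by (subst vector_derivative_circlepath01) (auto simp: norm_mult norm_exp_eq_Re)
    have "?g t / norm (?u t - w) * (2 * pi * r) \<le> ?g t / (r/2) * (2 * pi * r)"
      using uw[of t] r by (intro mult_right_mono divide_left_mono mult_pos_pos) auto
    then show "norm ((\<phi> (?u t))\<^sup>2 / (?u t - w) * vector_derivative (circlepath c r) (at t within {0..1}))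
        \<le> (4 * pi) * ?g t"
      using r by (simp add: norm_mult norm_divide norm_power v mult_ac)
  qed
  then have "(norm (\<phi> w))\<^sup>2 \<le> 2 * integral {0..1} ?g"
    by (simp add: norm_mult norm_power)
  then have "ennreal ((norm (\<phi> w))\<^sup>2) \<le> ennreal (2 * integral {0..1} ?g)" by (rule ennreal_leI)
  also have "\<dots> = 2 * ennreal (integral {0..1} ?g)"
    by (subst ennreal_mult') (auto intro!: integral_nonneg g)
  also have "ennreal (integral {0..1} ?g) = integral\<^sup>N lborel (\<lambda>t. ennreal (?g t) * indicator {0..1} t)"
    by (rule nn_integral_has_integral_lebesgue'[symmetric]) (use g in auto)
  also have "\<dots> = (\<integral>\<^sup>+t. ennreal (?g t) \<partial>unit_interval_measure)"
    by (subst nn_integral_restrict_space) auto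
  finally show ?thesis .
qed

text \<open>Mixed points make an induction over \<open>J\<close> possible: the coordinates in
  \<open>J\<close> run through circles, the others keep the values of \<open>w\<close>. For
  \<open>J = UNIV\<close> the point does not depend on \<open>w\<close>.\<close>

definition torus_point :: "'m set \<Rightarrow> complex ^ 'm \<Rightarrow> real \<Rightarrow> complex ^ 'm \<Rightarrow> ('m \<Rightarrow> real) \<Rightarrow> complex ^ 'm::finite" where
  "torus_point J c r w x = (\<chi> j. if j \<in> J then c $ j + of_real r * cis (2 * pi * x j) else w $ j)"

lemma product_sigma_finite_unit_interval: "product_sigma_finite (\<lambda>_. unit_interval_measure)"
proof -
  have "finite_measure unit_interval_measure"
    by (rule finite_measureI) (simp add: space_restrict_space emeasure_restrict_space)
  then show ?thesis
    by (intro product_sigma_finite.intro finite_measure.axioms(1))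
qed

lemma measurable_torus_point [measurable]:
  fixes c w :: "complex ^ 'm::finite"
  shows "torus_point J c r w \<in> Pi\<^sub>M J (\<lambda>_. unit_interval_measure) \<rightarrow>\<^sub>M borel"
proof (subst borel_measurable_euclidean_space, intro ballI)
  fix b :: "complex ^ 'm" assume "b \<in> Basis"
  then obtain j u where b: "b = axis j u" by (auto simp: Basis_vec_def)
  have "(\<lambda>x. x j) \<in> Pi\<^sub>M J (\<lambda>_. unit_interval_measure) \<rightarrow>\<^sub>M borel" if "j \<in> J"
  proof (rule measurable_compose[OF measurable_component_singleton[OF that]])
    show "(\<lambda>x. x) \<in> unit_interval_measure \<rightarrow>\<^sub>M borel"
      by (rule measurable_restrict_space1) simp
  qed
  then have "(\<lambda>x. if j \<in> J then c $ j + of_real r * cis (2 * pi * x j) else w $ j)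
      \<in> Pi\<^sub>M J (\<lambda>_. unit_interval_measure) \<rightarrow>\<^sub>M borel"
    by (cases "j \<in> J") (auto simp: cis_conv_exp)
  then show "(\<lambda>x. torus_point J c r w x \<bullet> b) \<in> borel_measurable (Pi\<^sub>M J (\<lambda>_. unit_interval_measure))"
    by (simp add: b inner_axis torus_point_def)
qed

text \<open>Induction on the set of coordinates already averaged. Each new coordinate costs a factor
  2 by the bound on a circle, and Tonelli's theorem for extended nonnegative integrals absorbs the
  new integral into the product measure without any integrability condition.\<close>

lemma torus_square_mean_bound:
  fixes H :: "('m::finite) cfun"
  assumes H: "holomorphic_fun_on H (polydisc c R)" and [measurable]: "H \<in> borel_measurable borel"
    and r: "0 < r" "r < R" and w: "w \<in> polydisc c (r / 2)"
  shows "ennreal ((norm (H w))\<^sup>2) \<le> 2 ^ card J *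
    (\<integral>\<^sup>+x. ennreal ((norm (H (torus_point J c r w x)))\<^sup>2) \<partial>Pi\<^sub>M J (\<lambda>_. unit_interval_measure))"
proof -
  interpret product_sigma_finite "\<lambda>_::'m. unit_interval_measure"
    by (rule product_sigma_finite_unit_interval)
  have "finite J" by simp
  then show ?thesis
  proof (induction J)
    case empty
    have "torus_point {} c r w x = w" for x by (simp add: torus_point_def vec_eq_iff)
    then show ?case by (simp add: PiM_empty)
  next
    case (insert i J)
    let ?F = "\<lambda>x. ennreal ((norm (H (torus_point (insert i J) c r w x)))\<^sup>2)"
    have meas1: "?F \<in> borel_measurable (Pi\<^sub>M (insert i J) (\<lambda>_. unit_interval_measure))"
      by measurable
    have "(\<lambda>(x, t). x(i := t)) \<in> Pi\<^sub>M J (\<lambda>_. unit_interval_measure) \<Otimes>\<^sub>M unit_interval_measure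
        \<rightarrow>\<^sub>M Pi\<^sub>M (insert i J) (\<lambda>_. unit_interval_measure)"
      by (rule measurable_add_dim)
    from measurable_compose[OF this meas1]
    have "(\<lambda>(x, t). ?F (x(i := t))) \<in> borel_measurable (Pi\<^sub>M J (\<lambda>_. unit_interval_measure) \<Otimes>\<^sub>M unit_interval_measure)"
      by (simp add: case_prod_unfold)
    then have meas2: "(\<lambda>x. \<integral>\<^sup>+t. ?F (x(i := t)) \<partial>unit_interval_measure)
        \<in> borel_measurable (Pi\<^sub>M J (\<lambda>_. unit_interval_measure))"
      by (rule sigma_finite_measure.borel_measurable_nn_integral[OF sigma_finite_measures])
    have "ennreal ((norm (H (torus_point J c r w x)))\<^sup>2)
        \<le> 2 * (\<integral>\<^sup>+t. ?F (x(i := t)) \<partial>unit_interval_measure)" for x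
    proof -
      \<comment> \<open>Only coordinate \<open>i\<close> is freed. As \<open>i\<close> is not in
        \<open>J\<close>, the point \<open>?p\<close> has \<open>w $ i\<close> there, so the value
        of the slice at \<open>w $ i\<close> is the old integrand and its values on the circle are
        the new one.\<close>
      let ?p = "torus_point J c r w x"
      let ?\<phi> = "\<lambda>\<zeta>. H (\<chi> j. if j = i then \<zeta> else ?p $ j)"
      define q where "q = (\<chi> j. if j = i then 0 else ?p $ j)"
      have eq: "(\<chi> j. if j = i then \<zeta> else ?p $ j) = q + \<zeta> *s axis i 1" for \<zeta>
        by (simp add: q_def vec_eq_iff axis_def)
      have "?\<phi> holomorphic_on ball (c $ i) R"
        unfolding eq
      proof (rule holomorphic_fun_on_imp_slice_holomorphic[OF H])
        fix \<zeta> assume "\<zeta> \<in> ball (c $ i) R"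
        moreover have "norm (?p $ j - c $ j) < R" for j
        proof -
          have "norm (w $ j - c $ j) < r / 2" using w by (simp add: polydisc_def)
          then show ?thesis using r by (simp add: torus_point_def norm_mult)
        qed
        ultimately show "q + \<zeta> *s axis i 1 \<in> polydisc c R"
          unfolding eq[symmetric] by (auto simp: polydisc_def dist_norm norm_minus_commute)
      qed
      then have "ennreal ((norm (?\<phi> (w $ i)))\<^sup>2) \<le>
          2 * (\<integral>\<^sup>+t. ennreal ((norm (?\<phi> (c $ i + of_real r * cis (2 * pi * t))))\<^sup>2) \<partial>unit_interval_measure)"
        by (rule circle_square_mean_bound) (use r w in \<open>auto simp: polydisc_def\<close>)
      moreover have "(\<chi> j. if j = i then w $ i else ?p $ j) = ?p"
        using insert.hyps by (auto simp: vec_eq_iff torus_point_def)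
      moreover have "(\<chi> j. if j = i then c $ i + of_real r * cis (2 * pi * t) else ?p $ j)
          = torus_point (insert i J) c r w (x(i := t))" for t
        using insert.hyps by (auto simp: vec_eq_iff torus_point_def)
      ultimately show ?thesis by simp
    qed
    then have "(\<integral>\<^sup>+x. ennreal ((norm (H (torus_point J c r w x)))\<^sup>2) \<partial>Pi\<^sub>M J (\<lambda>_. unit_interval_measure))
        \<le> (\<integral>\<^sup>+x. 2 * (\<integral>\<^sup>+t. ?F (x(i := t)) \<partial>unit_interval_measure) \<partial>Pi\<^sub>M J (\<lambda>_. unit_interval_measure))"
      by (intro nn_integral_mono)
    also have "\<dots> = 2 * (\<integral>\<^sup>+x. (\<integral>\<^sup>+t. ?F (x(i := t)) \<partial>unit_interval_measure) \<partial>Pi\<^sub>M J (\<lambda>_. unit_interval_measure))"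
      by (rule nn_integral_cmult[OF meas2])
    also have "\<dots> = 2 * integral\<^sup>N (Pi\<^sub>M (insert i J) (\<lambda>_. unit_interval_measure)) ?F"
      by (simp only: product_nn_integral_insert[OF insert.hyps meas1])
    finally have "2 ^ card J * (\<integral>\<^sup>+x. ennreal ((norm (H (torus_point J c r w x)))\<^sup>2) \<partial>Pi\<^sub>M J (\<lambda>_. unit_interval_measure))
       \<le> 2 ^ card J * (2 * integral\<^sup>N (Pi\<^sub>M (insert i J) (\<lambda>_. unit_interval_measure)) ?F)"
      by (intro mult_left_mono) auto
    also have "\<dots> = 2 ^ card (insert i J) * integral\<^sup>N (Pi\<^sub>M (insert i J) (\<lambda>_. unit_interval_measure)) ?F"
      using insert.hyps by (simp add: mult_ac)
    finally show ?case using insert.IH by (rule order_trans[rotated])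
  qed
qed

text \<open>A Hilbert seminorm on the functions that are holomorphic on a neighbourhood of the closed
  polydisc of radius \<open>r\<close>: it is dominated by the supremum norm and dominates all point evaluations
  near the centre.\<close>

definition torus_norm_sq :: "complex ^ 'm \<Rightarrow> real \<Rightarrow> ('m::finite) cfun \<Rightarrow> real" where
  "torus_norm_sq c r h = (\<integral>x. (norm (h (torus_point UNIV c r 0 x)))\<^sup>2 \<partial>Pi\<^sub>M UNIV (\<lambda>_. unit_interval_measure))"

lemma torus_point_in_polydisc: "0 < r \<Longrightarrow> r < R \<Longrightarrow> torus_point UNIV c r w x \<in> polydisc c R"
  by (auto simp: torus_point_def polydisc_def norm_mult)

lemma emeasure_torus:
  "emeasure (Pi\<^sub>M (UNIV::'m::finite set) (\<lambda>_. unit_interval_measure)) (space (Pi\<^sub>M UNIV (\<lambda>_. unit_interval_measure))) = 1"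
proof -
  interpret product_sigma_finite "\<lambda>_::'m. unit_interval_measure"
    by (rule product_sigma_finite_unit_interval)
  show ?thesis
    unfolding space_PiM
    by (subst emeasure_PiM) (auto simp: emeasure_restrict_space space_restrict_space sets_restrict_space_iff)
qed

lemma holomorphic_fun_on_imp_continuous_on: "holomorphic_fun_on h S \<Longrightarrow> continuous_on S h"
  unfolding holomorphic_fun_on_def
  by (meson continuous_at_imp_continuous_on has_derivative_continuous)

lemma integrable_torus_square:
  fixes h :: "('m::finite) cfun"
  assumes h: "holomorphic_fun_on h (polydisc c R)" and le: "\<And>z. z \<in> polydisc c R \<Longrightarrow> norm (h z) \<le> C"
    and r: "0 < r" "r < R"
  shows "integrable (Pi\<^sub>M UNIV (\<lambda>_. unit_interval_measure)) (\<lambda>x. (norm (h (torus_point UNIV c r 0 x)))\<^sup>2)"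
proof (rule finite_measure.integrable_const_bound)
  show "finite_measure (Pi\<^sub>M UNIV (\<lambda>_::'m. unit_interval_measure))"
    by (rule finite_measureI) (simp add: emeasure_torus)
  show "AE x in Pi\<^sub>M UNIV (\<lambda>_. unit_interval_measure). norm ((norm (h (torus_point UNIV c r 0 x)))\<^sup>2) \<le> C\<^sup>2"
    by (intro always_eventually allI) (simp add: le torus_point_in_polydisc r power_mono)
  \<comment> \<open>Nothing is known about \<open>h\<close> off the polydisc, so it is cut off to
    obtain a Borel function on the whole space. All torus points lie inside, hence the integrand
    does not change.\<close>
  have [measurable]: "(\<lambda>z. indicator (polydisc c R) z *\<^sub>R h z) \<in> borel_measurable borel"
    by (intro borel_measurable_continuous_on_indicator holomorphic_fun_on_imp_continuous_on h) auto
  have "(\<lambda>x. (norm (indicator (polydisc c R) (torus_point UNIV c r 0 x) *\<^sub>R h (torus_point UNIV c r 0 x)))\<^sup>2)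
    \<in> borel_measurable (Pi\<^sub>M UNIV (\<lambda>_. unit_interval_measure))" by measurable
  then show "(\<lambda>x. (norm (h (torus_point UNIV c r 0 x)))\<^sup>2) \<in> borel_measurable (Pi\<^sub>M UNIV (\<lambda>_. unit_interval_measure))"
    by (simp add: torus_point_in_polydisc r)
qed

lemma torus_norm_sq_nonneg: "torus_norm_sq c r h \<ge> 0"
  unfolding torus_norm_sq_def by simp

lemma torus_norm_sq_scale: "torus_norm_sq c r (\<lambda>z. a * h z) = (norm a)\<^sup>2 * torus_norm_sq c r h"
  unfolding torus_norm_sq_def by (simp add: norm_mult power_mult_distrib)

lemma torus_norm_sq_le:
  fixes h :: "('m::finite) cfun"
  assumes h: "holomorphic_fun_on h (polydisc c R)" and le: "\<And>z. z \<in> polydisc c R \<Longrightarrow> norm (h z) \<le> C"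
    and r: "0 < r" "r < R"
  shows "torus_norm_sq c r h \<le> C\<^sup>2"
proof -
  have fm: "finite_measure (Pi\<^sub>M UNIV (\<lambda>_::'m. unit_interval_measure))"
    by (rule finite_measureI) (simp add: emeasure_torus)
  have "torus_norm_sq c r h \<le> (\<integral>x. C\<^sup>2 \<partial>Pi\<^sub>M UNIV (\<lambda>_::'m. unit_interval_measure))"
    unfolding torus_norm_sq_def
    by (intro integral_mono integrable_torus_square[OF assms] finite_measure.integrable_const[OF fm])
      (auto simp: le torus_point_in_polydisc r power_mono emeasure_torus)
  also have "\<dots> = C\<^sup>2" by (simp add: measure_def emeasure_torus)
  finally show ?thesis .
qed

lemma torus_norm_sq_parallelogram:
  fixes h k :: "('m::finite) cfun"
  assumes "holomorphic_fun_on h (polydisc c R)" "\<And>z. z \<in> polydisc c R \<Longrightarrow> norm (h z) \<le> C"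
    and "holomorphic_fun_on k (polydisc c R)" "\<And>z. z \<in> polydisc c R \<Longrightarrow> norm (k z) \<le> D"
    and r: "0 < r" "r < R"
  shows "torus_norm_sq c r (\<lambda>z. h z + k z) + torus_norm_sq c r (\<lambda>z. h z - k z)
    = 2 * torus_norm_sq c r h + 2 * torus_norm_sq c r k"
proof -
  note ih = integrable_torus_square[OF assms(1,2) r] and ik = integrable_torus_square[OF assms(3,4) r]
  \<comment> \<open>The parameter \<open>a\<close> treats the sum (a = 1) and the difference (a =
    -1) together.\<close>
  have hp: "holomorphic_fun_on (\<lambda>z. h z + a * k z) (polydisc c R)" for a
    using holomorphic_fun_on_add[OF assms(1) holomorphic_fun_on_mult[OF holomorphic_fun_on_const assms(3)], of a]
    by (simp add: plus_fun_def times_fun_def)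
  have "norm (h z + a * k z) \<le> C + norm a * D" if "z \<in> polydisc c R" for z a
  proof -
    have "norm (h z + a * k z) \<le> norm (h z) + norm a * norm (k z)"
      by (metis norm_mult norm_triangle_ineq)
    also have "\<dots> \<le> C + norm a * D"
      by (intro add_mono mult_left_mono assms that norm_ge_zero)
    finally show ?thesis .
  qed
  note ip = integrable_torus_square[OF hp this r]
  have par: "(norm (a + 1 * b))\<^sup>2 + (norm (a + (- 1) * b))\<^sup>2 = 2 * (norm a)\<^sup>2 + 2 * (norm b)\<^sup>2" for a b :: complex
    unfolding cmod_power2 by (simp add: power2_eq_square algebra_simps)
  have "torus_norm_sq c r (\<lambda>z. h z + 1 * k z) + torus_norm_sq c r (\<lambda>z. h z + (- 1) * k z)
    = (\<integral>x. 2 * (norm (h (torus_point UNIV c r 0 x)))\<^sup>2 + 2 * (norm (k (torus_point UNIV c r 0 x)))\<^sup>2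
        \<partial>Pi\<^sub>M UNIV (\<lambda>_. unit_interval_measure))"
    unfolding torus_norm_sq_def par[symmetric] by (rule Bochner_Integration.integral_add[OF ip ip, symmetric])
  also have "\<dots> = 2 * torus_norm_sq c r h + 2 * torus_norm_sq c r k"
    unfolding torus_norm_sq_def using ih ik by simp
  finally show ?thesis by simp
qed

lemma torus_norm_sq_point_bound:
  fixes h :: "('m::finite) cfun"
  assumes h: "holomorphic_fun_on h (polydisc c R)" and le: "\<And>z. z \<in> polydisc c R \<Longrightarrow> norm (h z) \<le> C"
    and r: "0 < r" "r < R" and w: "w \<in> polydisc c (r / 2)"
  shows "(norm (h w))\<^sup>2 \<le> 2 ^ CARD('m) * torus_norm_sq c r h"
proof -
  \<comment> \<open>The averaging bound asks for a globally Borel measurable function; the cut-off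
    provides one and stays holomorphic on the polydisc, which is open.\<close>
  define H where "H = (\<lambda>z. indicator (polydisc c R) z *\<^sub>R h z)"
  have [measurable]: "H \<in> borel_measurable borel" unfolding H_def
    by (intro borel_measurable_continuous_on_indicator holomorphic_fun_on_imp_continuous_on h) auto
  have H: "holomorphic_fun_on H (polydisc c R)"
    unfolding holomorphic_fun_on_def
  proof
    fix z assume z: "z \<in> polydisc c R"
    then obtain D where D: "(h has_derivative D) (at z)" "\<forall>c v. D (c *s v) = c * D v"
      using h unfolding holomorphic_fun_on_def by blast
    have "(H has_derivative D) (at z)"
      by (rule has_derivative_transform_within_open[OF D(1) open_polydisc z]) (simp add: H_def)
    with D(2) show "\<exists>D. (H has_derivative D) (at z) \<and> (\<forall>c v. D (c *s v) = c * D v)" by blast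
  qed
  have eq: "H z = h z" if "z \<in> polydisc c R" for z using that by (simp add: H_def)
  have wR: "w \<in> polydisc c R" using w polydisc_mono[of "r/2" R c] r by auto
  have tp: "torus_point UNIV c r w x = torus_point UNIV c r 0 x" for x by (simp add: torus_point_def)
  have "ennreal ((norm (h w))\<^sup>2) \<le> 2 ^ CARD('m) *
    (\<integral>\<^sup>+x. ennreal ((norm (h (torus_point UNIV c r 0 x)))\<^sup>2) \<partial>Pi\<^sub>M UNIV (\<lambda>_. unit_interval_measure))"
    using torus_square_mean_bound[OF H _ r w, of UNIV]
    by (simp add: eq wR torus_point_in_polydisc[OF r] tp)
  also have "\<dots> = ennreal (2 ^ CARD('m) * torus_norm_sq c r h)"
    unfolding torus_norm_sq_def
    by (subst nn_integral_eq_integral[OF integrable_torus_square[OF h le r]])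
      (auto simp: ennreal_mult' ennreal_power[symmetric])
  finally show ?thesis by (simp add: torus_norm_sq_nonneg)
qed

section \<open>Hilbert spaces of functions\<close>

context hilbert_function_space
begin

lemma mem_simps [simp, intro]:
  shows zero_mem: "0 \<in> M"
    and add_mem: "f \<in> M \<Longrightarrow> g \<in> M \<Longrightarrow> f + g \<in> M"
    and diff_mem: "f \<in> M \<Longrightarrow> g \<in> M \<Longrightarrow> f - g \<in> M"
    and scale_mem: "f \<in> M \<Longrightarrow> cscale c f \<in> M"
  using subspace by (auto simp: cfun.subspace_0 cfun.subspace_add cfun.subspace_diff cfun.subspace_scale)

lemma sum_mem: "(\<And>i. i \<in> I \<Longrightarrow> f i \<in> M) \<Longrightarrow> (\<Sum>i\<in>I. f i) \<in> M"
  using subspace by (rule cfun.subspace_sum)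

lemma ip_add_right: "f \<in> M \<Longrightarrow> g \<in> M \<Longrightarrow> h \<in> M \<Longrightarrow> ip h (f + g) = ip h f + ip h g"
  using ip_add[of f g h] ip_cnj[of h f] ip_cnj[of h g] ip_cnj[of "f + g" h] by simp

lemma ip_scale_right: "f \<in> M \<Longrightarrow> h \<in> M \<Longrightarrow> ip h (cscale c f) = cnj c * ip h f"
  using ip_scale[of f h c] ip_cnj[of h f] ip_cnj[of "cscale c f" h] by simp

lemma ip_zero [simp]: "h \<in> M \<Longrightarrow> ip 0 h = 0" "h \<in> M \<Longrightarrow> ip h 0 = 0"
  using ip_add[of 0 0 h] ip_add_right[of 0 0 h] by auto

lemma ip_diff: "f \<in> M \<Longrightarrow> g \<in> M \<Longrightarrow> h \<in> M \<Longrightarrow> ip (f - g) h = ip f h - ip g h"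
  using ip_add[of "f - g" g h] by simp

lemma ip_diff_right: "f \<in> M \<Longrightarrow> g \<in> M \<Longrightarrow> h \<in> M \<Longrightarrow> ip h (f - g) = ip h f - ip h g"
  using ip_add_right[of "f - g" g h] by simp

lemma ip_sum:
  assumes "h \<in> M" "\<And>i. i \<in> I \<Longrightarrow> f i \<in> M"
  shows "ip (\<Sum>i\<in>I. f i) h = (\<Sum>i\<in>I. ip (f i) h)"
  using assms(2)
proof (induction I rule: infinite_finite_induct)
  case (insert i I)
  then show ?case using assms(1) sum_mem[of I f]
    unfolding sum.insert[OF insert.hyps] by (subst ip_add) auto
qed (use assms(1) in auto)

lemma ip_sum_right:
  assumes "h \<in> M" "\<And>i. i \<in> I \<Longrightarrow> f i \<in> M"
  shows "ip h (\<Sum>i\<in>I. f i) = (\<Sum>i\<in>I. ip h (f i))"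
  using assms(2)
proof (induction I rule: infinite_finite_induct)
  case (insert i I)
  then show ?case using assms(1) sum_mem[of I f]
    unfolding sum.insert[OF insert.hyps] by (subst ip_add_right) auto
qed (use assms(1) in auto)

lemma ip_self: "f \<in> M \<Longrightarrow> ip f f = of_real (Re (ip f f))"
  using ip_cnj[of f f] by (simp add: complex_eq_iff)

lemma Re_ip_self_nonneg: "f \<in> M \<Longrightarrow> Re (ip f f) \<ge> 0"
  using ip_pos[of f] by (cases "f = 0") auto

lemma hnorm_nonneg [simp]: "f \<in> M \<Longrightarrow> hnorm ip f \<ge> 0"
  by (simp add: hnorm_def Re_ip_self_nonneg)

lemma hnorm_sq: "f \<in> M \<Longrightarrow> (hnorm ip f)\<^sup>2 = Re (ip f f)"
  by (simp add: hnorm_def Re_ip_self_nonneg)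

lemma hnorm_zero [simp]: "hnorm ip 0 = 0"
  by (simp add: hnorm_def)

lemma hnorm_eq_0_iff: "f \<in> M \<Longrightarrow> hnorm ip f = 0 \<longleftrightarrow> f = 0"
  using ip_pos[of f] by (cases "f = 0") (auto simp: hnorm_def)

lemma hnorm_cscale: "f \<in> M \<Longrightarrow> hnorm ip (cscale c f) = norm c * hnorm ip f"
proof -
  assume f: "f \<in> M"
  have "ip (cscale c f) (cscale c f) = of_real ((norm c)\<^sup>2) * ip f f"
    using f by (simp add: ip_scale ip_scale_right complex_norm_square mult_ac del: of_real_power)
  then show ?thesis by (simp add: hnorm_def real_sqrt_mult)
qed

lemma hnorm_minus_commute: "f \<in> M \<Longrightarrow> g \<in> M \<Longrightarrow> hnorm ip (f - g) = hnorm ip (g - f)"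
  by (simp add: hnorm_def ip_diff ip_diff_right)

lemma hnorm_diff_sq:
  "f \<in> M \<Longrightarrow> g \<in> M \<Longrightarrow> (hnorm ip (f - g))\<^sup>2 = (hnorm ip f)\<^sup>2 - 2 * Re (ip f g) + (hnorm ip g)\<^sup>2"
  using ip_cnj[of f g] by (simp add: hnorm_sq ip_diff ip_diff_right)

lemma hnorm_add_sq:
  "f \<in> M \<Longrightarrow> g \<in> M \<Longrightarrow> (hnorm ip (f + g))\<^sup>2 = (hnorm ip f)\<^sup>2 + 2 * Re (ip f g) + (hnorm ip g)\<^sup>2"
  using ip_cnj[of f g] by (simp add: hnorm_sq ip_add ip_add_right)

lemma Cauchy_Schwarz:
  assumes f: "f \<in> M" and g: "g \<in> M"
  shows "norm (ip f g) \<le> hnorm ip f * hnorm ip g"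
proof (cases "g = 0")
  case False
  define a where "a = Re (ip g g)"
  have a: "a > 0" "ip g g = of_real a" using ip_pos[OF g False] ip_self[OF g] by (simp_all add: a_def)
  define c where "c = ip f g / of_real a"
  have "0 \<le> Re (ip (f - cscale c g) (f - cscale c g))"
    using f g by (intro Re_ip_self_nonneg) auto
  also have "ip (f - cscale c g) (f - cscale c g) = ip f f - cnj c * ip f g - c * cnj (ip f g) + c * cnj c * of_real a"
    using f g a ip_cnj[of f g] by (simp add: ip_diff ip_diff_right ip_scale ip_scale_right algebra_simps)
  also have "\<dots> = ip f f - of_real ((norm (ip f g))\<^sup>2 / a)"
    using a complex_norm_square[of "ip f g"] by (simp add: c_def field_simps)
  finally have "(norm (ip f g))\<^sup>2 \<le> Re (ip f f) * a" using a by (simp add: field_simps)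
  also have "\<dots> = (hnorm ip f * hnorm ip g)\<^sup>2"
    using f g by (simp add: power_mult_distrib hnorm_sq a_def)
  finally show ?thesis using f g by (simp add: power2_le_iff_abs_le)
qed (use f in simp)

lemma hnorm_triangle:
  assumes f: "f \<in> M" and g: "g \<in> M"
  shows "hnorm ip (f + g) \<le> hnorm ip f + hnorm ip g"
proof -
  have "Re (ip f g) \<le> hnorm ip f * hnorm ip g"
    using Cauchy_Schwarz[OF f g] complex_Re_le_cmod order_trans by blast
  then have "(hnorm ip (f + g))\<^sup>2 \<le> (hnorm ip f + hnorm ip g)\<^sup>2"
    using f g by (simp add: hnorm_add_sq power2_sum)
  then show ?thesis using f g by (simp add: power2_le_iff_abs_le)
qed

lemma hnorm_diff_triangle:
  "f \<in> M \<Longrightarrow> g \<in> M \<Longrightarrow> h \<in> M \<Longrightarrow> hnorm ip (f - h) \<le> hnorm ip (f - g) + hnorm ip (g - h)"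
  using hnorm_triangle[of "f - g" "g - h"] by simp

text \<open>The default value 0 is there because nonnegativity and symmetry of a distance are
  demanded for all arguments, while \<open>hnorm\<close> is known to satisfy them only on
  \<open>M\<close>. The metric is introduced for the Baire category theorem.\<close>

lemma Metric_space_hnorm: "Metric_space M (\<lambda>f g. if f \<in> M \<and> g \<in> M then hnorm ip (f - g) else 0)"
proof
  fix f g h
  show "f \<in> M \<Longrightarrow> g \<in> M \<Longrightarrow> h \<in> M \<Longrightarrow>
      (if f \<in> M \<and> h \<in> M then hnorm ip (f - h) else 0)
      \<le> (if f \<in> M \<and> g \<in> M then hnorm ip (f - g) else 0) + (if g \<in> M \<and> h \<in> M then hnorm ip (g - h) else 0)"
    using hnorm_diff_triangle[of f g h] by simp
qed (auto simp: hnorm_minus_commute hnorm_eq_0_iff)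

sublocale hms: Metric_space M "\<lambda>f g. if f \<in> M \<and> g \<in> M then hnorm ip (f - g) else 0"
  by (rule Metric_space_hnorm)

lemma mcomplete_hnorm: "hms.mcomplete"
  unfolding hms.mcomplete_def
proof (intro allI impI)
  fix X assume X: "hms.MCauchy X"
  then have r: "range X \<subseteq> M" by (simp add: hms.MCauchy_def)
  have "\<exists>N. \<forall>m\<ge>N. \<forall>n\<ge>N. hnorm ip (X m - X n) < e" if "e > 0" for e
    using X that r unfolding hms.MCauchy_def
    by (smt (verit, best) rangeI subsetD)
  from complete[OF r this] obtain f where f: "f \<in> M" "(\<lambda>n. hnorm ip (X n - f)) \<longlonglongrightarrow> 0" by blast
  have "limitin hms.mtopology X f sequentially"
  proof -
    have "X n \<in> M" for n using r by blast
    with f show ?thesis unfolding hms.limitin_metric_dist_null by simp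
  qed
  then show "\<exists>x. limitin hms.mtopology X x sequentially" by blast
qed

lemma ip_tendsto:
  assumes X: "\<And>n. X n \<in> M" and x: "x \<in> M" and lim: "(\<lambda>n. hnorm ip (X n - x)) \<longlonglongrightarrow> 0" and h: "h \<in> M"
  shows "(\<lambda>n. ip (X n) h) \<longlonglongrightarrow> ip x h"
proof (rule LIM_zero_cancel, rule Lim_null_comparison)
  show "eventually (\<lambda>n. norm (ip (X n) h - ip x h) \<le> hnorm ip (X n - x) * hnorm ip h) sequentially"
    using Cauchy_Schwarz[of "X n - x" h for n] X x h by (simp add: ip_diff)
  show "(\<lambda>n. hnorm ip (X n - x) * hnorm ip h) \<longlonglongrightarrow> 0"
    using tendsto_mult_left_zero[OF lim] .
qed

lemma ip_ext:
  assumes "u \<in> M" "v \<in> M" "\<And>f. f \<in> M \<Longrightarrow> ip f u = ip f v"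
  shows "u = v"
proof -
  have "ip (u - v) (u - v) = 0" using assms by (simp add: ip_diff_right)
  then show ?thesis using assms ip_pos[of "u - v"] by fastforce
qed

text \<open>A variational proof: if \<open>k\<close> represents the functional, then
  \<open>J f\<close> equals |f - k|^2 - |k|^2, so \<open>k\<close> is found as the limit of a
  minimizing sequence of \<open>J\<close>.\<close>

lemma Riesz_representation:
  fixes \<phi> :: "'m cfun \<Rightarrow> complex"
  assumes add: "\<And>f g. f \<in> M \<Longrightarrow> g \<in> M \<Longrightarrow> \<phi> (f + g) = \<phi> f + \<phi> g"
    and scale: "\<And>c f. f \<in> M \<Longrightarrow> \<phi> (cscale c f) = c * \<phi> f"
    and bound: "\<And>f. f \<in> M \<Longrightarrow> norm (\<phi> f) \<le> B * hnorm ip f"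
  shows "\<exists>k\<in>M. \<forall>f\<in>M. \<phi> f = ip f k"
proof -
  define J where "J f = (hnorm ip f)\<^sup>2 - 2 * Re (\<phi> f)" for f
  define m where "m = Inf (J ` M)"
  have "- B\<^sup>2 \<le> J f" if "f \<in> M" for f
  proof -
    have "Re (\<phi> f) \<le> B * hnorm ip f"
      using bound[OF that] complex_Re_le_cmod order_trans by blast
    moreover have "0 \<le> (hnorm ip f - B)\<^sup>2" by simp
    ultimately show ?thesis unfolding J_def by (simp add: power2_diff mult.commute)
  qed
  then have bdd: "bdd_below (J ` M)" by (auto simp: bdd_below_def)
  then have m: "m \<le> J f" if "f \<in> M" for f unfolding m_def using that by (intro cInf_lower) auto
  have "\<exists>f\<in>M. J f < m + 1 / real (Suc n)" for n
  proof -
    have "J ` M \<noteq> {}" using zero_mem by blast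
    from cInf_less_iff[OF this bdd, of "m + 1 / real (Suc n)"] show ?thesis
      by (auto simp: m_def)
  qed
  then obtain X where X: "\<And>n. X n \<in> M" "\<And>n. J (X n) < m + 1 / real (Suc n)" by metis
  \<comment> \<open>The parallelogram law for \<open>f\<close> and \<open>g\<close>, combined with
    \<open>m \<le> J h\<close> for their midpoint \<open>h\<close>; it makes minimizing sequences
    Cauchy.\<close>
  have par: "(hnorm ip (f - g))\<^sup>2 \<le> 2 * (J f - m) + 2 * (J g - m)" if "f \<in> M" "g \<in> M" for f g
  proof -
    define h where "h = cscale (1/2) (f + g)"
    have "h \<in> M" using that by (simp add: h_def)
    have "(hnorm ip h)\<^sup>2 = (hnorm ip (f + g))\<^sup>2 / 4"
      using that by (simp add: h_def hnorm_cscale power_divide norm_divide power_mult_distrib)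
    moreover have "Re (\<phi> h) = (Re (\<phi> f) + Re (\<phi> g)) / 2"
      using that by (simp add: h_def scale add)
    ultimately have "4 * J h = (hnorm ip (f + g))\<^sup>2 - 4 * (Re (\<phi> f) + Re (\<phi> g))"
      by (simp add: J_def)
    moreover have "(hnorm ip (f + g))\<^sup>2 + (hnorm ip (f - g))\<^sup>2 = 2 * (hnorm ip f)\<^sup>2 + 2 * (hnorm ip g)\<^sup>2"
      using that by (simp add: hnorm_add_sq hnorm_diff_sq)
    ultimately show ?thesis using m[OF \<open>h \<in> M\<close>] by (simp add: J_def)
  qed
  have "\<exists>N. \<forall>p\<ge>N. \<forall>n\<ge>N. hnorm ip (X p - X n) < e" if e: "e > 0" for e
  proof -
    obtain N where N: "4 / e\<^sup>2 < real N" using reals_Archimedean2 by blast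
    show ?thesis
    proof (intro exI[of _ N] allI impI)
      fix p n assume pn: "p \<ge> N" "n \<ge> N"
      have b: "J (X k) - m \<le> 1 / real (Suc N)" if "k \<ge> N" for k
      proof -
        have "1 / real (Suc k) \<le> 1 / real (Suc N)" using that by (intro divide_left_mono) auto
        then show ?thesis using X(2)[of k] by simp
      qed
      have "(hnorm ip (X p - X n))\<^sup>2 \<le> 4 / real (Suc N)"
        using par[OF X(1) X(1), of p n] b[OF pn(1)] b[OF pn(2)] by simp
      also have "\<dots> < e\<^sup>2"
      proof -
        have e2: "e\<^sup>2 > 0" using e by simp
        then have "4 < real N * e\<^sup>2" using N by (simp only: pos_divide_less_eq)
        also have "\<dots> \<le> real (Suc N) * e\<^sup>2" using e2 by (intro mult_right_mono) auto
        finally show ?thesis by (simp only: pos_divide_less_eq mult.commute of_nat_0_less_iff zero_less_Suc)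
      qed
      finally show "hnorm ip (X p - X n) < e" using e by (simp add: power_less_imp_less_base)
    qed
  qed
  then obtain k where k: "k \<in> M" "(\<lambda>n. hnorm ip (X n - k)) \<longlonglongrightarrow> 0"
    using complete[of X] X(1) by blast
  have crit: "Re (\<phi> f) = Re (ip k f)" if f: "f \<in> M" for f
  proof -
    define a where "a = Re (ip k f) - Re (\<phi> f)"
    \<comment> \<open>First variation in direction \<open>f\<close>. It is carried out at
      \<open>X n\<close>, where comparison with \<open>m\<close> leaves an error 1/(n+1); thus only
      the inner products with \<open>f\<close> have to converge and continuity of \<open>J\<close>
      is not involved.\<close>
    have ineq: "0 \<le> 2 * t * a + t\<^sup>2 * (hnorm ip f)\<^sup>2" for t :: real
    proof -
      have "(\<lambda>n. 2 * t * (Re (ip (X n) f) - Re (\<phi> f)) + t\<^sup>2 * (hnorm ip f)\<^sup>2 + 1 / real (Suc n))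
          \<longlonglongrightarrow> 2 * t * a + t\<^sup>2 * (hnorm ip f)\<^sup>2 + 0"
        unfolding a_def by (intro tendsto_intros ip_tendsto X k f LIMSEQ_Suc[OF lim_1_over_n])
      moreover have "0 \<le> 2 * t * (Re (ip (X n) f) - Re (\<phi> f)) + t\<^sup>2 * (hnorm ip f)\<^sup>2 + 1 / real (Suc n)" for n
      proof -
        let ?y = "cscale (of_real t) f"
        have "m \<le> J (X n + ?y)" using X f by (intro m) auto
        also have "J (X n + ?y) = J (X n) + 2 * t * (Re (ip (X n) f) - Re (\<phi> f)) + t\<^sup>2 * (hnorm ip f)\<^sup>2"
          using X(1)[of n] f
          by (simp add: J_def hnorm_add_sq add scale ip_scale_right hnorm_cscale power_mult_distrib algebra_simps)
        finally show ?thesis using X(2)[of n] by simp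
      qed
      ultimately show ?thesis by (intro LIMSEQ_le_const) auto
    qed
    \<comment> \<open>The quadratic in \<open>t\<close> is smallest at - a / |f|^2; the added 1
      avoids a division by zero for f = 0 and still forces a = 0.\<close>
    define q where "q = (hnorm ip f)\<^sup>2 + 1"
    have q: "q > 0" by (simp add: q_def add_nonneg_pos)
    have "0 \<le> 2 * (- a / q) * a + (- a / q)\<^sup>2 * (hnorm ip f)\<^sup>2" by (rule ineq)
    also have "\<dots> \<le> 2 * (- a / q) * a + (- a / q)\<^sup>2 * q" by (intro add_left_mono mult_left_mono) (auto simp: q_def)
    also have "\<dots> = - (a\<^sup>2 / q)" using q by (simp add: power2_eq_square field_simps)
    finally have "a\<^sup>2 / q \<le> 0" by simp
    then have "a = 0" using q by (simp add: divide_le_0_iff)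
    then show ?thesis by (simp add: a_def)
  qed
  have "\<phi> f = ip f k" if f: "f \<in> M" for f
  proof (rule complex_eqI)
    show "Re (\<phi> f) = Re (ip f k)" using crit[OF f] ip_cnj[of f k] f k by simp
    have "Re (\<phi> (cscale \<i> f)) = Re (ip k (cscale \<i> f))" using f by (intro crit) auto
    then show "Im (\<phi> f) = Im (ip f k)" using f k ip_cnj[of f k] by (simp add: scale ip_scale_right)
  qed
  with k show ?thesis by blast
qed

lemma hnorm_le_of_ip_bound:
  assumes "k \<in> M" "B \<ge> 0" "\<And>f. f \<in> M \<Longrightarrow> norm (ip f k) \<le> B * hnorm ip f"
  shows "hnorm ip k \<le> B"
proof (cases "k = 0")
  case False
  have "(hnorm ip k)\<^sup>2 \<le> B * hnorm ip k"
    using assms(3)[OF assms(1)] assms(1) complex_Re_le_cmod[of "ip k k"] by (simp add: hnorm_sq)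
  moreover have "hnorm ip k > 0"
    using False hnorm_eq_0_iff[OF assms(1)] hnorm_nonneg[OF assms(1)] by linarith
  ultimately show ?thesis by (simp add: power2_eq_square)
qed (use assms in simp)

end

section \<open>Ideals of germs\<close>

lemma holomorphic_near_sum:
  "(\<And>i. i \<in> I \<Longrightarrow> holomorphic_near w (f i)) \<Longrightarrow> holomorphic_near w (\<lambda>z. \<Sum>i\<in>I. f i z)"
proof (induction I rule: infinite_finite_induct)
  case (insert i I)
  then have "holomorphic_near w (f i + (\<lambda>z. \<Sum>i\<in>I. f i z))" by (intro holomorphic_near_add) auto
  with insert.hyps show ?case by (simp add: plus_fun_def)
qed (auto intro: holomorphic_near_const)

lemma holomorphic_near_times:
  "holomorphic_near w f \<Longrightarrow> holomorphic_near w g \<Longrightarrow> holomorphic_near w (\<lambda>z. f z * g z)"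
  using holomorphic_near_mult[of w f g] by (simp add: times_fun_def)

lemma holomorphic_near_diff:
  assumes "holomorphic_near w f" "holomorphic_near w g"
  shows "holomorphic_near w (\<lambda>z. f z - g z)"
  using holomorphic_near_add[OF assms(1) holomorphic_near_times[OF holomorphic_near_const[of w "-1"] assms(2)]]
  by (simp add: plus_fun_def)

lemma holomorphic_near_imp_isCont: "holomorphic_near w f \<Longrightarrow> isCont f w"
  unfolding holomorphic_near_def
  using holomorphic_fun_on_imp_continuous_on continuous_on_eq_continuous_at by metis

lemma holomorphic_near_inverse:
  assumes f: "holomorphic_near w f" and nz: "f w \<noteq> 0"
  shows "holomorphic_near w (\<lambda>z. inverse (f z))"
proof -
  obtain U where U: "open U" "w \<in> U" "holomorphic_fun_on f U" using f unfolding holomorphic_near_def by blast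
  define V where "V = U \<inter> f -` (- {0})"
  have "open V" unfolding V_def
    using holomorphic_fun_on_imp_continuous_on[OF U(3)] U(1) by (intro continuous_open_preimage) auto
  moreover have "w \<in> V" using U nz by (simp add: V_def)
  moreover have "holomorphic_fun_on (\<lambda>z. inverse (f z)) V"
    unfolding holomorphic_fun_on_def
  proof
    fix z assume z: "z \<in> V"
    then obtain D where D: "(f has_derivative D) (at z)" "\<forall>c v. D (c *s v) = c * D v"
      using U unfolding holomorphic_fun_on_def V_def by blast
    have "((\<lambda>z. inverse (f z)) has_derivative (\<lambda>v. - (inverse (f z) * D v * inverse (f z)))) (at z)"
      using D(1) z by (intro Deriv.has_derivative_inverse) (auto simp: V_def)
    then show "\<exists>D. ((\<lambda>z. inverse (f z)) has_derivative D) (at z) \<and> (\<forall>c v. D (c *s v) = c * D v)"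
      using D(2) by (intro exI[of _ "\<lambda>v. - (inverse (f z) * D v * inverse (f z))"]) auto
  qed
  ultimately show ?thesis unfolding holomorphic_near_def by blast
qed

lemma germ_in_carrier: "holomorphic_near w f \<Longrightarrow> germ w f \<in> carrier (germ_ring w)"
  by (simp add: germ_ring_carrier)

text \<open>The index set may be infinite, hence the finite set \<open>L\<close>. One description
  thus serves both a finite family of generators and the stalk, where the index set is
  \<open>M\<close> itself and \<open>F\<close> is the identity.\<close>

lemma genideal_germs:
  assumes F: "\<And>i. i \<in> I \<Longrightarrow> holomorphic_near w (F i)"
  shows "Idl\<^bsub>germ_ring w\<^esub> ((\<lambda>i. germ w (F i)) ` I) =
    {germ w (\<lambda>z. \<Sum>i\<in>L. a i z * F i z) | L a. finite L \<and> L \<subseteq> I \<and> (\<forall>i. holomorphic_near w (a i))}"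
    (is "?Idl = ?S")
proof
  interpret cring "germ_ring w" by (rule cring_germ_ring)
  have gens: "(\<lambda>i. germ w (F i)) ` I \<subseteq> carrier (germ_ring w)"
    using F by (auto intro: germ_in_carrier)
  have hol: "holomorphic_near w (\<lambda>z. \<Sum>i\<in>L. a i z * F i z)" if "L \<subseteq> I" "\<forall>i. holomorphic_near w (a i)" for L a
    using that F by (intro holomorphic_near_sum holomorphic_near_times) auto
  have memI: "germ w f \<in> ?S" if "f = (\<lambda>z. \<Sum>i\<in>L. a i z * F i z)" "finite L" "L \<subseteq> I" "\<forall>i. holomorphic_near w (a i)" for f L a
    using that by blast
  have mult_closed: "germ w h \<otimes>\<^bsub>germ_ring w\<^esub> x \<in> ?S" if x: "x \<in> ?S" and h: "holomorphic_near w h" for x h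
  proof -
    obtain L a where L: "x = germ w (\<lambda>z. \<Sum>i\<in>L. a i z * F i z)" "finite L" "L \<subseteq> I" "\<forall>i. holomorphic_near w (a i)"
      using x by blast
    show ?thesis unfolding L(1) germ_ring_mult
      by (rule memI[where a = "\<lambda>i z. h z * a i z" and L = L])
        (use L h in \<open>auto simp: fun_eq_iff sum_distrib_left mult.assoc intro!: holomorphic_near_times\<close>)
  qed
  have "ideal ?S (germ_ring w)"
  proof (rule idealI)
    show "ring (germ_ring w)" by (rule ring_axioms)
    show "subgroup ?S (add_monoid (germ_ring w))"
    proof
      show "?S \<subseteq> carrier (add_monoid (germ_ring w))" using hol by (auto intro: germ_in_carrier)
      show "\<one>\<^bsub>add_monoid (germ_ring w)\<^esub> \<in> ?S"
      proof -
        have "germ w 0 \<in> ?S"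
          by (rule memI[where L = "{}" and a = "\<lambda>i z. 0"]) (auto simp: fun_eq_iff intro: holomorphic_near_const)
        then show ?thesis by (simp only: monoid.select_convs germ_ring_zero)
      qed
      fix x assume x: "x \<in> ?S"
      then have "germ w (\<lambda>z. -1) \<otimes>\<^bsub>germ_ring w\<^esub> x \<in> ?S" by (intro mult_closed holomorphic_near_const)
      moreover have "inv\<^bsub>add_monoid (germ_ring w)\<^esub> x = germ w (\<lambda>z. -1) \<otimes>\<^bsub>germ_ring w\<^esub> x"
        unfolding a_inv_def[symmetric]
      proof (rule minus_equality)
        obtain f where f: "x = germ w f" "holomorphic_near w f" using x hol by blast
        show "germ w (\<lambda>z. -1) \<otimes>\<^bsub>germ_ring w\<^esub> x \<oplus>\<^bsub>germ_ring w\<^esub> x = \<zero>\<^bsub>germ_ring w\<^esub>"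
          unfolding f germ_ring_mult germ_ring_add germ_ring_zero by (rule arg_cong[of _ _ "germ w"]) (simp add: fun_eq_iff)
        show "x \<in> carrier (germ_ring w)" "germ w (\<lambda>z. -1) \<otimes>\<^bsub>germ_ring w\<^esub> x \<in> carrier (germ_ring w)"
          using f by (auto intro!: germ_in_carrier m_closed holomorphic_near_const)
      qed
      ultimately show "inv\<^bsub>add_monoid (germ_ring w)\<^esub> x \<in> ?S" by simp
      fix y assume y: "y \<in> ?S"
      obtain L a where L: "x = germ w (\<lambda>z. \<Sum>i\<in>L. a i z * F i z)" "finite L" "L \<subseteq> I" "\<forall>i. holomorphic_near w (a i)"
        using x by blast
      obtain L' b where L': "y = germ w (\<lambda>z. \<Sum>i\<in>L'. b i z * F i z)" "finite L'" "L' \<subseteq> I" "\<forall>i. holomorphic_near w (b i)"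
        using y by blast
      \<comment> \<open>The two combinations may use different, overlapping index sets; extension by
        zero to the union lets them be added termwise.\<close>
      define e where "e i z = (if i \<in> L then a i z else 0) + (if i \<in> L' then b i z else 0)" for i z
      have "holomorphic_near w (e i)" for i
      proof -
        have "e i = (if i \<in> L then a i else (\<lambda>z. 0)) + (if i \<in> L' then b i else (\<lambda>z. 0))"
          by (simp add: e_def fun_eq_iff)
        moreover have "holomorphic_near w (if i \<in> L then a i else (\<lambda>z. 0))"
          "holomorphic_near w (if i \<in> L' then b i else (\<lambda>z. 0))"
          using L L' by (simp_all add: holomorphic_near_const)
        ultimately show ?thesis using holomorphic_near_add by metis
      qed
      moreover have "(\<lambda>z. \<Sum>i\<in>L. a i z * F i z) + (\<lambda>z. \<Sum>i\<in>L'. b i z * F i z) = (\<lambda>z. \<Sum>i\<in>L\<union>L'. e i z * F i z)"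
      proof
        fix z
        have "(\<Sum>i\<in>L. a i z * F i z) = (\<Sum>i\<in>L\<union>L'. (if i \<in> L then a i z else 0) * F i z)"
          "(\<Sum>i\<in>L'. b i z * F i z) = (\<Sum>i\<in>L\<union>L'. (if i \<in> L' then b i z else 0) * F i z)"
          using L L' by (auto intro!: sum.mono_neutral_cong_left)
        then show "((\<lambda>z. \<Sum>i\<in>L. a i z * F i z) + (\<lambda>z. \<Sum>i\<in>L'. b i z * F i z)) z = (\<Sum>i\<in>L\<union>L'. e i z * F i z)"
          by (simp add: e_def distrib_right sum.distrib)
      qed
      ultimately have "germ w ((\<lambda>z. \<Sum>i\<in>L. a i z * F i z) + (\<lambda>z. \<Sum>i\<in>L'. b i z * F i z)) \<in> ?S"
        using L(2,3) L'(2,3) by (intro memI[where L = "L \<union> L'" and a = e]) auto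
      then show "x \<otimes>\<^bsub>add_monoid (germ_ring w)\<^esub> y \<in> ?S"
        by (simp only: L(1) L'(1) monoid.select_convs germ_ring_add)
    qed
    fix x y assume x: "x \<in> ?S" and y: "y \<in> carrier (germ_ring w)"
    then show yx: "y \<otimes>\<^bsub>germ_ring w\<^esub> x \<in> ?S" unfolding germ_ring_carrier using mult_closed by blast
    moreover have "x \<in> carrier (germ_ring w)" using x hol germ_in_carrier by blast
    ultimately show "x \<otimes>\<^bsub>germ_ring w\<^esub> y \<in> ?S" using m_comm[of x y] y by simp
  qed
  moreover have "(\<lambda>i. germ w (F i)) ` I \<subseteq> ?S"
  proof
    fix x assume "x \<in> (\<lambda>i. germ w (F i)) ` I"
    then obtain i where "x = germ w (F i)" "i \<in> I" by blast
    then show "x \<in> ?S"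
      using memI[where f = "F i" and a = "\<lambda>i z. 1" and L = "{i}"] by (simp add: holomorphic_near_const)
  qed
  ultimately show "?Idl \<subseteq> ?S" by (rule genideal_minimal)
  interpret J: ideal ?Idl "germ_ring w" by (rule genideal_ideal[OF gens])
  show "?S \<subseteq> ?Idl"
  proof
    fix x assume "x \<in> ?S"
    then obtain L a where L: "x = germ w (\<lambda>z. \<Sum>i\<in>L. a i z * F i z)" "finite L" "L \<subseteq> I" "\<forall>i. holomorphic_near w (a i)"
      by blast
    from L(2,3) have "germ w (\<lambda>z. \<Sum>i\<in>L. a i z * F i z) \<in> ?Idl"
    proof (induction L)
      case empty
      then show ?case using J.zero_closed by (simp add: germ_ring_zero zero_fun_def)
    next
      case (insert i L)
      have "germ w (F i) \<in> ?Idl" using insert.prems genideal_self[OF gens] by blast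
      then have "germ w (a i) \<otimes>\<^bsub>germ_ring w\<^esub> germ w (F i) \<in> ?Idl"
        using L(4) by (intro J.I_l_closed germ_in_carrier) auto
      moreover have "germ w (\<lambda>z. \<Sum>i\<in>L. a i z * F i z) \<in> ?Idl" using insert by simp
      ultimately have "germ w (a i) \<otimes>\<^bsub>germ_ring w\<^esub> germ w (F i) \<oplus>\<^bsub>germ_ring w\<^esub> germ w (\<lambda>z. \<Sum>i\<in>L. a i z * F i z) \<in> ?Idl"
        by (rule J.a_closed)
      then show ?case using insert.hyps by (simp add: germ_ring_mult germ_ring_add plus_fun_def times_fun_def)
    qed
    then show "x \<in> ?Idl" by (simp add: L(1))
  qed
qed

text \<open>For finite \<open>I\<close> the subset \<open>L\<close> can be enlarged to
  \<open>I\<close> with zero coefficients, which puts all coefficient families in one shape, so that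
  they can be subtracted.\<close>

lemma germ_mem_genideal_finite:
  assumes F: "\<And>i. i \<in> I \<Longrightarrow> holomorphic_near w (F i)" and "finite I"
  shows "germ w f \<in> Idl\<^bsub>germ_ring w\<^esub> ((\<lambda>i. germ w (F i)) ` I) \<longleftrightarrow>
    (\<exists>a. (\<forall>i. holomorphic_near w (a i)) \<and> eventually (\<lambda>z. f z = (\<Sum>i\<in>I. a i z * F i z)) (nhds w))"
    (is "?L \<longleftrightarrow> ?R")
proof
  have eq: "Idl\<^bsub>germ_ring w\<^esub> ((\<lambda>i. germ w (F i)) ` I) =
    {germ w (\<lambda>z. \<Sum>i\<in>L. a i z * F i z) | L a. finite L \<and> L \<subseteq> I \<and> (\<forall>i. holomorphic_near w (a i))}"
    by (rule genideal_germs) (rule F)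
  have extend: "\<exists>b. (\<forall>i. holomorphic_near w (b i)) \<and> (\<forall>z. (\<Sum>i\<in>L. a i z * F i z) = (\<Sum>i\<in>I. b i z * F i z))"
    if L: "L \<subseteq> I" "\<forall>i. holomorphic_near w (a i)" for L a
  proof (rule exI[of _ "\<lambda>i. if i \<in> L then a i else (\<lambda>z. 0)"], intro conjI allI)
    show "holomorphic_near w (if i \<in> L then a i else (\<lambda>z. 0))" for i
      using L(2) holomorphic_near_const[of w 0] by simp
    show "(\<Sum>i\<in>L. a i z * F i z) = (\<Sum>i\<in>I. (if i \<in> L then a i else (\<lambda>z. 0)) z * F i z)" for z
      by (rule sum.mono_neutral_cong_left[OF \<open>finite I\<close> L(1)]) auto
  qed
  show ?R if l: ?L
  proof -
    obtain L a where L: "germ w f = germ w (\<lambda>z. \<Sum>i\<in>L. a i z * F i z)" "L \<subseteq> I" "\<forall>i. holomorphic_near w (a i)"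
      using l unfolding eq by (elim CollectE exE conjE) (rule that)
    obtain b where b: "\<forall>i. holomorphic_near w (b i)" "\<forall>z. (\<Sum>i\<in>L. a i z * F i z) = (\<Sum>i\<in>I. b i z * F i z)"
      using extend[OF L(2,3)] by blast
    from L(1) have "eventually (\<lambda>z. f z = (\<Sum>i\<in>L. a i z * F i z)) (nhds w)" by (simp only: germ_eq_iff)
    then have "eventually (\<lambda>z. f z = (\<Sum>i\<in>I. b i z * F i z)) (nhds w)"
      by (rule eventually_mono) (rule trans[OF _ b(2)[rule_format]])
    with b(1) show ?thesis by (intro exI[of _ b] conjI)
  qed
  show ?L if r: ?R
  proof -
    obtain a where a: "\<forall>i. holomorphic_near w (a i)" "eventually (\<lambda>z. f z = (\<Sum>i\<in>I. a i z * F i z)) (nhds w)"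
      using r by blast
    from a(2) have "germ w f = germ w (\<lambda>z. \<Sum>i\<in>I. a i z * F i z)" unfolding germ_eq_iff .
    then show ?thesis using \<open>finite I\<close> a(1) unfolding eq
      by (intro CollectI exI[of _ I] exI[of _ a] conjI order_refl)
  qed
qed

text \<open>Otherwise the generator with a nonvanishing coefficient could be solved for, the ring of germs
  being local.\<close>

lemma minimal_generators_relation:
  assumes min: "minimal_generators w S d g" and x: "\<And>i. i \<in> {1..d} \<Longrightarrow> holomorphic_near w (x i)"
    and rel: "eventually (\<lambda>z. (\<Sum>i=1..d. x i z * g i z) = 0) (nhds w)" and k: "k \<in> {1..d}"
  shows "x k w = 0"
proof (rule ccontr)
  assume nz: "x k w \<noteq> 0"
  interpret cring "germ_ring w" by (rule cring_germ_ring)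
  define J where "J = {1..d} - {k}"
  have J: "J \<subset> {1..d}" "finite J" "k \<notin> J" unfolding J_def using k by (blast, simp, blast)
  have g: "holomorphic_near w (g i)" if "i \<in> {1..d}" for i using min that by (simp add: minimal_generators_def)
  let ?G = "\<lambda>I. (\<lambda>i. germ w (g i)) ` I"
  have car: "?G {1..d} \<subseteq> carrier (germ_ring w)" "?G J \<subseteq> carrier (germ_ring w)"
    using g J by (blast intro: germ_in_carrier)+
  define a where "a i = (if i \<in> J then (\<lambda>z. - 1 * (x i z * inverse (x k z))) else (\<lambda>z. 0))" for i
  have "holomorphic_near w (a i)" for i
  proof (cases "i \<in> J")
    case True
    then have "i \<in> {1..d}" using J by blast
    then have "holomorphic_near w (\<lambda>z. - 1 * (x i z * inverse (x k z)))"
      by (intro holomorphic_near_times holomorphic_near_const x holomorphic_near_inverse k nz)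
    then show ?thesis using True by (simp add: a_def)
  qed (simp add: a_def holomorphic_near_const)
  moreover have "(x k \<longlongrightarrow> x k w) (nhds w)"
    using holomorphic_near_imp_isCont[OF x[OF k]] by (simp only: isCont_def tendsto_at_iff_tendsto_nhds)
  then have "eventually (\<lambda>z. x k z \<noteq> 0) (nhds w)" using nz by (rule tendsto_imp_eventually_ne)
  with rel have "eventually (\<lambda>z. g k z = (\<Sum>i\<in>J. a i z * g i z)) (nhds w)"
  proof eventually_elim
    case (elim z)
    have "(\<Sum>i=1..d. x i z * g i z) = x k z * g k z + (\<Sum>i\<in>J. x i z * g i z)"
      using k unfolding J_def by (intro sum.remove) auto
    with elim(1) have "x k z * g k z = - (\<Sum>i\<in>J. x i z * g i z)" by (simp add: eq_neg_iff_add_eq_0)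
    then have "inverse (x k z) * (x k z * g k z) = - inverse (x k z) * (\<Sum>i\<in>J. x i z * g i z)" by simp
    then have "g k z = - inverse (x k z) * (\<Sum>i\<in>J. x i z * g i z)"
      using elim(2) by (simp flip: mult.assoc)
    also have "\<dots> = (\<Sum>i\<in>J. a i z * g i z)"
      unfolding sum_distrib_left by (intro sum.cong) (auto simp: a_def)
    finally show ?case .
  qed
  ultimately have a: "\<exists>a. (\<forall>i. holomorphic_near w (a i)) \<and> eventually (\<lambda>z. g k z = (\<Sum>i\<in>J. a i z * g i z)) (nhds w)"
    by (intro exI[of _ a] conjI allI)
  have gk: "germ w (g k) \<in> Idl\<^bsub>germ_ring w\<^esub> (?G J)"
    by (rule germ_mem_genideal_finite[THEN iffD2, OF _ J(2) a]) (use g J in blast)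
  have "?G J \<subseteq> Idl\<^bsub>germ_ring w\<^esub> (?G J)" by (rule genideal_self[OF car(2)])
  with gk have "?G (insert k J) \<subseteq> Idl\<^bsub>germ_ring w\<^esub> (?G J)" by simp
  also have "insert k J = {1..d}" using k unfolding J_def by blast
  finally have "?G {1..d} \<subseteq> Idl\<^bsub>germ_ring w\<^esub> (?G J)" .
  then have "Idl\<^bsub>germ_ring w\<^esub> (?G {1..d}) \<subseteq> Idl\<^bsub>germ_ring w\<^esub> (?G J)"
    by (intro genideal_minimal genideal_ideal car)
  moreover have "Idl\<^bsub>germ_ring w\<^esub> (?G J) \<subseteq> Idl\<^bsub>germ_ring w\<^esub> (?G {1..d})"
    by (rule subset_Idl_subset[OF car(1)]) (use J in blast)
  ultimately have "Idl\<^bsub>germ_ring w\<^esub> (?G J) = S" using min by (simp add: minimal_generators_def)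
  with min J(1) show False by (simp add: minimal_generators_def)
qed

section \<open>Kernel decompositions\<close>

lemma holomorphic_near_power: "holomorphic_near w f \<Longrightarrow> holomorphic_near w (\<lambda>z. f z ^ n)"
proof (induction n)
  case 0
  then show ?case by (simp add: holomorphic_near_const)
next
  case (Suc n)
  then have "holomorphic_near w (\<lambda>z. f z * f z ^ n)" by (intro holomorphic_near_times) simp_all
  then show ?case by simp
qed

lemma holomorphic_near_prod:
  "(\<And>i. i \<in> I \<Longrightarrow> holomorphic_near w (f i)) \<Longrightarrow> holomorphic_near w (\<lambda>z. \<Prod>i\<in>I. f i z)"
proof (induction I rule: infinite_finite_induct)
  case (insert i I)
  then have "holomorphic_near w (\<lambda>z. f i z * (\<Prod>i\<in>I. f i z))" by (intro holomorphic_near_times) simp_all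
  with insert.hyps show ?case by simp
qed (simp_all add: holomorphic_near_const)

lemma holomorphic_near_component: "holomorphic_near w (\<lambda>z. z $ (j :: 'm::finite))"
  unfolding holomorphic_near_def holomorphic_fun_on_def
proof (intro exI[of _ UNIV] conjI ballI open_UNIV UNIV_I)
  fix z :: "complex ^ 'm"
  show "\<exists>D. ((\<lambda>z. z $ j) has_derivative D) (at z) \<and> (\<forall>c v. D (c *s v) = c * D v)"
    by (intro exI[of _ "\<lambda>v. v $ j"] conjI bounded_linear_imp_has_derivative bounded_linear_vec_nth) simp
qed

lemma holomorphic_near_poly_eval: "holomorphic_near w (poly_eval p)"
proof -
  have "holomorphic_near w (\<lambda>z. \<Sum>\<alpha>\<in>Poly_Mapping.keys p.
        Poly_Mapping.lookup p \<alpha> * (\<Prod>j\<in>UNIV. (z $ j) ^ Poly_Mapping.lookup \<alpha> j))"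
    by (intro holomorphic_near_sum holomorphic_near_times holomorphic_near_const holomorphic_near_prod
        holomorphic_near_power holomorphic_near_component)
  moreover have "poly_eval p = (\<lambda>z. \<Sum>\<alpha>\<in>Poly_Mapping.keys p.
        Poly_Mapping.lookup p \<alpha> * (\<Prod>j\<in>UNIV. (z $ j) ^ Poly_Mapping.lookup \<alpha> j))"
    by (rule ext) (rule poly_eval_def)
  ultimately show ?thesis by simp
qed

lemma holomorphic_fun_on_imp_near: "holomorphic_fun_on f U \<Longrightarrow> open U \<Longrightarrow> w \<in> U \<Longrightarrow> holomorphic_near w f"
  unfolding holomorphic_near_def by (intro exI[of _ U] conjI)

text \<open>The inner product is conjugate-linear in its second argument, so it turns the
  conjugate-linear derivative of \<open>F\<close> into a complex-linear one; Cauchy-Schwarz controls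
  the remainder.\<close>

lemma (in hilbert_function_space) holomorphic_fun_on_ip_antiholomorphic:
  assumes F: "antiholomorphic_into M ip S F" and S: "open S" and f: "f \<in> M"
  shows "holomorphic_fun_on (\<lambda>w. ip f (F w)) S"
  unfolding holomorphic_fun_on_def
proof
  fix z assume z: "z \<in> S"
  have FM: "F w \<in> M" if "w \<in> S" for w using F that by (simp add: antiholomorphic_into_def)
  obtain D where D: "\<And>v. D v \<in> M" "\<And>u v. D (u + v) = D u + D v"
      "\<And>c v. D (c *s v) = cscale (cnj c) (D v)"
      "((\<lambda>v. hnorm ip (F (z + v) - F z - D v) / norm v) \<longlongrightarrow> 0) (at 0)"
    using F z unfolding antiholomorphic_into_def by blast
  define E where "E v = ip f (D v)" for v
  have Eadd: "E (u + v) = E u + E v" for u v by (simp add: E_def D ip_add_right f)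
  have Escale: "E (c *s v) = c * E v" for c v by (simp add: E_def D ip_scale_right f)
  have "((\<lambda>w. ip f (F w)) has_derivative E) (at z)"
    unfolding has_derivative_at
  proof (intro conjI)
    show "bounded_linear E" using Eadd Escale by (rule complex_linear_imp_bounded_linear)
    have "eventually (\<lambda>v. z + v \<in> S) (at 0)"
    proof -
      have "((\<lambda>v. z + v) \<longlongrightarrow> z + 0) (at 0)" by (intro tendsto_intros)
      then show ?thesis using S z by (intro topological_tendstoD) auto
    qed
    then have "eventually (\<lambda>v. norm (norm (ip f (F (z + v)) - ip f (F z) - E v) / norm v)
        \<le> hnorm ip f * (hnorm ip (F (z + v) - F z - D v) / norm v)) (at 0)"
    proof eventually_elim
      case (elim v)
      have "ip f (F (z + v)) - ip f (F z) - E v = ip f (F (z + v) - F z - D v)"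
        by (simp add: E_def ip_diff_right f FM z elim D(1))
      then have "norm (ip f (F (z + v)) - ip f (F z) - E v) \<le> hnorm ip f * hnorm ip (F (z + v) - F z - D v)"
        using Cauchy_Schwarz[of f "F (z + v) - F z - D v"] by (simp add: f FM z elim D(1))
      then show ?case by (simp add: divide_right_mono)
    qed
    moreover have "((\<lambda>v. hnorm ip f * (hnorm ip (F (z + v) - F z - D v) / norm v)) \<longlongrightarrow> 0) (at 0)"
      using D(4) by (rule tendsto_mult_right_zero)
    ultimately show "(\<lambda>v. norm (ip f (F (z + v)) - ip f (F z) - E v) / norm v) \<midarrow>0\<rightarrow> 0"
      by (rule Lim_null_comparison)
  qed
  with Escale show "\<exists>D. ((\<lambda>w. ip f (F w)) has_derivative D) (at z) \<and> (\<forall>c v. D (c *s v) = c * D v)"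
    by blast
qed

text \<open>The difference of two coefficient families of the same function is a relation among the
  generators. Only the values at \<open>w\<close> are determined, not the coefficient
  functions.\<close>

lemma minimal_generators_coeff_unique:
  assumes min: "minimal_generators w S d g" and k: "k \<in> {1..d}"
    and x: "\<And>i. i \<in> {1..d} \<Longrightarrow> holomorphic_near w (x i)" and y: "\<And>i. i \<in> {1..d} \<Longrightarrow> holomorphic_near w (y i)"
    and f: "eventually (\<lambda>z. f z = (\<Sum>i=1..d. x i z * g i z)) (nhds w)"
      "eventually (\<lambda>z. f z = (\<Sum>i=1..d. y i z * g i z)) (nhds w)"
  shows "x k w = y k w"
proof -
  have "eventually (\<lambda>z. (\<Sum>i=1..d. (x i z - y i z) * g i z) = 0) (nhds w)"
    using f by eventually_elim (simp add: left_diff_distrib sum_subtractf)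
  then have "x k w - y k w = 0"
    using minimal_generators_relation[OF min, of "\<lambda>i z. x i z - y i z" k] x y k
    by (simp add: holomorphic_near_diff)
  then show ?thesis by simp
qed

lemma (in hilbert_function_space) kernel_decomposition_expand:
  assumes dec: "kernel_decomposition \<Omega> M ip K w0 d g \<Omega>0 KK" and K: "reproducing_kernel \<Omega> M ip K"
    and f: "f \<in> M" and w: "w \<in> \<Omega>0"
  shows "f w = (\<Sum>i=1..d. ip f (KK i w) * g i w)"
proof -
  have KM: "KK i w \<in> M" if "i \<in> {1..d}" for i
    using dec w that by (simp add: kernel_decomposition_def antiholomorphic_into_def)
  have "w \<in> \<Omega>" using dec w by (auto simp: kernel_decomposition_def)
  then have "f w = ip f (\<lambda>z. K z w)" using K f by (simp add: reproducing_kernel_def)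
  also have "(\<lambda>z. K z w) = (\<Sum>i=1..d. cscale (cnj (g i w)) (KK i w))"
    using dec w by (simp add: kernel_decomposition_def)
  also have "ip f \<dots> = (\<Sum>i=1..d. ip f (cscale (cnj (g i w)) (KK i w)))"
    by (rule ip_sum_right) (use f KM in auto)
  also have "\<dots> = (\<Sum>i=1..d. ip f (KK i w) * g i w)"
    by (rule sum.cong) (use f KM in \<open>simp_all add: ip_scale_right\<close>)
  finally show ?thesis .
qed

text \<open>A locale, because uniqueness and independence of the span compare two instances over the
  same module, the latter with different generators.\<close>

locale kernel_decomposition_space = hilbert_function_space M ip
  for M :: "('m::finite) cfun set" and ip +
  fixes \<Omega> :: "(complex ^ 'm) set" and K w0 d g \<Omega>0 KK
  assumes min: "minimal_generators w0 (stalk M w0) d g"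
    and K: "reproducing_kernel \<Omega> M ip K"
    and dec: "kernel_decomposition \<Omega> M ip K w0 d g \<Omega>0 KK"
begin

lemma nbhd: "open \<Omega>0" "w0 \<in> \<Omega>0" "\<Omega>0 \<subseteq> \<Omega>"
  using dec by (simp_all add: kernel_decomposition_def)

lemma KK_mem: "i \<in> {1..d} \<Longrightarrow> w \<in> \<Omega>0 \<Longrightarrow> KK i w \<in> M"
  using dec by (simp add: kernel_decomposition_def antiholomorphic_into_def)

lemma holomorphic_near_ip_KK: "i \<in> {1..d} \<Longrightarrow> f \<in> M \<Longrightarrow> holomorphic_near w0 (\<lambda>w. ip f (KK i w))"
  using dec nbhd
  by (intro holomorphic_fun_on_imp_near[of _ \<Omega>0] holomorphic_fun_on_ip_antiholomorphic)
    (simp_all add: kernel_decomposition_def)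

lemma expand: "f \<in> M \<Longrightarrow> eventually (\<lambda>w. f w = (\<Sum>i=1..d. ip f (KK i w) * g i w)) (nhds w0)"
  using kernel_decomposition_expand[OF dec K] nbhd unfolding eventually_nhds by blast

text \<open>The common source of (iii), (iv) and (v): to evaluate \<open>KK i w0\<close> against
  \<open>f\<close>, any holomorphic coefficients of \<open>f\<close> near \<open>w0\<close> may be
  used, not just those coming from the given decomposition.\<close>

lemma ip_KK_eq:
  assumes "i \<in> {1..d}" "f \<in> M" "\<And>i. i \<in> {1..d} \<Longrightarrow> holomorphic_near w0 (x i)"
    and "eventually (\<lambda>z. f z = (\<Sum>i=1..d. x i z * g i z)) (nhds w0)"
  shows "ip f (KK i w0) = x i w0"
  by (rule minimal_generators_coeff_unique[OF min assms(1) holomorphic_near_ip_KK[OF _ assms(2)] assms(3)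
        expand[OF assms(2)] assms(4)])

text \<open>Multiplying an expansion of \<open>f\<close> by \<open>p\<close> gives an expansion of
  the product, so the coefficient values at \<open>w0\<close> are multiplied by the value of
  \<open>p\<close> there.\<close>

lemma adjoint_op_KK:
  assumes i: "i \<in> {1..d}" and p: "\<And>f. f \<in> M \<Longrightarrow> module_mult p f \<in> M"
  shows "adjoint_op M ip (module_mult p) (KK i w0) = cscale (cnj (poly_eval p w0)) (KK i w0)"
proof (rule adjoint_op_eqI)
  show "cscale (cnj (poly_eval p w0)) (KK i w0) \<in> M" using KK_mem[OF i nbhd(2)] by simp
  fix f assume f: "f \<in> M"
  have "ip (module_mult p f) (KK i w0) = poly_eval p w0 * ip f (KK i w0)"
  proof (rule ip_KK_eq[OF i p[OF f]])
    show "holomorphic_near w0 (\<lambda>w. poly_eval p w * ip f (KK i w))" if "i \<in> {1..d}" for i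
      by (intro holomorphic_near_times holomorphic_near_poly_eval holomorphic_near_ip_KK f that)
    from expand[OF f]
    show "eventually (\<lambda>z. module_mult p f z = (\<Sum>i=1..d. poly_eval p z * ip f (KK i z) * g i z)) (nhds w0)"
      by eventually_elim (simp add: module_mult_def sum_distrib_left mult.assoc)
  qed
  then show "ip (module_mult p f) (KK i w0) = ip f (cscale (cnj (poly_eval p w0)) (KK i w0))"
    using KK_mem[OF i nbhd(2)] f by (simp add: ip_scale_right)
qed

text \<open>Writing the \<open>g' j\<close> as combinations of the \<open>g i\<close> with
  coefficients \<open>a j i\<close> and substituting into the second expansion gives coefficients
  for the first. At \<open>w0\<close> this expresses \<open>KK i w0\<close> through the
  \<open>KK' j w0\<close> with the conjugates of \<open>a j i w0\<close>. Exchanging the roles gives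
  the other inclusion, and \<open>d = d'\<close> need not be known.\<close>

lemma span_KK_subset:
  assumes "kernel_decomposition_space M ip \<Omega> K w0 d' g' \<Omega>0' KK'"
  shows "(\<lambda>i. KK i w0) ` {1..d} \<subseteq> cfun.span ((\<lambda>i. KK' i w0) ` {1..d'})"
proof -
  interpret other: kernel_decomposition_space M ip \<Omega> K w0 d' g' \<Omega>0' KK' by fact
  interpret R: cring "germ_ring w0" by (rule cring_germ_ring)
  have g: "holomorphic_near w0 (g i)" if "i \<in> {1..d}" for i
    using min that by (simp add: minimal_generators_def)
  have g': "holomorphic_near w0 (g' i)" if "i \<in> {1..d'}" for i
    using other.min that by (simp add: minimal_generators_def)
  have "\<forall>j\<in>{1..d'}. \<exists>a. (\<forall>i. holomorphic_near w0 (a i)) \<and>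
      eventually (\<lambda>z. g' j z = (\<Sum>i=1..d. a i z * g i z)) (nhds w0)"
  proof
    fix j assume j: "j \<in> {1..d'}"
    have "(\<lambda>i. germ w0 (g' i)) ` {1..d'} \<subseteq> Idl\<^bsub>germ_ring w0\<^esub> ((\<lambda>i. germ w0 (g' i)) ` {1..d'})"
      by (rule R.genideal_self) (use g' germ_in_carrier in blast)
    also have "\<dots> = Idl\<^bsub>germ_ring w0\<^esub> ((\<lambda>i. germ w0 (g i)) ` {1..d})"
      using min other.min by (simp add: minimal_generators_def)
    finally have "germ w0 (g' j) \<in> Idl\<^bsub>germ_ring w0\<^esub> ((\<lambda>i. germ w0 (g i)) ` {1..d})"
      using j by blast
    then show "\<exists>a. (\<forall>i. holomorphic_near w0 (a i)) \<and>
        eventually (\<lambda>z. g' j z = (\<Sum>i=1..d. a i z * g i z)) (nhds w0)"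
      by (rule germ_mem_genideal_finite[THEN iffD1, rotated 2]) (rule g, assumption, rule finite_atLeastAtMost)
  qed
  from bchoice[OF this] obtain a where a: "\<And>j i. j \<in> {1..d'} \<Longrightarrow> holomorphic_near w0 (a j i)"
    "\<And>j. j \<in> {1..d'} \<Longrightarrow> eventually (\<lambda>z. g' j z = (\<Sum>i=1..d. a j i z * g i z)) (nhds w0)"
    by blast
  have a2: "eventually (\<lambda>z. \<forall>j\<in>{1..d'}. g' j z = (\<Sum>i=1..d. a j i z * g i z)) (nhds w0)"
    by (rule eventually_ball_finite) (use a(2) in blast)+
  show ?thesis
  proof
    fix k assume "k \<in> (\<lambda>i. KK i w0) ` {1..d}"
    then obtain i where i: "i \<in> {1..d}" and k: "k = KK i w0" by blast
    have K'M: "KK' j w0 \<in> M" if "j \<in> {1..d'}" for j using other.KK_mem[OF that other.nbhd(2)] .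
    have "k = (\<Sum>j=1..d'. cscale (cnj (a j i w0)) (KK' j w0))"
    proof (rule ip_ext)
      show "k \<in> M" using KK_mem[OF i nbhd(2)] k by simp
      show "(\<Sum>j=1..d'. cscale (cnj (a j i w0)) (KK' j w0)) \<in> M"
        by (intro sum_mem scale_mem K'M)
      fix f assume f: "f \<in> M"
      have "ip f (KK i w0) = (\<Sum>j=1..d'. ip f (KK' j w0) * a j i w0)"
      proof (rule ip_KK_eq[OF i f])
        show "holomorphic_near w0 (\<lambda>z. \<Sum>j=1..d'. ip f (KK' j z) * a j i z)" for i
          by (intro holomorphic_near_sum holomorphic_near_times other.holomorphic_near_ip_KK f a(1))
        from other.expand[OF f] a2
        show "eventually (\<lambda>z. f z = (\<Sum>i=1..d. (\<Sum>j=1..d'. ip f (KK' j z) * a j i z) * g i z)) (nhds w0)"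
        proof eventually_elim
          case (elim z)
          have "f z = (\<Sum>j=1..d'. ip f (KK' j z) * (\<Sum>i=1..d. a j i z * g i z))"
            unfolding elim(1) by (rule sum.cong) (use elim(2) in simp_all)
          also have "\<dots> = (\<Sum>j=1..d'. \<Sum>i=1..d. ip f (KK' j z) * a j i z * g i z)"
            by (simp add: sum_distrib_left mult.assoc)
          also have "\<dots> = (\<Sum>i=1..d. (\<Sum>j=1..d'. ip f (KK' j z) * a j i z) * g i z)"
            by (subst sum.swap) (simp add: sum_distrib_right)
          finally show ?case .
        qed
      qed
      also have "\<dots> = (\<Sum>j=1..d'. ip f (cscale (cnj (a j i w0)) (KK' j w0)))"
        by (rule sum.cong) (use f K'M in \<open>simp_all add: ip_scale_right\<close>)
      also have "\<dots> = ip f (\<Sum>j=1..d'. cscale (cnj (a j i w0)) (KK' j w0))"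
        by (rule ip_sum_right[symmetric]) (use f K'M in simp_all)
      finally show "ip f k = ip f (\<Sum>j=1..d'. cscale (cnj (a j i w0)) (KK' j w0))" unfolding k .
    qed
    also have "\<dots> \<in> cfun.span ((\<lambda>i. KK' i w0) ` {1..d'})"
      by (intro cfun.span_sum cfun.span_scale cfun.span_base imageI)
    finally show "k \<in> cfun.span ((\<lambda>i. KK' i w0) ` {1..d'})" .
  qed
qed

text \<open>The germ of \<open>g k\<close> is a combination of elements of \<open>M\<close> with
  holomorphic coefficients, so \<open>g k\<close> need not belong to \<open>M\<close>. Freezing
  these coefficients at \<open>w0\<close> gives an element of \<open>M\<close> whose expansion has
  the same values at \<open>w0\<close> as that of \<open>g k\<close>, namely a unit vector.\<close>

lemma dual_vectors:
  assumes M: "\<And>f. f \<in> M \<Longrightarrow> holomorphic_near w0 f" and k: "k \<in> {1..d}"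
  shows "\<exists>F\<in>M. \<forall>i\<in>{1..d}. ip F (KK i w0) = (if i = k then 1 else 0)"
proof -
  interpret R: cring "germ_ring w0" by (rule cring_germ_ring)
  have g: "holomorphic_near w0 (g i)" if "i \<in> {1..d}" for i
    using min that by (simp add: minimal_generators_def)
  have "(\<lambda>i. germ w0 (g i)) ` {1..d} \<subseteq> Idl\<^bsub>germ_ring w0\<^esub> ((\<lambda>i. germ w0 (g i)) ` {1..d})"
    by (rule R.genideal_self) (use g germ_in_carrier in blast)
  also have "\<dots> = Idl\<^bsub>germ_ring w0\<^esub> ((\<lambda>f. germ w0 f) ` M)"
    using min by (simp add: minimal_generators_def stalk_def)
  also have "\<dots> = {germ w0 (\<lambda>z. \<Sum>f\<in>L. a f z * f z) | L a. finite L \<and> L \<subseteq> M \<and> (\<forall>f. holomorphic_near w0 (a f))}"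
    by (rule genideal_germs) (rule M)
  finally have "germ w0 (g k) \<in> {germ w0 (\<lambda>z. \<Sum>f\<in>L. a f z * f z) | L a. finite L \<and> L \<subseteq> M \<and> (\<forall>f. holomorphic_near w0 (a f))}"
    using k by blast
  then obtain L a where L: "finite L" "L \<subseteq> M" "\<And>f. holomorphic_near w0 (a f)"
    and gk: "germ w0 (g k) = germ w0 (\<lambda>z. \<Sum>f\<in>L. a f z * f z)" by blast
  define F where "F = (\<Sum>f\<in>L. cscale (a f w0) f)"
  have LM: "f \<in> M" if "f \<in> L" for f using L(2) that by blast
  have F: "F \<in> M" unfolding F_def by (intro sum_mem scale_mem LM)
  have ev: "eventually (\<lambda>z. \<forall>f\<in>L. f z = (\<Sum>i=1..d. ip f (KK i z) * g i z)) (nhds w0)"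
    by (rule eventually_ball_finite[OF L(1)]) (use expand LM in simp)
  have "ip F (KK i w0) = (if i = k then 1 else 0)" if i: "i \<in> {1..d}" for i
  proof -
    have "ip F (KK i w0) = (\<Sum>f\<in>L. ip (cscale (a f w0) f) (KK i w0))"
      unfolding F_def by (rule ip_sum) (use LM KK_mem[OF i nbhd(2)] in simp_all)
    also have "\<dots> = (\<Sum>f\<in>L. a f w0 * ip f (KK i w0))"
      by (rule sum.cong) (use LM KK_mem[OF i nbhd(2)] in \<open>simp_all add: ip_scale\<close>)
    also have "\<dots> = (if i = k then 1 else 0)"
    proof (rule minimal_generators_coeff_unique[OF min i, where f = "g k"
          and x = "\<lambda>i z. \<Sum>f\<in>L. a f z * ip f (KK i z)" and y = "\<lambda>i z. if i = k then 1 else 0"])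
      show "holomorphic_near w0 (\<lambda>z. \<Sum>f\<in>L. a f z * ip f (KK i z))" if "i \<in> {1..d}" for i
        by (intro holomorphic_near_sum holomorphic_near_times L holomorphic_near_ip_KK LM that)
      show "holomorphic_near w0 (\<lambda>z. if i = k then 1 else 0)" for i by (rule holomorphic_near_const)
      show "eventually (\<lambda>z. g k z = (\<Sum>i=1..d. (if i = k then 1 else 0) * g i z)) (nhds w0)"
      proof (rule always_eventually, rule allI)
        fix z
        have "(\<Sum>i=1..d. (if i = k then 1 else 0) * g i z) = (\<Sum>i=1..d. if k = i then g i z else 0)"
          by (rule sum.cong) simp_all
        then show "g k z = (\<Sum>i=1..d. (if i = k then 1 else 0) * g i z)"
          using k by simp
      qed
      from gk[unfolded germ_eq_iff] ev
      show "eventually (\<lambda>z. g k z = (\<Sum>i=1..d. (\<Sum>f\<in>L. a f z * ip f (KK i z)) * g i z)) (nhds w0)"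
      proof eventually_elim
        case (elim z)
        have "g k z = (\<Sum>f\<in>L. a f z * (\<Sum>i=1..d. ip f (KK i z) * g i z))"
          unfolding elim(1) by (rule sum.cong[OF refl], rule arg_cong2[of _ _ _ _ times, OF refl])
            (use elim(2) in blast)
        also have "\<dots> = (\<Sum>f\<in>L. \<Sum>i=1..d. a f z * ip f (KK i z) * g i z)"
          by (simp add: sum_distrib_left mult.assoc)
        also have "\<dots> = (\<Sum>i=1..d. (\<Sum>f\<in>L. a f z * ip f (KK i z)) * g i z)"
          by (subst sum.swap) (simp add: sum_distrib_right)
        finally show ?case .
      qed
    qed
    finally show ?thesis .
  qed
  with F show ?thesis by blast
qed

end

section \<open>Linear independence near the base point\<close>

lemma linearly_independent_familyI:
  fixes v :: "nat \<Rightarrow> ('m::finite) cfun"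
  assumes fin: "finite I"
    and zero: "\<And>c i. (\<Sum>i\<in>I. cscale (c i) (v i)) = 0 \<Longrightarrow> i \<in> I \<Longrightarrow> c i = 0"
  shows "linearly_independent_family I v"
proof -
  have inj: "inj_on v I"
  proof (rule inj_onI, rule ccontr)
    fix i j assume ij: "i \<in> I" "j \<in> I" "v i = v j" "i \<noteq> j"
    define c where "c l = (if l = i then 1 else if l = j then - 1 else 0 :: complex)" for l
    have "(\<Sum>l\<in>I. cscale (c l) (v l)) = (\<Sum>l\<in>{i, j}. cscale (c l) (v l))"
      using ij fin by (intro sum.mono_neutral_right) (auto simp: c_def)
    also have "\<dots> = cscale 1 (v i) + cscale (- 1) (v j)" using ij(4) by (simp add: c_def)
    also have "\<dots> = 0" using ij(3) by (simp add: cscale_def fun_eq_iff)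
    finally have "c i = 0" using ij(1) by (rule zero)
    then show False by (simp add: c_def)
  qed
  have "cfun.independent (v ` I)"
  proof (rule ccontr)
    assume "\<not> cfun.independent (v ` I)"
    then have "cfun.dependent (v ` I)" by simp
    then obtain u where u: "\<exists>x\<in>v ` I. u x \<noteq> 0" "(\<Sum>x\<in>v ` I. cscale (u x) x) = 0"
      using cfun.dependent_finite[of "v ` I"] fin by blast
    from u(2) have "(\<Sum>i\<in>I. cscale (u (v i)) (v i)) = 0"
      by (simp add: sum.reindex[OF inj])
    from zero[OF this] u(1) show False by blast
  qed
  with inj show ?thesis by (simp add: linearly_independent_family_def)
qed

text \<open>The pairings of the dual vectors with the \<open>KK i w\<close> form the identity matrix
  at \<open>w0\<close> and stay entrywise within \<epsilon> of it nearby. As d * \<epsilon> < 1,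
  pairing a vanishing combination with the dual vector of the index whose coefficient is largest in
  modulus forces that coefficient, hence all of them, to be zero.\<close>

lemma (in kernel_decomposition_space) linearly_independent_near:
  assumes M: "\<And>f. f \<in> M \<Longrightarrow> holomorphic_near w0 f"
  shows "\<exists>N. open N \<and> w0 \<in> N \<and> N \<subseteq> \<Omega>0 \<and> (\<forall>w\<in>N. linearly_independent_family {1..d} (\<lambda>i. KK i w))"
proof -
  have "\<forall>k\<in>{1..d}. \<exists>F. F \<in> M \<and> (\<forall>i\<in>{1..d}. ip F (KK i w0) = (if i = k then 1 else 0))"
    using dual_vectors[OF M] by blast
  from bchoice[OF this] obtain F where F: "\<And>k. k \<in> {1..d} \<Longrightarrow> F k \<in> M"
    "\<And>k i. k \<in> {1..d} \<Longrightarrow> i \<in> {1..d} \<Longrightarrow> ip (F k) (KK i w0) = (if i = k then 1 else 0)" by blast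
  define \<epsilon> where "\<epsilon> = 1 / (real d + 1)"
  have \<epsilon>: "\<epsilon> > 0" by (simp add: \<epsilon>_def add_nonneg_pos)
  have "eventually (\<lambda>w. norm (ip (F k) (KK i w) - (if i = k then 1 else 0)) < \<epsilon>) (nhds w0)"
    if "k \<in> {1..d}" "i \<in> {1..d}" for k i
  proof -
    have "((\<lambda>w. ip (F k) (KK i w)) \<longlongrightarrow> ip (F k) (KK i w0)) (nhds w0)"
      by (rule tendsto_at_iff_tendsto_nhds[THEN iffD1])
        (rule holomorphic_near_imp_isCont[OF holomorphic_near_ip_KK[OF that(2) F(1)[OF that(1)]], unfolded isCont_def])
    from tendstoD[OF this \<epsilon>] show ?thesis unfolding F(2)[OF that] dist_norm .
  qed
  then have "eventually (\<lambda>w. \<forall>k\<in>{1..d}. \<forall>i\<in>{1..d}. norm (ip (F k) (KK i w) - (if i = k then 1 else 0)) < \<epsilon>) (nhds w0)"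
    by (intro eventually_ball_finite ballI finite_atLeastAtMost)
  then obtain N where N: "open N" "w0 \<in> N"
    "\<And>w k i. w \<in> N \<Longrightarrow> k \<in> {1..d} \<Longrightarrow> i \<in> {1..d} \<Longrightarrow> norm (ip (F k) (KK i w) - (if i = k then 1 else 0)) < \<epsilon>"
    unfolding eventually_nhds by blast
  have "linearly_independent_family {1..d} (\<lambda>i. KK i w)" if w: "w \<in> N \<inter> \<Omega>0" for w
  proof (rule linearly_independent_familyI)
    fix c i0 assume sum0: "(\<Sum>i=1..d. cscale (c i) (KK i w)) = 0" and i0: "i0 \<in> {1..d}"
    obtain k where k: "k \<in> {1..d}" "\<And>i. i \<in> {1..d} \<Longrightarrow> norm (c i) \<le> norm (c k)"
    proof -
      have "Max ((\<lambda>i. norm (c i)) ` {1..d}) \<in> (\<lambda>i. norm (c i)) ` {1..d}"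
        by (rule Max_in) (use i0 in auto)
      then obtain k where k: "k \<in> {1..d}" "Max ((\<lambda>i. norm (c i)) ` {1..d}) = norm (c k)" by blast
      show ?thesis
      proof (rule that[OF k(1)])
        show "norm (c i) \<le> norm (c k)" if "i \<in> {1..d}" for i
          unfolding k(2)[symmetric] using that by (intro Max_ge imageI) simp_all
      qed
    qed
    have KM: "KK i w \<in> M" if "i \<in> {1..d}" for i using KK_mem that w by blast
    let ?e = "\<lambda>i. ip (F k) (KK i w) - (if i = k then 1 else 0)"
    have "0 = ip (F k) (\<Sum>i=1..d. cscale (c i) (KK i w))" using F(1)[OF k(1)] by (simp only: sum0 ip_zero)
    also have "\<dots> = (\<Sum>i=1..d. ip (F k) (cscale (c i) (KK i w)))"
      by (rule ip_sum_right) (use F(1)[OF k(1)] KM in simp_all)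
    also have "\<dots> = (\<Sum>i=1..d. cnj (c i) * ?e i + (if k = i then cnj (c i) else 0))"
      by (rule sum.cong) (use F(1)[OF k(1)] KM in \<open>simp_all add: ip_scale_right right_diff_distrib\<close>)
    also have "\<dots> = (\<Sum>i=1..d. cnj (c i) * ?e i) + cnj (c k)"
      unfolding sum.distrib using k(1) by simp
    finally have "cnj (c k) = - (\<Sum>i=1..d. cnj (c i) * ?e i)" by (simp add: eq_neg_iff_add_eq_0 add.commute)
    then have "norm (cnj (c k)) = norm (\<Sum>i=1..d. cnj (c i) * ?e i)" by (simp only: norm_minus_cancel)
    then have "norm (c k) = norm (\<Sum>i=1..d. cnj (c i) * ?e i)" by (simp only: complex_mod_cnj)
    also have "\<dots> \<le> (\<Sum>i=1..d. norm (c k) * \<epsilon>)"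
    proof (rule order_trans[OF norm_sum], rule sum_mono)
      fix i assume i: "i \<in> {1..d}"
      have "norm (?e i) \<le> \<epsilon>" using N(3)[OF _ k(1) i, of w] w by simp
      then show "norm (cnj (c i) * ?e i) \<le> norm (c k) * \<epsilon>"
        unfolding norm_mult complex_mod_cnj using k(2)[OF i] by (intro mult_mono) simp_all
    qed
    also have "\<dots> = norm (c k) * (real d * \<epsilon>)" by simp
    finally have "norm (c k) * (1 - real d * \<epsilon>) \<le> 0" by (simp add: algebra_simps)
    moreover have "1 - real d * \<epsilon> > 0" by (simp add: \<epsilon>_def field_simps)
    ultimately have "norm (c k) \<le> 0" by (simp add: mult_le_0_iff)
    then show "c i0 = 0" using k(2)[OF i0] by simp
  qed simp
  then show ?thesis using N nbhd by (intro exI[of _ "N \<inter> \<Omega>0"]) blast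
qed

section \<open>Lifting elements of the module to coefficient functions\<close>

text \<open>Here \<open>L f x\<close> reads ``\<open>x\<close> lifts \<open>f\<close>''. The quotient seminorm inherits the parallelogram law
  from \<open>Q\<close>, and therefore sums of almost minimal lifts are almost minimal.\<close>

locale quadratic_lifting =
  fixes M :: "('m::finite) cfun set" and L :: "'m cfun \<Rightarrow> 'x::ab_group_add \<Rightarrow> bool"
    and Q :: "'x \<Rightarrow> real" and scal :: "complex \<Rightarrow> 'x \<Rightarrow> 'x"
  assumes subspace: "cfun.subspace M"
    and L_ex: "f \<in> M \<Longrightarrow> \<exists>x. L f x"
    and L_add: "L f x \<Longrightarrow> L g y \<Longrightarrow> L (f + g) (x + y)"
    and L_diff: "L f x \<Longrightarrow> L g y \<Longrightarrow> L (f - g) (x - y)"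
    and L_scale: "L f x \<Longrightarrow> L (cscale a f) (scal a x)"
    and Q_nonneg: "Q x \<ge> 0"
    and Q_parallelogram: "L f x \<Longrightarrow> L g y \<Longrightarrow> Q (x + y) + Q (x - y) = 2 * Q x + 2 * Q y"
    and Q_scale: "Q (scal a x) = (norm a)\<^sup>2 * Q x"
begin

definition q :: "'m cfun \<Rightarrow> real" where "q f = Inf (Q ` {x. L f x})"

text \<open>The infimum need not be attained, so minimality carries an error
  \<open>e\<close>.\<close>

definition near_min :: "'m cfun \<Rightarrow> 'x \<Rightarrow> real \<Rightarrow> bool" where
  "near_min f x e \<longleftrightarrow> L f x \<and> Q x \<le> q f + e"

lemma q_le: "L f x \<Longrightarrow> q f \<le> Q x"
  unfolding q_def by (rule cInf_lower) (auto simp: bdd_below_def Q_nonneg intro!: exI[of _ 0])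

lemma le_q: "f \<in> M \<Longrightarrow> (\<And>x. L f x \<Longrightarrow> c \<le> Q x) \<Longrightarrow> c \<le> q f"
  unfolding q_def using L_ex[of f] by (intro cInf_greatest) auto

lemma near_min_ex:
  assumes f: "f \<in> M" and e: "e > 0"
  shows "\<exists>x. near_min f x e"
proof (rule ccontr)
  assume "\<nexists>x. near_min f x e"
  then have "q f + e \<le> Q x" if "L f x" for x
    using that unfolding near_min_def by (meson linear)
  then have "q f + e \<le> q f" by (rule le_q[OF f])
  with e show False by simp
qed

lemma q_scale_le: "f \<in> M \<Longrightarrow> q (cscale a f) \<le> (norm a)\<^sup>2 * q f"
proof (cases "a = 0")
  case True
  assume "f \<in> M"
  then obtain x where "L f x" using L_ex by blast
  from q_le[OF L_scale[OF this, of a]] show ?thesis using True by (simp add: Q_scale)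
next
  case False
  assume f: "f \<in> M"
  have "q (cscale a f) / (norm a)\<^sup>2 \<le> q f"
  proof (rule le_q[OF f])
    fix x assume "L f x"
    from q_le[OF L_scale[OF this, of a]] show "q (cscale a f) / (norm a)\<^sup>2 \<le> Q x"
      using False by (simp add: Q_scale field_simps)
  qed
  then show ?thesis using False by (simp add: field_simps)
qed

lemma q_scale_ge:
  assumes f: "f \<in> M" shows "(norm a)\<^sup>2 * q f \<le> q (cscale a f)"
proof (cases "a = 0")
  case True
  have "0 \<le> q (cscale a f)"
    using f subspace by (intro le_q) (auto simp: Q_nonneg cfun.subspace_scale)
  with True show ?thesis by simp
next
  case False
  have "cscale (1 / a) (cscale a f) = f" using False by (simp add: cscale_def)
  then have "q f \<le> (norm (1 / a))\<^sup>2 * q (cscale a f)"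
    using q_scale_le[of "cscale a f" "1 / a"] f subspace by (simp add: cfun.subspace_scale)
  then show ?thesis using False by (simp add: norm_divide power_divide field_simps)
qed

lemma q_parallelogram_le:
  assumes f: "f \<in> M" and g: "g \<in> M"
  shows "q (f + g) + q (f - g) \<le> 2 * q f + 2 * q g"
proof (rule field_le_epsilon)
  fix e :: real assume e: "e > 0"
  obtain x y where x: "near_min f x (e / 4)" and y: "near_min g y (e / 4)"
    using near_min_ex[OF f, of "e / 4"] near_min_ex[OF g, of "e / 4"] e by auto
  then show "q (f + g) + q (f - g) \<le> 2 * q f + 2 * q g + e"
    using q_le[OF L_add, of f x g y] q_le[OF L_diff, of f x g y] Q_parallelogram[of f x g y]
    unfolding near_min_def by linarith
qed

text \<open>The opposite inequality applied to \<open>f + g\<close> and \<open>f - g\<close>, whose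
  sum and difference are 2f and 2g; homogeneity of \<open>q\<close> then gives the claim.\<close>

lemma q_parallelogram:
  assumes f: "f \<in> M" and g: "g \<in> M"
  shows "2 * q f + 2 * q g \<le> q (f + g) + q (f - g)"
proof -
  have eq: "(f + g) + (f - g) = cscale 2 f" "(f + g) - (f - g) = cscale 2 g"
    by (simp_all add: cscale_def fun_eq_iff)
  have "q (cscale 2 f) + q (cscale 2 g) \<le> 2 * q (f + g) + 2 * q (f - g)"
    using q_parallelogram_le[of "f + g" "f - g"] f g subspace
    unfolding eq by (simp add: cfun.subspace_add cfun.subspace_diff)
  then show ?thesis using q_scale_ge[OF f, of 2] q_scale_ge[OF g, of 2] by simp
qed

text \<open>Uniform convexity: \<open>x + y\<close> lifts 2f, so \<open>Q (x + y)\<close> is at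
  least 4 * q f, and the parallelogram law leaves little for \<open>x - y\<close>.\<close>

lemma near_min_diff:
  assumes f: "f \<in> M" and "near_min f x e" "near_min f y e'"
  shows "Q (x - y) \<le> 2 * e + 2 * e'"
proof -
  have "f + f = cscale 2 f" by (simp add: cscale_def fun_eq_iff)
  then have "4 * q f \<le> q (f + f)" using q_scale_ge[OF f, of 2] by simp
  also have "\<dots> \<le> Q (x + y)" using assms by (intro q_le L_add) (simp_all add: near_min_def)
  finally show ?thesis
    using assms Q_parallelogram[of f x f y] unfolding near_min_def by linarith
qed

text \<open>In the parallelogram law \<open>Q (x - y)\<close> is at least \<open>q (f - g)\<close>,
  which bounds \<open>Q (x + y)\<close> from above; the law for \<open>q\<close> turns this bound
  into \<open>q (f + g)\<close> plus the error.\<close>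

lemma near_min_add:
  assumes "f \<in> M" "g \<in> M" "near_min f x e" "near_min g y e'"
  shows "near_min (f + g) (x + y) (2 * e + 2 * e')"
  using assms L_add[of f x g y] q_le[OF L_diff, of f x g y] Q_parallelogram[of f x g y] q_parallelogram[of f g]
  unfolding near_min_def by linarith

lemma near_min_scale:
  assumes "f \<in> M" "near_min f x e"
  shows "near_min (cscale a f) (scal a x) ((norm a)\<^sup>2 * e)"
proof -
  have "Q (scal a x) \<le> (norm a)\<^sup>2 * (q f + e)"
    using assms unfolding Q_scale near_min_def by (intro mult_left_mono) simp_all
  also have "\<dots> \<le> q (cscale a f) + (norm a)\<^sup>2 * e"
    using q_scale_ge[OF assms(1), of a] by (simp add: distrib_left)
  finally show ?thesis using assms L_scale[of f x a] by (simp add: near_min_def)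
qed

end

text \<open>Radius and bound are explicit parameters: the Baire argument stratifies \<open>M\<close>
  by them, and limits of lifts need both fixed.\<close>

definition lifts :: "complex ^ 'm \<Rightarrow> real \<Rightarrow> nat \<Rightarrow> (nat \<Rightarrow> ('m::finite) cfun) \<Rightarrow> real \<Rightarrow> 'm cfun
    \<Rightarrow> (nat \<Rightarrow> 'm cfun) \<Rightarrow> bool" where
  "lifts c R d g C f x \<longleftrightarrow>
    (\<forall>i\<in>{1..d}. holomorphic_fun_on (x i) (polydisc c R) \<and> (\<forall>z\<in>polydisc c R. norm (x i z) \<le> C)) \<and>
    (\<forall>z\<in>polydisc c R. f z = (\<Sum>i=1..d. x i z * g i z))"

lemma liftsD:
  assumes "lifts c R d g C f x"
  shows "i \<in> {1..d} \<Longrightarrow> holomorphic_fun_on (x i) (polydisc c R)"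
    and "i \<in> {1..d} \<Longrightarrow> z \<in> polydisc c R \<Longrightarrow> norm (x i z) \<le> C"
    and "z \<in> polydisc c R \<Longrightarrow> f z = (\<Sum>i=1..d. x i z * g i z)"
  using assms unfolding lifts_def by blast+

lemma lifts_mono: "lifts c R d g C f x \<Longrightarrow> C \<le> D \<Longrightarrow> lifts c R d g D f x"
  unfolding lifts_def by (meson order_trans)

lemma lifts_zero: "C \<ge> 0 \<Longrightarrow> lifts c R d g C 0 (\<lambda>i z. 0)"
  by (simp add: lifts_def holomorphic_fun_on_const)

lemma lifts_add:
  assumes "lifts c R d g C f x" "lifts c R d g D f' y"
  shows "lifts c R d g (C + D) (f + f') (x + y)"
  unfolding lifts_def
proof (intro conjI ballI)
  fix i assume i: "i \<in> {1..d}"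
  show "holomorphic_fun_on ((x + y) i) (polydisc c R)"
    using holomorphic_fun_on_add[OF liftsD(1)[OF assms(1) i] liftsD(1)[OF assms(2) i]]
    by (simp only: plus_fun_apply)
  show "norm ((x + y) i z) \<le> C + D" if "z \<in> polydisc c R" for z
    using norm_triangle_le[OF add_mono[OF liftsD(2)[OF assms(1) i that] liftsD(2)[OF assms(2) i that]]]
    by (simp only: plus_fun_apply)
next
  fix z assume z: "z \<in> polydisc c R"
  show "(f + f') z = (\<Sum>i=1..d. (x + y) i z * g i z)"
    unfolding plus_fun_apply liftsD(3)[OF assms(1) z] liftsD(3)[OF assms(2) z]
    by (simp add: distrib_right sum.distrib)
qed

lemma lifts_scale:
  assumes "lifts c R d g C f x"
  shows "lifts c R d g (norm a * C) (cscale a f) (\<lambda>i z. a * x i z)"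
  unfolding lifts_def
proof (intro conjI ballI)
  fix i assume i: "i \<in> {1..d}"
  show "holomorphic_fun_on (\<lambda>z. a * x i z) (polydisc c R)"
    using holomorphic_fun_on_mult[OF holomorphic_fun_on_const liftsD(1)[OF assms i], of a]
    by (simp add: times_fun_def)
  show "norm (a * x i z) \<le> norm a * C" if "z \<in> polydisc c R" for z
    unfolding norm_mult by (intro mult_left_mono liftsD(2)[OF assms i that] norm_ge_zero)
next
  fix z assume z: "z \<in> polydisc c R"
  show "cscale a f z = (\<Sum>i=1..d. a * x i z * g i z)"
    unfolding cscale_def liftsD(3)[OF assms z] by (simp add: sum_distrib_left mult.assoc)
qed

lemma lifts_diff:
  assumes "lifts c R d g C f x" "lifts c R d g D f' y"
  shows "lifts c R d g (C + D) (f - f') (x - y)"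
proof -
  have "f + cscale (- 1) f' = f - f'" "x + (\<lambda>i z. - 1 * y i z) = x - y"
    by (simp_all add: cscale_def fun_eq_iff)
  then show ?thesis using lifts_add[OF assms(1) lifts_scale[OF assms(2), of "- 1"]] by simp
qed

text \<open>The common bound makes pointwise convergence of the coefficients enough for a
  holomorphic limit.\<close>

lemma lifts_limit:
  assumes l: "\<And>n. lifts c R d g C (F n) (X n)"
    and X: "\<And>i z. i \<in> {1..d} \<Longrightarrow> z \<in> polydisc c R \<Longrightarrow> (\<lambda>n. X n i z) \<longlonglongrightarrow> Y i z"
    and F: "\<And>z. z \<in> polydisc c R \<Longrightarrow> (\<lambda>n. F n z) \<longlonglongrightarrow> f z"
  shows "lifts c R d g C f Y"
  unfolding lifts_def
proof (intro conjI ballI)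
  fix i assume i: "i \<in> {1..d}"
  show "holomorphic_fun_on (Y i) (polydisc c R)"
    by (rule holomorphic_fun_on_pointwise_limit[OF open_polydisc liftsD(1)[OF l i] liftsD(2)[OF l i] X[OF i]])
  show "norm (Y i z) \<le> C" if z: "z \<in> polydisc c R" for z
    by (rule LIMSEQ_le_const2[OF tendsto_norm[OF X[OF i z]]]) (use liftsD(2)[OF l i z] in blast)
next
  fix z assume z: "z \<in> polydisc c R"
  have "(\<lambda>n. \<Sum>i=1..d. X n i z * g i z) \<longlonglongrightarrow> (\<Sum>i=1..d. Y i z * g i z)"
    by (intro tendsto_sum tendsto_mult_right X z)
  then have "(\<lambda>n. F n z) \<longlonglongrightarrow> (\<Sum>i=1..d. Y i z * g i z)"
    by (simp only: liftsD(3)[OF l z])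
  with F[OF z] show "f z = (\<Sum>i=1..d. Y i z * g i z)" by (rule LIMSEQ_unique)
qed

lemma lifts_from_germ:
  assumes g: "\<And>i. i \<in> {1..d} \<Longrightarrow> holomorphic_near w (g i)"
    and f: "germ w f \<in> Idl\<^bsub>germ_ring w\<^esub> ((\<lambda>i. germ w (g i)) ` {1..d})"
  shows "\<exists>R>0. \<exists>C. \<exists>x. lifts w R d g C f x"
proof -
  obtain a where a: "\<And>i. holomorphic_near w (a i)"
    and fa: "eventually (\<lambda>z. f z = (\<Sum>i=1..d. a i z * g i z)) (nhds w)"
    using germ_mem_genideal_finite[THEN iffD1, OF g finite_atLeastAtMost f] by blast
  have "\<forall>i. \<exists>U. open U \<and> w \<in> U \<and> holomorphic_fun_on (a i) U"
    using a unfolding holomorphic_near_def by blast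
  then obtain U where U: "\<And>i. open (U i)" "\<And>i. w \<in> U i" "\<And>i. holomorphic_fun_on (a i) (U i)"
    by metis
  \<comment> \<open>The inserted 0 keeps the maximum defined when d = 0.\<close>
  define C where "C = Max (insert 0 ((\<lambda>i. norm (a i w) + 1) ` {1..d}))"
  have "eventually (\<lambda>z. z \<in> U i \<and> norm (a i z) < norm (a i w) + 1) (nhds w)" for i
  proof (rule eventually_conj)
    show "eventually (\<lambda>z. z \<in> U i) (nhds w)" by (rule eventually_nhds_in_open[OF U(1,2)])
    have "(a i \<longlongrightarrow> a i w) (nhds w)"
      by (rule tendsto_at_iff_tendsto_nhds[THEN iffD1])
        (rule holomorphic_near_imp_isCont[OF a, unfolded isCont_def])
    then have "((\<lambda>z. norm (a i z)) \<longlongrightarrow> norm (a i w)) (nhds w)" by (rule tendsto_norm)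
    then show "eventually (\<lambda>z. norm (a i z) < norm (a i w) + 1) (nhds w)"
      by (rule order_tendstoD) simp
  qed
  then have "eventually (\<lambda>z. \<forall>i\<in>{1..d}. z \<in> U i \<and> norm (a i z) < norm (a i w) + 1) (nhds w)"
    by (intro eventually_ball_finite ballI finite_atLeastAtMost)
  with fa have "eventually (\<lambda>z. f z = (\<Sum>i=1..d. a i z * g i z) \<and>
      (\<forall>i\<in>{1..d}. z \<in> U i \<and> norm (a i z) < norm (a i w) + 1)) (nhds w)" by (rule eventually_conj)
  then obtain V where V: "open V" "w \<in> V" and VV: "\<And>z. z \<in> V \<Longrightarrow> f z = (\<Sum>i=1..d. a i z * g i z)"
    "\<And>z i. z \<in> V \<Longrightarrow> i \<in> {1..d} \<Longrightarrow> z \<in> U i \<and> norm (a i z) < norm (a i w) + 1"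
    unfolding eventually_nhds by blast
  obtain R where R: "R > 0" "polydisc w R \<subseteq> V" using polydisc_subset_open[OF V] by blast
  have "lifts w R d g C f a"
    unfolding lifts_def
  proof (intro conjI ballI)
    fix i assume i: "i \<in> {1..d}"
    show "holomorphic_fun_on (a i) (polydisc w R)"
      by (rule holomorphic_fun_on_subset[OF U(3)]) (use R(2) VV(2)[OF _ i] in blast)
    fix z assume "z \<in> polydisc w R"
    then have "norm (a i z) \<le> norm (a i w) + 1" using VV(2)[OF _ i, of z] R(2) by (simp add: subset_iff)
    also have "\<dots> \<le> C" unfolding C_def by (rule Max_ge) (use i in simp_all)
    finally show "norm (a i z) \<le> C" .
  next
    fix z assume "z \<in> polydisc w R"
    then show "f z = (\<Sum>i=1..d. a i z * g i z)" using R(2) by (intro VV(1)) blast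
  qed
  with R(1) show ?thesis by blast
qed

lemma lifts_subset: "lifts c R d g C f x \<Longrightarrow> R' \<le> R \<Longrightarrow> lifts c R' d g C f x"
  unfolding lifts_def using polydisc_mono[of R' R c] holomorphic_fun_on_subset by blast

section \<open>From individual lifts to uniformly bounded lifts\<close>

context hilbert_function_space
begin

text \<open>The sets are not assumed closed, so only density of one of them in a ball results. For
  the strata of liftable functions closedness would call for a normal-family argument; successive
  approximation takes its place.\<close>

lemma Baire_interior:
  fixes E :: "nat \<Rightarrow> 'm cfun set"
  assumes E: "\<And>n. E n \<subseteq> M" and cover: "M \<subseteq> (\<Union>n. E n)"
  shows "\<exists>n f0 \<rho>. \<rho> > 0 \<and> f0 \<in> M \<and>
    (\<forall>f\<in>M. hnorm ip (f - f0) < \<rho> \<longrightarrow> (\<forall>\<epsilon>>0. \<exists>e\<in>E n. hnorm ip (f - e) < \<epsilon>))"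
proof -
  let ?cl = "\<lambda>n. hms.mtopology closure_of (E n)"
  have sub: "E n \<subseteq> ?cl n" for n
    by (rule closure_of_subset) (simp only: hms.topspace_mtopology E)
  have clM: "?cl n \<subseteq> M" for n
    using closure_of_subset_topspace[of hms.mtopology "E n"] by (simp only: hms.topspace_mtopology)
  have "\<exists>n. hms.mtopology interior_of (?cl n) \<noteq> {}"
  proof (rule ccontr)
    assume "\<nexists>n. hms.mtopology interior_of (?cl n) \<noteq> {}"
    then have int: "hms.mtopology interior_of (?cl n) = {}" for n by blast
    have "hms.mtopology interior_of \<Union>(range ?cl) = {}"
    proof (rule hms.metric_Baire_category_alt[OF mcomplete_hnorm])
      show "countable (range ?cl)" by (rule countable_image) (rule countableI_type)
      fix T assume "T \<in> range ?cl"
      then obtain n where "T = ?cl n" by blast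
      then show "closedin hms.mtopology T \<and> hms.mtopology interior_of T = {}"
        by (simp only: int closedin_closure_of simp_thms)
    qed
    moreover have "\<Union>(range ?cl) = M"
    proof
      show "\<Union>(range ?cl) \<subseteq> M" by (rule Union_least) (use clM in \<open>elim imageE, simp only:\<close>)
      show "M \<subseteq> \<Union>(range ?cl)" by (rule order_trans[OF cover]) (rule UN_mono[OF order_refl sub])
    qed
    moreover have "hms.mtopology interior_of M = M"
      using interior_of_topspace[of hms.mtopology] by (simp only: hms.topspace_mtopology)
    ultimately have "M = {}" by (simp only:)
    with zero_mem show False by (simp only: empty_iff)
  qed
  then obtain n f0 where f0: "f0 \<in> hms.mtopology interior_of (?cl n)" by blast
  have "openin hms.mtopology (hms.mtopology interior_of (?cl n))" by (rule openin_interior_of)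
  then obtain \<rho> where \<rho>: "\<rho> > 0" "hms.mball f0 \<rho> \<subseteq> hms.mtopology interior_of (?cl n)"
    using f0 unfolding hms.openin_mtopology by blast
  have f0M: "f0 \<in> M" by (rule subsetD[OF clM subsetD[OF interior_of_subset f0]])
  have "\<exists>e\<in>E n. hnorm ip (f - e) < \<epsilon>"
    if f: "f \<in> M" "hnorm ip (f - f0) < \<rho>" and \<epsilon>: "\<epsilon> > 0" for f \<epsilon>
  proof -
    have "f \<in> hms.mball f0 \<rho>"
      using f f0M by (simp add: hms.in_mball hnorm_minus_commute)
    then have "f \<in> ?cl n" by (rule subsetD[OF interior_of_subset subsetD[OF \<rho>(2)]])
    then obtain e where e: "e \<in> E n" "e \<in> hms.mball f \<epsilon>"
      using \<epsilon> unfolding hms.metric_closure_of by blast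
    have "hnorm ip (f - e) < \<epsilon>" using e(2) by (simp add: hms.in_mball split: if_splits)
    with e(1) show ?thesis by blast
  qed
  with \<rho>(1) f0M show ?thesis by blast
qed

text \<open>Density in a ball about \<open>f0\<close> is moved to the origin by subtracting an
  approximation of \<open>f0\<close> from one of \<open>f0 + f1\<close>, and spread to all of
  \<open>M\<close> by scaling.\<close>

lemma approximate_lifts:
  assumes R0: "R0 > 0"
    and ex: "\<forall>f\<in>M. \<exists>R>0. \<exists>C. \<exists>x. lifts c R d g C f x"
  shows "\<exists>R C. 0 < R \<and> R \<le> R0 \<and> 0 \<le> C \<and> (\<forall>f\<in>M. \<forall>\<epsilon>>0. \<exists>f'\<in>M. hnorm ip (f - f') < \<epsilon> \<and>
    (\<exists>x. lifts c R d g (C * hnorm ip f) f' x))"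
proof -
  define r where "r n = R0 / real (Suc n)" for n
  have r: "0 < r n" "r n \<le> R0" for n using R0 by (simp_all add: r_def field_simps)
  define E where "E n = {f \<in> M. \<exists>x. lifts c (r n) d g (real n) f x}" for n
  have "M \<subseteq> (\<Union>n. E n)"
  proof
    fix f assume f: "f \<in> M"
    obtain R C x where l: "R > 0" "lifts c R d g C f x" using bspec[OF ex f] by blast
    obtain n where n: "max C (R0 / R) \<le> real n" using real_arch_simple[of "max C (R0 / R)"] by (elim exE)
    have "R0 / R \<le> real (Suc n)" using n by simp
    then have "r n \<le> R" using l(1) by (simp add: r_def field_simps)
    then have "lifts c (r n) d g (real n) f x"
      by (intro lifts_mono[OF lifts_subset[OF l(2)]]) (use n in simp_all)
    then show "f \<in> (\<Union>n. E n)" using f unfolding E_def by blast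
  qed
  note cover = this
  have "E n \<subseteq> M" for n unfolding E_def by (rule Collect_restrict)
  from Baire_interior[OF this cover] obtain n f0 \<rho> where \<rho>: "\<rho> > 0" and f0: "f0 \<in> M"
    and dense0: "\<forall>f\<in>M. hnorm ip (f - f0) < \<rho> \<longrightarrow> (\<forall>\<epsilon>>0. \<exists>e\<in>E n. hnorm ip (f - e) < \<epsilon>)"
    by (elim exE conjE)
  have dense: "\<exists>e\<in>E n. hnorm ip (f - e) < \<epsilon>" if "f \<in> M" "hnorm ip (f - f0) < \<rho>" "\<epsilon> > 0" for f \<epsilon>
    using dense0 that by simp
  \<comment> \<open>A difference of two elements of \<open>E n\<close> has a lift bounded by 2 * n,
    and undoing the scaling multiplies this by 2 * |f| / \<rho>.\<close>
  define C where "C = 4 * real n / \<rho>"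
  have "\<exists>f'\<in>M. hnorm ip (f - f') < \<epsilon> \<and> (\<exists>x. lifts c (r n) d g (C * hnorm ip f) f' x)"
    if f: "f \<in> M" and \<epsilon>: "\<epsilon> > 0" for f \<epsilon>
  proof (cases "f = 0")
    case True
    then show ?thesis using \<epsilon> lifts_zero[of 0 c "r n" d g] by (intro bexI[of _ 0]) auto
  next
    case False
    have pos: "hnorm ip f > 0" using hnorm_nonneg[OF f] hnorm_eq_0_iff[OF f] False by linarith
    \<comment> \<open>The scaled vector has norm \<rho>/2, so \<open>f0 + f1\<close> stays in the
      ball. Two approximation errors below s * \<epsilon> / 2 become an error below \<epsilon> after
      division by \<open>s\<close>.\<close>
    define s where "s = \<rho> / (2 * hnorm ip f)"
    have s: "s > 0" using \<rho> pos by (simp add: s_def)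
    define f1 where "f1 = cscale (of_real s) f"
    have f1: "f1 \<in> M" using f by (simp add: f1_def)
    have "hnorm ip f1 = s * hnorm ip f" using f s by (simp add: f1_def hnorm_cscale)
    also have "\<dots> < \<rho>" using \<rho> pos by (simp add: s_def)
    finally have "hnorm ip ((f0 + f1) - f0) < \<rho>" by simp
    from dense[OF add_mem[OF f0 f1] this, of "s * \<epsilon> / 2"] obtain e1
      where e1: "e1 \<in> E n" "hnorm ip ((f0 + f1) - e1) < s * \<epsilon> / 2" using s \<epsilon> by auto
    have "hnorm ip (f0 - f0) < \<rho>" using \<rho> by simp
    from dense[OF f0 this, of "s * \<epsilon> / 2"] obtain e2
      where e2: "e2 \<in> E n" "hnorm ip (f0 - e2) < s * \<epsilon> / 2" using s \<epsilon> by auto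
    obtain x1 x2 where x: "lifts c (r n) d g (real n) e1 x1" "lifts c (r n) d g (real n) e2 x2"
      using e1(1) e2(1) by (auto simp: E_def)
    have eM: "e1 \<in> M" "e2 \<in> M" using e1(1) e2(1) by (simp_all add: E_def)
    define f' where "f' = cscale (of_real (1 / s)) (e1 - e2)"
    have "f - f' = cscale (of_real (1 / s)) (f1 - (e1 - e2))"
      using s by (simp add: f'_def f1_def cscale_def fun_eq_iff field_simps)
    then have "hnorm ip (f - f') = (1 / s) * hnorm ip (f1 - (e1 - e2))"
      using s f1 eM by (simp add: hnorm_cscale norm_divide)
    also have "f1 - (e1 - e2) = ((f0 + f1) - e1) - (f0 - e2)" by simp
    also have "hnorm ip \<dots> \<le> hnorm ip ((f0 + f1) - e1) + hnorm ip (f0 - e2)"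
      using hnorm_diff_triangle[of "(f0 + f1) - e1" 0 "f0 - e2"] f0 f1 eM
      by (simp add: hnorm_minus_commute)
    then have "(1 / s) * hnorm ip (((f0 + f1) - e1) - (f0 - e2))
        \<le> (1 / s) * (hnorm ip ((f0 + f1) - e1) + hnorm ip (f0 - e2))"
      using s by (intro mult_left_mono) simp_all
    also have "\<dots> < (1 / s) * (s * \<epsilon>)"
      using s e1(2) e2(2) by (intro mult_strict_left_mono) simp_all
    also have "\<dots> = \<epsilon>" using s by simp
    finally have "hnorm ip (f - f') < \<epsilon>" .
    moreover have "lifts c (r n) d g (norm (complex_of_real (1 / s)) * (real n + real n)) f'
        (\<lambda>i z. of_real (1 / s) * (x1 - x2) i z)"
      unfolding f'_def by (intro lifts_scale lifts_diff x)
    moreover have "norm (complex_of_real (1 / s)) * (real n + real n) = C * hnorm ip f"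
      using s \<rho> pos by (simp add: norm_divide C_def) (simp add: s_def field_simps)
    moreover have "f' \<in> M" using eM by (simp add: f'_def)
    ultimately show ?thesis by auto
  qed
  note main = this
  have "0 \<le> C" using \<rho> by (simp add: C_def)
  then show ?thesis using r[of n] by (intro exI[of _ "r n"] exI[of _ C] conjI ballI allI impI main)
qed

text \<open>The successive approximation step of the open mapping theorem.\<close>

lemma exact_lifts:
  assumes pt: "\<And>z. z \<in> polydisc c R \<Longrightarrow> \<exists>k\<in>M. \<forall>f\<in>M. f z = ip f k" and C: "0 \<le> C"
    and approx: "\<And>f \<epsilon>. f \<in> M \<Longrightarrow> \<epsilon> > 0 \<Longrightarrow> \<exists>f'\<in>M. hnorm ip (f - f') < \<epsilon> \<and>
      (\<exists>x. lifts c R d g (C * hnorm ip f) f' x)"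
    and f: "f \<in> M"
  shows "\<exists>x. lifts c R d g (2 * C * hnorm ip f) f x"
proof (cases "f = 0")
  case True
  then show ?thesis using lifts_zero[of 0 c R d g] by auto
next
  case False
  define a where "a = hnorm ip f"
  have a: "a > 0" using hnorm_nonneg[OF f] hnorm_eq_0_iff[OF f] False by (simp add: a_def)
  \<comment> \<open>\<open>r n\<close> will be the part of \<open>f\<close> not yet lifted. Halving
    its norm at every step makes the bounds of the lifted increments a geometric series with sum 2 *
    C * a.\<close>
  let ?P = "\<lambda>n r. r \<in> M \<and> hnorm ip r \<le> a / 2 ^ n"
  let ?Q = "\<lambda>n r r'. \<exists>x. lifts c R d g (C * (a / 2 ^ n)) (r - r') x"
  have step: "\<exists>r'. ?P (Suc n) r' \<and> ?Q n r r'" if r: "?P n r" for n r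
  proof -
    obtain f' x where f': "f' \<in> M" "hnorm ip (r - f') < a / 2 ^ Suc n"
        "lifts c R d g (C * hnorm ip r) f' x"
      using approx[of r "a / 2 ^ Suc n"] r a by auto
    have "C * hnorm ip r \<le> C * (a / 2 ^ n)" using r C by (intro mult_left_mono) simp_all
    moreover have "r - (r - f') = f'" by simp
    ultimately have "lifts c R d g (C * (a / 2 ^ n)) (r - (r - f')) x"
      using lifts_mono[OF f'(3)] by (simp only:)
    moreover have "?P (Suc n) (r - f')" using f' r by simp
    ultimately show ?thesis by blast
  qed
  \<comment> \<open>The clause for n = 0 pins the start of the chosen sequence to
    \<open>f\<close>.\<close>
  have "\<exists>r. \<forall>n. (?P n (r n) \<and> (n = 0 \<longrightarrow> r n = f)) \<and> ?Q n (r n) (r (Suc n))"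
  proof (rule dependent_nat_choice)
    have "?P 0 f" using f by (simp add: a_def)
    then show "\<exists>r. ?P 0 r \<and> (0 = (0::nat) \<longrightarrow> r = f)" by blast
    fix r n assume "?P n r \<and> (n = 0 \<longrightarrow> r = f)"
    then obtain r' where "?P (Suc n) r'" "?Q n r r'" using step[of r n] by blast
    then show "\<exists>r'. (?P (Suc n) r' \<and> (Suc n = 0 \<longrightarrow> r' = f)) \<and> ?Q n r r'"
      by (intro exI[of _ r'] conjI impI) (simp_all only: nat.simps)
  qed
  then obtain r where rr: "\<forall>n. (?P n (r n) \<and> (n = 0 \<longrightarrow> r n = f)) \<and> ?Q n (r n) (r (Suc n))" ..
  then have r: "r n \<in> M" "hnorm ip (r n) \<le> a / 2 ^ n" "r 0 = f" for n by blast+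
  from rr have "\<forall>n. \<exists>x. lifts c R d g (C * (a / 2 ^ n)) (r n - r (Suc n)) x" by blast
  from choice[OF this] obtain X where X: "\<And>n. lifts c R d g (C * (a / 2 ^ n)) (r n - r (Suc n)) (X n)"
    by blast
  define S where "S n = (\<Sum>k<n. X k)" for n
  have S_apply: "S n i z = (\<Sum>k<n. X k i z)" for n i z
    unfolding S_def by (induction n) simp_all
  have S: "lifts c R d g (\<Sum>k<n. C * (a / 2 ^ k)) (f - r n) (S n)" for n
  proof (induction n)
    case 0
    have "S 0 = (\<lambda>i z. 0)" by (simp add: S_apply fun_eq_iff)
    moreover have "f - r 0 = 0" by (simp add: r(3))
    ultimately show ?case using lifts_zero[of 0 c R d g] by (simp only: lessThan_0 sum.empty order_refl)
  next
    case (Suc n)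
    have "(f - r n) + (r n - r (Suc n)) = f - r (Suc n)" "S n + X n = S (Suc n)"
      by (simp_all add: S_def)
    with lifts_add[OF Suc X[of n]] show ?case by (simp only: sum.lessThan_Suc)
  qed
  have sum_le: "(\<Sum>k<n. C * (a / 2 ^ k)) \<le> 2 * C * a" for n
  proof -
    have "(\<Sum>k<n. C * (a / 2 ^ k)) = C * a * (\<Sum>k<n. (1/2) ^ k)"
      by (simp add: sum_distrib_left power_divide)
    also have "\<dots> \<le> C * a * 2"
    proof (rule mult_left_mono)
      have "(\<Sum>k<n. (1/2::real) ^ k) = 2 - 2 * (1/2) ^ n" by (induction n) simp_all
      then show "(\<Sum>k<n. (1/2::real) ^ k) \<le> 2" by simp
    qed (use C a in simp)
    finally show ?thesis by simp
  qed
  have "lifts c R d g (2 * C * a) f (\<lambda>i z. suminf (\<lambda>k. X k i z))"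
  proof (rule lifts_limit)
    show "lifts c R d g (2 * C * a) (f - r n) (S n)" for n by (rule lifts_mono[OF S sum_le])
    fix i z assume i: "i \<in> {1..d}" and z: "z \<in> polydisc c R"
    have "summable (\<lambda>k. X k i z)"
    proof (rule summable_comparison_test')
      show "summable (\<lambda>k. C * a * (1/2) ^ k)" by (intro summable_mult summable_geometric) simp
      show "norm (X k i z) \<le> C * a * (1/2) ^ k" for k
        using liftsD(2)[OF X[of k] i z] by (simp add: power_divide)
    qed
    then show "(\<lambda>n. S n i z) \<longlonglongrightarrow> suminf (\<lambda>k. X k i z)" unfolding S_apply by (rule summable_LIMSEQ)
  next
    fix z assume z: "z \<in> polydisc c R"
    obtain k where k: "k \<in> M" "\<forall>f\<in>M. f z = ip f k" using pt[OF z] by blast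
    have "(\<lambda>n. r n z) \<longlonglongrightarrow> 0"
    proof (rule Lim_null_comparison)
      show "eventually (\<lambda>n. norm (r n z) \<le> a * hnorm ip k * (1/2) ^ n) sequentially"
      proof (rule always_eventually, rule allI)
        fix n
        have "norm (r n z) \<le> hnorm ip (r n) * hnorm ip k"
          using Cauchy_Schwarz[OF r(1) k(1), of n] k(2) r(1) by simp
        also have "\<dots> \<le> (a / 2 ^ n) * hnorm ip k" using r(2) k(1) by (intro mult_right_mono) simp_all
        finally show "norm (r n z) \<le> a * hnorm ip k * (1/2) ^ n" by (simp add: power_divide)
      qed
      show "(\<lambda>n. a * hnorm ip k * (1/2) ^ n) \<longlonglongrightarrow> 0"
        by (intro tendsto_mult_right_zero LIMSEQ_realpow_zero) simp_all
    qed
    then have "(\<lambda>n. f z - r n z) \<longlonglongrightarrow> f z - 0" by (intro tendsto_intros)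
    then show "(\<lambda>n. (f - r n) z) \<longlonglongrightarrow> f z" by simp
  qed
  then show ?thesis unfolding a_def by blast
qed

end

section \<open>Linear choice of lifts and construction of the kernel vectors\<close>

context hilbert_function_space
begin

text \<open>Weak antiholomorphy together with a norm bound gives norm differentiability: the scalar
  derivatives are bounded functionals of \<open>f\<close>, so Riesz assembles them into vectors
  \<open>G v\<close>, and the second-order remainder, uniform over |f| \<le> 1, becomes a norm
  estimate by duality.\<close>

lemma antiholomorphic_intoI_weak:
  assumes S: "open S" and FM: "\<And>w. w \<in> S \<Longrightarrow> F w \<in> M"
    and hol: "\<And>f. f \<in> M \<Longrightarrow> holomorphic_fun_on (\<lambda>w. ip f (F w)) S"
    and bound: "\<And>w. w \<in> S \<Longrightarrow> hnorm ip (F w) \<le> B"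
  shows "antiholomorphic_into M ip S F"
  unfolding antiholomorphic_into_def
proof (intro conjI ballI FM)
  fix z assume z: "z \<in> S"
  have B: "B \<ge> 0" using bound[OF z] hnorm_nonneg[OF FM[OF z]] by linarith
  obtain \<delta> where \<delta>: "\<delta> > 0" "ball z \<delta> \<subseteq> S" using S z open_contains_ball by blast
  have "\<forall>f\<in>M. \<exists>D. ((\<lambda>w. ip f (F w)) has_derivative D) (at z) \<and> (\<forall>c v. D (c *s v) = c * D v)"
    using hol z unfolding holomorphic_fun_on_def by simp
  from bchoice[OF this] obtain D where D: "\<And>f. f \<in> M \<Longrightarrow> ((\<lambda>w. ip f (F w)) has_derivative D f) (at z)"
    "\<And>f c v. f \<in> M \<Longrightarrow> D f (c *s v) = c * D f v" by blast
  have D_add_right: "D f (u + v) = D f u + D f v" if "f \<in> M" for f u v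
    using D(1)[OF that] by (rule linear_add[OF has_derivative_linear])
  have D_add: "D (f + g) v = D f v + D g v" if f: "f \<in> M" and g: "g \<in> M" for f g v
  proof -
    have "((\<lambda>w. ip f (F w) + ip g (F w)) has_derivative (\<lambda>v. D f v + D g v)) (at z)"
      by (intro has_derivative_add D f g)
    then have "((\<lambda>w. ip (f + g) (F w)) has_derivative (\<lambda>v. D f v + D g v)) (at z)"
      by (rule has_derivative_transform_within_open[OF _ S z]) (simp add: ip_add f g FM)
    from has_derivative_unique[OF D(1)[OF add_mem[OF f g]] this] show ?thesis by (rule fun_cong)
  qed
  have D_scale: "D (cscale c f) v = c * D f v" if f: "f \<in> M" for c f v
  proof -
    have "((\<lambda>w. c * ip f (F w)) has_derivative (\<lambda>v. c * D f v)) (at z)"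
      by (intro has_derivative_mult_right D f)
    then have "((\<lambda>w. ip (cscale c f) (F w)) has_derivative (\<lambda>v. c * D f v)) (at z)"
      by (rule has_derivative_transform_within_open[OF _ S z]) (simp add: ip_scale f FM)
    from has_derivative_unique[OF D(1)[OF scale_mem[OF f]] this] show ?thesis by (rule fun_cong)
  qed
  have le: "norm (ip f (F w)) \<le> hnorm ip f * B" if f: "f \<in> M" and w: "w \<in> ball z \<delta>" for f w
  proof -
    have "w \<in> S" using w \<delta>(2) by (rule subsetD[rotated])
    then have "hnorm ip f * hnorm ip (F w) \<le> hnorm ip f * B" by (intro mult_left_mono bound hnorm_nonneg f)
    with Cauchy_Schwarz[OF f FM[OF \<open>w \<in> S\<close>]] show ?thesis by (rule order_trans)
  qed
  have D_bound: "norm (D f v) \<le> (16 * B / \<delta> * norm v) * hnorm ip f" if f: "f \<in> M" for f v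
  proof -
    have "norm (D f v) \<le> 16 * (hnorm ip f * B) / \<delta> * norm v"
      by (rule holomorphic_fun_derivative_bound[OF holomorphic_fun_on_subset[OF hol[OF f] \<delta>(2)] le[OF f] D[OF f] \<delta>(1)])
    then show ?thesis by (simp add: mult_ac)
  qed
  have "\<forall>v. \<exists>k. k \<in> M \<and> (\<forall>f\<in>M. D f v = ip f k)"
    using Riesz_representation[OF D_add D_scale D_bound] by blast
  from choice[OF this] obtain G where G: "\<And>v. G v \<in> M" "\<And>f v. f \<in> M \<Longrightarrow> D f v = ip f (G v)" by blast
  show "\<exists>D. (\<forall>v. D v \<in> M) \<and> (\<forall>u v. D (u + v) = D u + D v) \<and>
      (\<forall>c v. D (c *s v) = cscale (cnj c) (D v)) \<and>
      ((\<lambda>v. hnorm ip (F (z + v) - F z - D v) / norm v) \<longlongrightarrow> 0) (at 0)"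
  proof (intro exI[of _ G] conjI allI G)
    show "G (u + v) = G u + G v" for u v
      by (rule ip_ext) (simp_all only: G add_mem ip_add_right flip: G(2), simp only: D_add_right)
    show "G (c *s v) = cscale (cnj c) (G v)" for c v
      by (rule ip_ext) (simp_all only: G scale_mem ip_scale_right complex_cnj_cnj flip: G(2), simp only: D(2))
    have rem: "hnorm ip (F (z + v) - F z - G v) \<le> 32 * B / \<delta>\<^sup>2 * (norm v)\<^sup>2" if v: "norm v < \<delta> / 2" for v
    proof -
      have zv: "z + v \<in> S" using v \<delta> by (intro subsetD[OF \<delta>(2)]) (simp add: dist_norm)
      show ?thesis
      proof (rule hnorm_le_of_ip_bound)
        show "F (z + v) - F z - G v \<in> M" by (intro diff_mem FM zv z G)
        fix f assume f: "f \<in> M"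
        have "norm (ip f (F (z + v)) - ip f (F z) - D f v) \<le> 32 * (hnorm ip f * B) / \<delta>\<^sup>2 * (norm v)\<^sup>2"
          by (rule holomorphic_fun_remainder[OF holomorphic_fun_on_subset[OF hol[OF f] \<delta>(2)] le[OF f] D[OF f] v])
        also have "ip f (F (z + v)) - ip f (F z) - D f v = ip f (F (z + v) - F z - G v)"
          by (simp add: ip_diff_right f FM z zv G)
        finally show "norm (ip f (F (z + v) - F z - G v)) \<le> 32 * B / \<delta>\<^sup>2 * (norm v)\<^sup>2 * hnorm ip f"
          by (simp add: mult_ac)
      qed (use B in simp)
    qed
    have "norm (hnorm ip (F (z + v) - F z - G v) / norm v) \<le> 32 * B / \<delta>\<^sup>2 * norm v"
      if v: "v \<noteq> 0" "norm v < \<delta> / 2" for v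
    proof -
      have "z + v \<in> S" using v \<delta> by (intro subsetD[OF \<delta>(2)]) (simp add: dist_norm)
      then have "0 \<le> hnorm ip (F (z + v) - F z - G v)" by (intro hnorm_nonneg diff_mem FM z G)
      then show ?thesis using rem[OF v(2)] v(1) by (simp add: power2_eq_square field_simps)
    qed
    then have "eventually (\<lambda>v. norm (hnorm ip (F (z + v) - F z - G v) / norm v) \<le> 32 * B / \<delta>\<^sup>2 * norm v) (at 0)"
      unfolding eventually_at using \<delta>(1) by (intro exI[of _ "\<delta> / 2"]) simp
    moreover have "((\<lambda>v::complex^'m. 32 * B / \<delta>\<^sup>2 * norm v) \<longlongrightarrow> 0) (at 0)"
      by (rule tendsto_eq_intros refl tendsto_ident_at | simp)+
    ultimately show "((\<lambda>v. hnorm ip (F (z + v) - F z - G v) / norm v) \<longlongrightarrow> 0) (at 0)"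
      by (rule Lim_null_comparison)
  qed
qed

text \<open>The limit of almost minimal lifts does not depend on the minimizing sequence, and sums
  and multiples of such sequences are again minimizing; hence the limit is linear in
  \<open>f\<close> although the choice of sequences is not.\<close>

lemma linear_lifts:
  assumes R: "R > 0" and B: "B \<ge> 0"
    and ex: "\<forall>f\<in>M. \<exists>x. lifts c R d g (B * hnorm ip f) f x"
  shows "\<exists>h B'. 0 \<le> B' \<and> (\<forall>f\<in>M. lifts c (R / 4) d g (B' * hnorm ip f) f (h f)) \<and>
    (\<forall>f\<in>M. \<forall>f'\<in>M. \<forall>i\<in>{1..d}. \<forall>z\<in>polydisc c (R / 4). h (f + f') i z = h f i z + h f' i z) \<and>
    (\<forall>a. \<forall>f\<in>M. \<forall>i\<in>{1..d}. \<forall>z\<in>polydisc c (R / 4). h (cscale a f) i z = a * h f i z)"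
proof -
  define r where "r = R / 2"
  have r: "0 < r" "r < R" "R / 4 = r / 2" using R by (simp_all add: r_def)
  define U where "U = polydisc c (R / 4)"
  have UR: "U \<subseteq> polydisc c R" unfolding U_def using R by (intro polydisc_mono) simp
  \<comment> \<open>The bound is existential so that \<open>L\<close> is closed under sums,
    differences and scalar multiples; it provides integrability on the torus.\<close>
  define L where "L f x \<longleftrightarrow> (\<exists>C. lifts c R d g C f x)" for f x
  define Q where "Q x = (\<Sum>i=1..d. torus_norm_sq c r (x i))" for x :: "nat \<Rightarrow> 'm cfun"
  define scal where "scal a x = (\<lambda>i z. a * x i z)" for a :: complex and x :: "nat \<Rightarrow> 'm cfun"
  interpret quadratic_lifting M L Q scal
  proof
    show "cfun.subspace M" by (rule subspace)
    show "\<exists>x. L f x" if "f \<in> M" for f using bspec[OF ex that] unfolding L_def by blast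
    show "L (f + f') (x + y)" if "L f x" "L f' y" for f f' x y
      using that unfolding L_def by (elim exE) (rule exI, rule lifts_add)
    show "L (f - f') (x - y)" if "L f x" "L f' y" for f f' x y
      using that unfolding L_def by (elim exE) (rule exI, rule lifts_diff)
    show "L (cscale a f) (scal a x)" if "L f x" for a f x
      using that lifts_scale unfolding L_def scal_def by blast
    show "Q x \<ge> 0" for x unfolding Q_def by (intro sum_nonneg torus_norm_sq_nonneg)
    show "Q (scal a x) = (norm a)\<^sup>2 * Q x" for a x
      unfolding Q_def scal_def torus_norm_sq_scale by (rule sum_distrib_left[symmetric])
    show "Q (x + y) + Q (x - y) = 2 * Q x + 2 * Q y" if L: "L f x" "L f' y" for f f' x y
    proof -
      obtain C C' where l: "lifts c R d g C f x" "lifts c R d g C' f' y" using L unfolding L_def by blast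
      have eq: "(x + y) i = (\<lambda>z. x i z + y i z)" "(x - y) i = (\<lambda>z. x i z - y i z)" for i
        by (simp_all add: fun_eq_iff)
      have "torus_norm_sq c r ((x + y) i) + torus_norm_sq c r ((x - y) i)
          = 2 * torus_norm_sq c r (x i) + 2 * torus_norm_sq c r (y i)" if "i \<in> {1..d}" for i
        unfolding eq
        by (rule torus_norm_sq_parallelogram[OF liftsD(1)[OF l(1) that] liftsD(2)[OF l(1) that]
              liftsD(1)[OF l(2) that] liftsD(2)[OF l(2) that] r(1,2)])
      then show ?thesis
        unfolding Q_def sum.distrib[symmetric] sum_distrib_left by (rule sum.cong[OF refl])
    qed
  qed
  define \<kappa> :: real where "\<kappa> = 2 ^ CARD('m)"
  have \<kappa>: "\<kappa> > 0" by (simp add: \<kappa>_def)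
  have point: "(norm (x i w))\<^sup>2 \<le> \<kappa> * Q x" if x: "L f x" and i: "i \<in> {1..d}" and w: "w \<in> U" for f x i w
  proof -
    obtain C where l: "lifts c R d g C f x" using x unfolding L_def by blast
    have "(norm (x i w))\<^sup>2 \<le> \<kappa> * torus_norm_sq c r (x i)"
      unfolding \<kappa>_def
      by (rule torus_norm_sq_point_bound[OF liftsD(1)[OF l i] liftsD(2)[OF l i] r(1,2)])
        (use w in \<open>simp_all only: U_def r(3)\<close>)
    also have "\<dots> \<le> \<kappa> * Q x"
      unfolding Q_def using \<kappa> i by (intro mult_left_mono member_le_sum torus_norm_sq_nonneg) simp_all
    finally show ?thesis .
  qed
  define s where "s f n = (SOME x. near_min f x (1 / real (Suc n)))" for f n
  have s: "near_min f (s f n) (1 / real (Suc n))" if "f \<in> M" for f n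
    unfolding s_def by (rule someI_ex[OF near_min_ex[OF that]]) simp
  have diff: "(norm (x i w - y i w))\<^sup>2 \<le> \<kappa> * (2 * e + 2 * e')"
    if f: "f \<in> M" and x: "near_min f x e" and y: "near_min f y e'" and i: "i \<in> {1..d}" and w: "w \<in> U" for f x y e e' i w
  proof -
    have "L (f - f) (x - y)" using x y unfolding near_min_def by (intro L_diff) simp_all
    from point[OF this i w] have "(norm (x i w - y i w))\<^sup>2 \<le> \<kappa> * Q (x - y)" by simp
    also have "\<dots> \<le> \<kappa> * (2 * e + 2 * e')"
      using \<kappa> by (intro mult_left_mono near_min_diff[OF f x y]) simp
    finally show ?thesis .
  qed
  have conv: "convergent (\<lambda>n. s f n i w)" if f: "f \<in> M" and i: "i \<in> {1..d}" and w: "w \<in> U" for f i w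
  proof -
    have "Cauchy (\<lambda>n. s f n i w)"
    proof (rule metric_CauchyI)
      fix e :: real assume e: "e > 0"
      obtain N where N: "4 * \<kappa> / e\<^sup>2 < real N" using reals_Archimedean2 by blast
      have "dist (s f m i w) (s f n i w) < e" if mn: "m \<ge> N" "n \<ge> N" for m n
      proof -
        have b: "1 / real (Suc k) \<le> 1 / real (Suc N)" if "k \<ge> N" for k
          using that by (intro divide_left_mono) simp_all
        have "(norm (s f m i w - s f n i w))\<^sup>2 \<le> \<kappa> * (2 * (1 / real (Suc m)) + 2 * (1 / real (Suc n)))"
          by (rule diff[OF f s[OF f] s[OF f] i w])
        also have "\<dots> \<le> \<kappa> * (4 * (1 / real (Suc N)))"
          using \<kappa> b[OF mn(1)] b[OF mn(2)] by (intro mult_left_mono) linarith+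
        also have "\<dots> < e\<^sup>2"
        proof -
          have e2: "e\<^sup>2 > 0" using e by simp
          then have "4 * \<kappa> < real N * e\<^sup>2" using N by (simp only: pos_divide_less_eq)
          also have "\<dots> \<le> real (Suc N) * e\<^sup>2" using e2 by (intro mult_right_mono) simp_all
          finally have "4 * \<kappa> / real (Suc N) < e\<^sup>2"
            by (simp only: pos_divide_less_eq mult.commute of_nat_0_less_iff zero_less_Suc)
          then show ?thesis by (simp add: mult_ac)
        qed
        finally have "(norm (s f m i w - s f n i w))\<^sup>2 < e\<^sup>2" .
        then show ?thesis unfolding dist_norm by (rule power_less_imp_less_base) (use e in simp)
      qed
      then show "\<exists>N. \<forall>m\<ge>N. \<forall>n\<ge>N. dist (s f m i w) (s f n i w) < e" by blast
    qed
    then show ?thesis by (rule Cauchy_convergent)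
  qed
  define h where "h f i w = lim (\<lambda>n. s f n i w)" for f i w
  have lim_s: "(\<lambda>n. s f n i w) \<longlonglongrightarrow> h f i w" if "f \<in> M" "i \<in> {1..d}" "w \<in> U" for f i w
    unfolding h_def using conv[OF that] by (simp only: convergent_LIMSEQ_iff)
  \<comment> \<open>The free constant \<open>a\<close> absorbs what is lost in the operations:
    errors 1/(n+1) become 4/(n+1) for a sum and are multiplied by the squared modulus of the scalar
    for a multiple.\<close>
  have lim_unique: "h f i w = l"
    if f: "f \<in> M" and i: "i \<in> {1..d}" and w: "w \<in> U"
      and X: "\<And>n. near_min f (X n) (a / real (Suc n))" and l: "(\<lambda>n. X n i w) \<longlonglongrightarrow> l" for f i w X a l
  proof -
    have "(\<lambda>n. s f n i w - X n i w) \<longlonglongrightarrow> 0"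
    proof (rule Lim_null_comparison)
      show "eventually (\<lambda>n. norm (s f n i w - X n i w) \<le> sqrt (\<kappa> * (2 + 2 * a) * (1 / real (Suc n)))) sequentially"
      proof (rule always_eventually, rule allI)
        fix n
        have "(norm (s f n i w - X n i w))\<^sup>2 \<le> \<kappa> * (2 * (1 / real (Suc n)) + 2 * (a / real (Suc n)))"
          by (rule diff[OF f s[OF f] X i w])
        also have "\<dots> = \<kappa> * (2 + 2 * a) * (1 / real (Suc n))"
          by (simp add: add_divide_distrib distrib_left distrib_right del: of_nat_Suc)
        finally show "norm (s f n i w - X n i w) \<le> sqrt (\<kappa> * (2 + 2 * a) * (1 / real (Suc n)))"
          by (rule real_le_rsqrt)
      qed
      have "(\<lambda>n. sqrt (\<kappa> * (2 + 2 * a) * (1 / real (Suc n)))) \<longlonglongrightarrow> sqrt (\<kappa> * (2 + 2 * a) * 0)"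
        by (intro tendsto_intros LIMSEQ_Suc[OF lim_1_over_n])
      then show "(\<lambda>n. sqrt (\<kappa> * (2 + 2 * a) * (1 / real (Suc n)))) \<longlonglongrightarrow> 0" by simp
    qed
    from tendsto_add[OF this l] have "(\<lambda>n. s f n i w) \<longlonglongrightarrow> l" by simp
    with lim_s[OF f i w] show ?thesis by (rule LIMSEQ_unique)
  qed
  have h_add: "h (f + f') i w = h f i w + h f' i w"
    if f: "f \<in> M" and f': "f' \<in> M" and i: "i \<in> {1..d}" and w: "w \<in> U" for f f' i w
  proof (rule lim_unique[OF add_mem[OF f f'] i w])
    show "near_min (f + f') (s f n + s f' n) (4 / real (Suc n))" for n
      using near_min_add[OF f f' s[OF f, of n] s[OF f', of n]] by simp
    show "(\<lambda>n. (s f n + s f' n) i w) \<longlonglongrightarrow> h f i w + h f' i w"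
      unfolding plus_fun_apply by (intro tendsto_add lim_s f f' i w)
  qed
  have h_scale: "h (cscale a f) i w = a * h f i w"
    if f: "f \<in> M" and i: "i \<in> {1..d}" and w: "w \<in> U" for a f i w
  proof (rule lim_unique[OF scale_mem[OF f] i w])
    show "near_min (cscale a f) (scal a (s f n)) ((norm a)\<^sup>2 / real (Suc n))" for n
      using near_min_scale[OF f s[OF f, of n], of a] by simp
    show "(\<lambda>n. scal a (s f n) i w) \<longlonglongrightarrow> a * h f i w"
      unfolding scal_def by (intro tendsto_mult_left lim_s f i w)
  qed
  \<comment> \<open>The factor \<kappa> is the cost of a point evaluation, \<open>d\<close> counts
    the coordinates summed in \<open>Q\<close>; both enter under the root because \<open>Q\<close>
    is quadratic.\<close>
  define B' where "B' = sqrt (\<kappa> * real d) * B"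
  have lifts_h: "lifts c (R / 4) d g (B' * hnorm ip f) f (h f)" if f: "f \<in> M" for f
  proof -
    have q0: "0 \<le> q f" by (rule le_q[OF f]) (rule Q_nonneg)
    have s_bound: "(norm (s f n i w))\<^sup>2 \<le> \<kappa> * (q f + 1 / real (Suc n))" if i: "i \<in> {1..d}" and w: "w \<in> U" for n i w
    proof -
      have "L f (s f n)" "Q (s f n) \<le> q f + 1 / real (Suc n)" using s[OF f, of n] by (simp_all only: near_min_def)
      then have "\<kappa> * Q (s f n) \<le> \<kappa> * (q f + 1 / real (Suc n))" using \<kappa> by (intro mult_left_mono) simp_all
      with point[OF \<open>L f (s f n)\<close> i w] show ?thesis by (rule order_trans)
    qed
    \<comment> \<open>The error 1/(n+1) is replaced by 1 to get a bound independent of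
      \<open>n\<close> for passing to the limit. The bound linear in the norm of \<open>f\<close> is
      obtained afterwards, from the limit of \<open>s_bound\<close>.\<close>
    have "lifts c (R / 4) d g (sqrt (\<kappa> * (q f + 1))) f (s f n)" for n
      unfolding lifts_def U_def[symmetric]
    proof (intro conjI ballI)
      obtain C where l: "lifts c R d g C f (s f n)" using s[OF f, of n] unfolding near_min_def L_def by blast
      fix i assume i: "i \<in> {1..d}"
      show "holomorphic_fun_on (s f n i) U" by (rule holomorphic_fun_on_subset[OF liftsD(1)[OF l i] UR])
      fix w assume w: "w \<in> U"
      have "\<kappa> * (q f + 1 / real (Suc n)) \<le> \<kappa> * (q f + 1)" using \<kappa> by (intro mult_left_mono add_left_mono) simp_all
      with s_bound[OF i w, of n] have "(norm (s f n i w))\<^sup>2 \<le> \<kappa> * (q f + 1)" by (rule order_trans)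
      then show "norm (s f n i w) \<le> sqrt (\<kappa> * (q f + 1))" by (rule real_le_rsqrt)
    next
      obtain C where l: "lifts c R d g C f (s f n)" using s[OF f, of n] unfolding near_min_def L_def by blast
      fix w assume "w \<in> U"
      then show "f w = (\<Sum>i=1..d. s f n i w * g i w)" by (intro liftsD(3)[OF l] subsetD[OF UR])
    qed
    then have l: "lifts c (R / 4) d g (sqrt (\<kappa> * (q f + 1))) f (h f)"
    proof (rule lifts_limit)
      show "(\<lambda>n. s f n i w) \<longlonglongrightarrow> h f i w" if "i \<in> {1..d}" "w \<in> polydisc c (R / 4)" for i w
        using that by (intro lim_s f) (simp_all only: U_def)
    qed (rule tendsto_const)
    have "q f \<le> real d * (B * hnorm ip f)\<^sup>2"
    proof -
      obtain x where x: "lifts c R d g (B * hnorm ip f) f x" using bspec[OF ex f] by blast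
      then have "q f \<le> Q x" by (intro q_le) (auto simp: L_def)
      also have "\<dots> \<le> (\<Sum>i=1..d. (B * hnorm ip f)\<^sup>2)"
        unfolding Q_def
        by (rule sum_mono) (rule torus_norm_sq_le[OF liftsD(1)[OF x] liftsD(2)[OF x] r(1,2)])
      finally show ?thesis by simp
    qed
    then have "\<kappa> * q f \<le> \<kappa> * (real d * (B * hnorm ip f)\<^sup>2)" using \<kappa> by (intro mult_left_mono) simp_all
    also have "\<dots> = (B' * hnorm ip f)\<^sup>2" using \<kappa> by (simp add: B'_def power_mult_distrib mult_ac)
    finally have qB: "\<kappa> * q f \<le> (B' * hnorm ip f)\<^sup>2" .
    have "norm (h f i w) \<le> B' * hnorm ip f" if i: "i \<in> {1..d}" and w: "w \<in> U" for i w
    proof -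
      have "(norm (h f i w))\<^sup>2 \<le> \<kappa> * (q f + 0)"
      proof (rule LIMSEQ_le)
        show "(\<lambda>n. (norm (s f n i w))\<^sup>2) \<longlonglongrightarrow> (norm (h f i w))\<^sup>2"
          by (intro tendsto_power tendsto_norm lim_s f i w)
        show "(\<lambda>n. \<kappa> * (q f + 1 / real (Suc n))) \<longlonglongrightarrow> \<kappa> * (q f + 0)"
          by (intro tendsto_intros LIMSEQ_Suc[OF lim_1_over_n])
      qed (use s_bound[OF i w] in blast)
      with qB have "(norm (h f i w))\<^sup>2 \<le> (B' * hnorm ip f)\<^sup>2" by simp
      then show ?thesis by (rule power2_le_imp_le) (use B \<kappa> f in \<open>simp add: B'_def\<close>)
    qed
    then show ?thesis using l unfolding lifts_def U_def by blast
  qed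
  have "0 \<le> B'" using B \<kappa> by (simp add: B'_def)
  then show ?thesis
    by (intro exI[of _ h] exI[of _ B'] conjI ballI allI lifts_h h_add h_scale) (simp_all only: U_def)
qed

text \<open>Linearity and the bound make each coefficient value a bounded functional, represented by
  a vector of norm at most \<open>B\<close>. Pairing both sides of the claimed decomposition with
  \<open>f\<close> then reduces it to the lifting identity.\<close>

lemma kernel_decomposition_of_linear_lifts:
  assumes K: "reproducing_kernel \<Omega> M ip K" and R: "R > 0" and sub: "polydisc w0 R \<subseteq> \<Omega>" and B: "0 \<le> B"
    and g: "\<And>i. i \<in> {1..d} \<Longrightarrow> holomorphic_fun_on (g i) (polydisc w0 R)"
    and l: "\<And>f. f \<in> M \<Longrightarrow> lifts w0 R d g (B * hnorm ip f) f (h f)"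
    and h_add: "\<And>f f' i z. f \<in> M \<Longrightarrow> f' \<in> M \<Longrightarrow> i \<in> {1..d} \<Longrightarrow> z \<in> polydisc w0 R \<Longrightarrow>
      h (f + f') i z = h f i z + h f' i z"
    and h_scale: "\<And>a f i z. f \<in> M \<Longrightarrow> i \<in> {1..d} \<Longrightarrow> z \<in> polydisc w0 R \<Longrightarrow>
      h (cscale a f) i z = a * h f i z"
  shows "\<exists>KK. kernel_decomposition \<Omega> M ip K w0 d g (polydisc w0 R) KK"
proof -
  let ?U = "polydisc w0 R"
  have "\<exists>k. k \<in> M \<and> (\<forall>f\<in>M. h f i w = ip f k)" if i: "i \<in> {1..d}" and w: "w \<in> ?U" for i w
    using Riesz_representation[of "\<lambda>f. h f i w" B, OF h_add[OF _ _ i w] h_scale[OF _ i w] liftsD(2)[OF l i w]]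
    by blast
  then have "\<forall>p\<in>{1..d} \<times> ?U. \<exists>k. k \<in> M \<and> (\<forall>f\<in>M. h f (fst p) (snd p) = ip f k)" by auto
  from bchoice[OF this] obtain k where
    k: "\<forall>p\<in>{1..d} \<times> ?U. k p \<in> M \<and> (\<forall>f\<in>M. h f (fst p) (snd p) = ip f (k p))" ..
  define KK where "KK i w = k (i, w)" for i w
  have KK: "KK i w \<in> M" "\<And>f. f \<in> M \<Longrightarrow> h f i w = ip f (KK i w)" if "i \<in> {1..d}" "w \<in> ?U" for i w
    using bspec[OF k, of "(i, w)"] that unfolding KK_def by simp_all
  have "antiholomorphic_into M ip ?U (KK i)" if i: "i \<in> {1..d}" for i
  proof (rule antiholomorphic_intoI_weak[OF open_polydisc KK(1)[OF i]])
    fix f assume f: "f \<in> M"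
    show "holomorphic_fun_on (\<lambda>w. ip f (KK i w)) ?U"
      unfolding holomorphic_fun_on_def
    proof
      fix z assume z: "z \<in> ?U"
      obtain D where D: "(h f i has_derivative D) (at z)" "\<forall>c v. D (c *s v) = c * D v"
        using liftsD(1)[OF l[OF f] i] z unfolding holomorphic_fun_on_def by blast
      from D(1) have "((\<lambda>w. ip f (KK i w)) has_derivative D) (at z)"
        by (rule has_derivative_transform_within_open[OF _ open_polydisc z]) (rule KK(2)[OF i _ f])
      with D(2) show "\<exists>D. ((\<lambda>w. ip f (KK i w)) has_derivative D) (at z) \<and> (\<forall>c v. D (c *s v) = c * D v)"
        by blast
    qed
  next
    fix w assume w: "w \<in> ?U"
    show "hnorm ip (KK i w) \<le> B"
      by (rule hnorm_le_of_ip_bound[OF KK(1)[OF i w] B])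
        (use liftsD(2)[OF l i w] KK(2)[OF i w] in simp)
  qed
  moreover have "(\<lambda>z. K z w) = (\<Sum>i=1..d. cscale (cnj (g i w)) (KK i w))" if w: "w \<in> ?U" for w
  proof (rule ip_ext)
    have w\<Omega>: "w \<in> \<Omega>" using sub w by (rule subsetD)
    show "(\<lambda>z. K z w) \<in> M" using K w\<Omega> unfolding reproducing_kernel_def by blast
    show "(\<Sum>i=1..d. cscale (cnj (g i w)) (KK i w)) \<in> M" by (intro sum_mem scale_mem KK w)
    fix f assume f: "f \<in> M"
    have "ip f (\<lambda>z. K z w) = f w" using K w\<Omega> f unfolding reproducing_kernel_def by simp
    also have "\<dots> = (\<Sum>i=1..d. h f i w * g i w)" by (rule liftsD(3)[OF l[OF f] w])
    also have "\<dots> = (\<Sum>i=1..d. ip f (cscale (cnj (g i w)) (KK i w)))"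
      by (rule sum.cong[OF refl]) (simp only: ip_scale_right KK[OF _ w] f complex_cnj_cnj mult.commute)
    also have "\<dots> = ip f (\<Sum>i=1..d. cscale (cnj (g i w)) (KK i w))"
      by (rule ip_sum_right[symmetric]) (intro f scale_mem KK w)+
    finally show "ip f (\<lambda>z. K z w) = ip f (\<Sum>i=1..d. cscale (cnj (g i w)) (KK i w))" .
  qed
  ultimately show ?thesis
    unfolding kernel_decomposition_def
    by (intro exI[of _ KK] conjI ballI open_polydisc center_in_polydisc R sub g)
qed

lemma kernel_decomposition_exists:
  assumes \<Omega>: "open \<Omega>" "w0 \<in> \<Omega>" and hol: "\<And>f. f \<in> M \<Longrightarrow> holomorphic_fun_on f \<Omega>"
    and K: "reproducing_kernel \<Omega> M ip K" and min: "minimal_generators w0 (stalk M w0) d g"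
  shows "\<exists>\<Omega>0 KK. kernel_decomposition \<Omega> M ip K w0 d g \<Omega>0 KK"
proof -
  interpret R: cring "germ_ring w0" by (rule cring_germ_ring)
  have g: "holomorphic_near w0 (g i)" if "i \<in> {1..d}" for i
    using min that by (simp add: minimal_generators_def)
  have "\<forall>i\<in>{1..d}. \<exists>V. open V \<and> w0 \<in> V \<and> holomorphic_fun_on (g i) V"
    using g unfolding holomorphic_near_def by simp
  from bchoice[OF this] obtain V where V: "\<forall>i\<in>{1..d}. open (V i) \<and> w0 \<in> V i \<and> holomorphic_fun_on (g i) (V i)" ..
  \<comment> \<open>The final polydisc has to lie in \<open>\<Omega>\<close> and in the domain of
    holomorphy of every \<open>g i\<close>; the radius found by the Baire argument is therefore kept
    below \<open>R0\<close>.\<close>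
  have "open (\<Omega> \<inter> (\<Inter>i\<in>{1..d}. V i))" using V \<Omega> by (intro open_Int open_INT) simp_all
  moreover have "w0 \<in> \<Omega> \<inter> (\<Inter>i\<in>{1..d}. V i)" using V \<Omega> by simp
  ultimately obtain R0 where R0: "R0 > 0" "polydisc w0 R0 \<subseteq> \<Omega> \<inter> (\<Inter>i\<in>{1..d}. V i)"
    by (rule polydisc_subset_open)
  have germs: "germ w0 f \<in> Idl\<^bsub>germ_ring w0\<^esub> ((\<lambda>i. germ w0 (g i)) ` {1..d})" if f: "f \<in> M" for f
  proof -
    have "germ w0 ` M \<subseteq> carrier (germ_ring w0)"
    proof
      fix y assume "y \<in> germ w0 ` M"
      then obtain f where "y = germ w0 f" "f \<in> M" by (rule imageE)
      then show "y \<in> carrier (germ_ring w0)"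
        using germ_in_carrier[OF holomorphic_fun_on_imp_near[OF hol \<Omega>]] by simp
    qed
    from R.genideal_self[OF this] have "germ w0 f \<in> stalk M w0"
      unfolding stalk_def using f by blast
    then show ?thesis using min by (simp add: minimal_generators_def)
  qed
  have "\<forall>f\<in>M. \<exists>R>0. \<exists>C. \<exists>x. lifts w0 R d g C f x"
    by (intro ballI lifts_from_germ g germs)
  from approximate_lifts[OF R0(1) this] obtain R C where R: "0 < R" "R \<le> R0" "0 \<le> C"
    and approx: "\<forall>f\<in>M. \<forall>\<epsilon>>0. \<exists>f'\<in>M. hnorm ip (f - f') < \<epsilon> \<and> (\<exists>x. lifts w0 R d g (C * hnorm ip f) f' x)"
    by (elim exE conjE)
  have R\<Omega>: "polydisc w0 R \<subseteq> \<Omega>" using R0(2) polydisc_mono[OF R(2), of w0] by blast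
  have pt: "\<exists>k\<in>M. \<forall>f\<in>M. f z = ip f k" if "z \<in> polydisc w0 R" for z
    using K subsetD[OF R\<Omega> that] unfolding reproducing_kernel_def by blast
  have "\<forall>f\<in>M. \<exists>x. lifts w0 R d g (2 * C * hnorm ip f) f x"
    by (rule ballI, rule exact_lifts[OF pt R(3)]) (use approx in blast)+
  moreover have "0 \<le> 2 * C" using R(3) by simp
  ultimately obtain h B where B: "0 \<le> B"
    and l: "\<forall>f\<in>M. lifts w0 (R / 4) d g (B * hnorm ip f) f (h f)"
    and lin: "\<forall>f\<in>M. \<forall>f'\<in>M. \<forall>i\<in>{1..d}. \<forall>z\<in>polydisc w0 (R / 4). h (f + f') i z = h f i z + h f' i z"
      "\<forall>a. \<forall>f\<in>M. \<forall>i\<in>{1..d}. \<forall>z\<in>polydisc w0 (R / 4). h (cscale a f) i z = a * h f i z"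
    using linear_lifts[OF R(1)] by blast
  have R4: "polydisc w0 (R / 4) \<subseteq> polydisc w0 R0" using R by (intro polydisc_mono) simp
  have "\<exists>KK. kernel_decomposition \<Omega> M ip K w0 d g (polydisc w0 (R / 4)) KK"
  proof (rule kernel_decomposition_of_linear_lifts[OF K _ _ B])
    show "R / 4 > 0" using R(1) by simp
    show "polydisc w0 (R / 4) \<subseteq> \<Omega>" using R4 R0(2) by blast
    show "holomorphic_fun_on (g i) (polydisc w0 (R / 4))" if i: "i \<in> {1..d}" for i
    proof (rule holomorphic_fun_on_subset)
      show "holomorphic_fun_on (g i) (V i)" using V i by blast
      show "polydisc w0 (R / 4) \<subseteq> V i" using R4 R0(2) i by blast
    qed
  qed (use l lin in blast)+
  then show ?thesis by (rule exI)
qed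

end

theorem theorem1p5:
  fixes \<Omega> :: "(complex ^ 'm::finite) set"
    and M :: "'m cfun set"
    and ip :: "'m cfun \<Rightarrow> 'm cfun \<Rightarrow> complex"
    and K :: "complex ^ 'm \<Rightarrow> complex ^ 'm \<Rightarrow> complex"
    and w0 :: "complex ^ 'm"
    and d :: nat
    and g :: "nat \<Rightarrow> 'm cfun"
  assumes "open \<Omega>" and "connected \<Omega>" and "bounded \<Omega>"
    and "class_B1 \<Omega> M ip"
    and "reproducing_kernel \<Omega> M ip K"
    and "w0 \<in> \<Omega>"
    and "minimal_generators w0 (stalk M w0) d g"
  shows
    "(\<exists>\<Omega>0 KK. kernel_decomposition \<Omega> M ip K w0 d g \<Omega>0 KK) \<and>
     (\<forall>\<Omega>0 KK. kernel_decomposition \<Omega> M ip K w0 d g \<Omega>0 KK \<longrightarrow>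
        (\<exists>N. open N \<and> w0 \<in> N \<and> N \<subseteq> \<Omega>0 \<and>
           (\<forall>w\<in>N. linearly_independent_family {1..d} (\<lambda>i. KK i w)))) \<and>
     (\<forall>\<Omega>0 KK \<Omega>0' KK'. kernel_decomposition \<Omega> M ip K w0 d g \<Omega>0 KK \<longrightarrow>
        kernel_decomposition \<Omega> M ip K w0 d g \<Omega>0' KK' \<longrightarrow>
        (\<forall>i\<in>{1..d}. KK i w0 = KK' i w0)) \<and>
     (\<forall>d' g' \<Omega>0 KK \<Omega>0' KK'. minimal_generators w0 (stalk M w0) d' g' \<longrightarrow>
        kernel_decomposition \<Omega> M ip K w0 d g \<Omega>0 KK \<longrightarrow>
        kernel_decomposition \<Omega> M ip K w0 d' g' \<Omega>0' KK' \<longrightarrow>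
        cfun.span ((\<lambda>i. KK i w0) ` {1..d}) = cfun.span ((\<lambda>i. KK' i w0) ` {1..d'})) \<and>
     (\<forall>\<Omega>0 KK. kernel_decomposition \<Omega> M ip K w0 d g \<Omega>0 KK \<longrightarrow>
        (\<forall>i\<in>{1..d}. \<forall>p :: 'm cpoly.
           adjoint_op M ip (module_mult p) (KK i w0) = cscale (cnj (poly_eval p w0)) (KK i w0)))"
proof -
  interpret hilbert_function_space M ip using assms(4) by (simp only: class_B1_def)
  have hol: "holomorphic_fun_on f \<Omega>" if "f \<in> M" for f using assms(4) that unfolding class_B1_def by blast
  have hol_near: "holomorphic_near w0 f" if "f \<in> M" for f
    by (rule holomorphic_fun_on_imp_near[OF hol[OF that] assms(1,6)])
  have mult: "module_mult p f \<in> M" if "f \<in> M" for p f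
    using assms(4) that unfolding class_B1_def bounded_operator_def by blast
  have space: "kernel_decomposition_space M ip \<Omega> K w0 d' g' \<Omega>0 KK"
    if "minimal_generators w0 (stalk M w0) d' g'" "kernel_decomposition \<Omega> M ip K w0 d' g' \<Omega>0 KK"
    for d' g' \<Omega>0 KK
    by (intro kernel_decomposition_space.intro kernel_decomposition_space_axioms.intro
        hilbert_function_space_axioms that assms(5))
  note sp = space[OF assms(7)]
  have unique: "KK i w0 = KK' i w0"
    if "kernel_decomposition \<Omega> M ip K w0 d g \<Omega>0 KK" "kernel_decomposition \<Omega> M ip K w0 d g \<Omega>0' KK'" "i \<in> {1..d}"
    for \<Omega>0 KK \<Omega>0' KK' i
  proof -
    interpret A: kernel_decomposition_space M ip \<Omega> K w0 d g \<Omega>0 KK using that(1) by (rule sp)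
    interpret B: kernel_decomposition_space M ip \<Omega> K w0 d g \<Omega>0' KK' using that(2) by (rule sp)
    show ?thesis
    proof (rule ip_ext[OF A.KK_mem[OF that(3) A.nbhd(2)] B.KK_mem[OF that(3) B.nbhd(2)]])
      fix f assume f: "f \<in> M"
      \<comment> \<open>The coefficients supplied by the second decomposition are used to evaluate
        the vectors of the first.\<close>
      show "ip f (KK i w0) = ip f (KK' i w0)"
        by (rule A.ip_KK_eq[OF that(3) f B.holomorphic_near_ip_KK[OF _ f] B.expand[OF f]])
    qed
  qed
  have span: "cfun.span ((\<lambda>i. KK i w0) ` {1..d}) = cfun.span ((\<lambda>i. KK' i w0) ` {1..d'})"
    if "kernel_decomposition_space M ip \<Omega> K w0 d g \<Omega>0 KK" "kernel_decomposition_space M ip \<Omega> K w0 d' g' \<Omega>0' KK'"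
    for d' g' \<Omega>0 KK \<Omega>0' KK'
    unfolding cfun.span_eq
    using kernel_decomposition_space.span_KK_subset[OF that] kernel_decomposition_space.span_KK_subset[OF that(2,1)]
    by (rule conjI)
  show ?thesis
  proof (intro conjI allI impI ballI)
    show "\<exists>\<Omega>0 KK. kernel_decomposition \<Omega> M ip K w0 d g \<Omega>0 KK"
      by (rule kernel_decomposition_exists[OF assms(1,6) hol assms(5,7)])
  next
    fix \<Omega>0 KK assume "kernel_decomposition \<Omega> M ip K w0 d g \<Omega>0 KK"
    then show "\<exists>N. open N \<and> w0 \<in> N \<and> N \<subseteq> \<Omega>0 \<and> (\<forall>w\<in>N. linearly_independent_family {1..d} (\<lambda>i. KK i w))"
      by (rule kernel_decomposition_space.linearly_independent_near[OF sp hol_near])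
  qed (rule unique span[OF sp space] kernel_decomposition_space.adjoint_op_KK[OF sp _ mult]; assumption)+
qed

end
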